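(* Let $q$ be real, $q\neq0$, $q^2\neq 1$, and put $\mu=1-q^{-2}$. The algebra $B_q[SU_2]$ has a $4$-dimensional first order differential calculus $(\Omega^1,\mathrm{d})$, covariant under the adjoint coaction of $C_q[SL_2]$, in which $\Omega^1$ is free as a left module with basis of $1$-forms $(e_\alpha{}^\beta)=\begin{pmatrix}e_a&e_b\\ e_c&e_d\end{pmatrix}$ (so $e_c=e_2{}^1$) and with bimodule relations $$[e_a,\alpha]_q=[e_a,\beta]_{q^{-1}}=[e_c,\beta]_q=[e_b,\alpha]_{q^{-1}}=[e_b,\gamma]_q=0,$$ $$[e_a,\gamma]_q=\mu\alpha e_b,\quad [e_a,\delta]_{q^{-1}}=\mu\beta e_b+q\mu^2\alpha e_a,\quad [e_c,\alpha]_q=q^2\mu\beta e_a,\quad [e_b,\beta]_{q^{-1}}=\mu\alpha e_a,$$ $$[e_b,\delta]_q=q^2\mu\gamma e_a,\quad [e_d,\alpha]_{q^{-1}}=\mu\beta e_b,\quad [e_d,\beta]_q=\mu\alpha e_c+q\mu^2\beta e_a,\quad [e_d,\gamma]_{q^{-1}}=\mu(\delta-\alpha)e_b,$$ $$[e_d,\delta]_q=-\mu\beta e_b+q\mu^2(\delta-\alpha)e_a+\mu\gamma e_c,\quad [e_c,\gamma]_{q^{-1}}=\mu(\delta-\alpha)e_a+\mu\alpha e_d+q\mu^2\beta e_b,$$ $$[e_c,\delta]_{q^{-1}}=\mu(q^2-2)\beta e_a+q^2\mu\beta e_d+q\mu^2\alpha e_c .$$ The calculus is inner with $\theta=e_a+e_d$,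 i.e. $\mathrm{d}f=\mu^{-1}(\theta f-f\theta)$ for all $f\in B_q[SU_2]$.
   Context: Notation: $[x,y]_p=xy-p\,yx$. $B_q[SU_2]$: the unital complex algebra with generators $u=(u^a{}_b)=\begin{pmatrix}\alpha&\beta\\ \gamma&\delta\end{pmatrix}$ and relations $\beta\alpha=q^2\alpha\beta$, $\alpha\gamma=q^2\gamma\alpha$, $\delta\alpha=\alpha\delta$, $[\beta,\gamma]=(1-q^{-2})\alpha(\delta-\alpha)$, $[\delta,\beta]=(1-q^{-2})\alpha\beta$, $[\gamma,\delta]=(1-q^{-2})\gamma\alpha$, $\alpha\delta-q^2\gamma\beta=1$ (as a $*$-algebra $\gamma=\beta^*$, $\alpha^*=\alpha$, $\delta^*=\delta$). A first order differential calculus over an algebra $B$ is a $B$-bimodule $\Omega^1$ with a linear map $\mathrm{d}:B\to\Omega^1$ obeying $\mathrm{d}(fg)=(\mathrm{d}f)g+f\,\mathrm{d}g$ and such that $\Omega^1$ is spanned by elements $f\,\mathrm{d}g$. $C_q[SL_2]$: the Hopf algebra with matrix of generators $t=(t^i{}_j)=\begin{pmatrix}a&b\\ c&d\end{pmatrix}$, relations $ba=qab$, $ca=qac$, $db=qbd$, $dc=qcd$, $bc=cb$, $da-ad=(q-q^{-1})bc$, $ad-q^{-1}bc=1$, coproduct $\Delta t^i{}_j=\sum_k t^i{}_k\otimes t^k{}_j$, counit $\epsilon(t^i{}_j)=\delta^i_j$ and antipode $S$. Its right adjoint coaction on $B_q[SU_2]$ is the algebra in the category of right $C_q[SL_2]$-comodules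 determined by $u^i{}_j\mapsto \sum u^m{}_n\otimes (St^i{}_m)t^n{}_j$ (extended multiplicatively as a right comodule algebra structure), and on the basis $1$-forms it is $e_\alpha{}^\beta\mapsto\sum e_m{}^n\otimes t^m{}_\alpha\,St^\beta{}_n$. Covariance of the calculus means that these define a right coaction on $\Omega^1$ compatible with the bimodule structure and commuting with $\mathrm{d}$. *)

theory Defs
  imports
    Complex_Main
    "HOL-Library.Poly_Mapping"
    "HOL-Library.Numeral_Type"
    "HOL-Algebra.Module"
    "HOL-Algebra.QuotRing"
    "HOL-Algebra.Algebraic_Closure_Type"
begin

section \<open>Complex vector spaces and algebras\<close>

abbreviation complex_field :: "complex ring"
  where "complex_field \<equiv> ring_of_type_algebra"

locale complex_algebra = Module.module complex_field A + ring A for A (structure) +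
  assumes smult_mult_left:
      "\<lbrakk>x \<in> carrier A; y \<in> carrier A\<rbrakk> \<Longrightarrow> (c \<odot> x) \<otimes> y = c \<odot> (x \<otimes> y)"
    and smult_mult_right:
      "\<lbrakk>x \<in> carrier A; y \<in> carrier A\<rbrakk> \<Longrightarrow> x \<otimes> (c \<odot> y) = c \<odot> (x \<otimes> y)"

definition complex_linear ::
    "(complex, 'v, 'm) module_scheme \<Rightarrow> (complex, 'w, 'n) module_scheme \<Rightarrow> ('v \<Rightarrow> 'w) set"
  where "complex_linear V W = {f \<in> carrier V \<rightarrow> carrier W.
     (\<forall>x\<in>carrier V. \<forall>y\<in>carrier V. f (x \<oplus>\<^bsub>V\<^esub> y) = f x \<oplus>\<^bsub>W\<^esub> f y) \<and>
     (\<forall>c. \<forall>x\<in>carrier V. f (c \<odot>\<^bsub>V\<^esub> x) = c \<odot>\<^bsub>W\<^esub> f x)}"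

definition algebra_hom ::
    "(complex, 'v, 'm) module_scheme \<Rightarrow> (complex, 'w, 'n) module_scheme \<Rightarrow> ('v \<Rightarrow> 'w) set"
  where "algebra_hom A B = ring_hom A B \<inter> complex_linear A B"

definition opposite_algebra :: "(complex, 'a, 'm) module_scheme \<Rightarrow> (complex, 'a, 'm) module_scheme"
  where "opposite_algebra A = A\<lparr>monoid.mult := \<lambda>x y. y \<otimes>\<^bsub>A\<^esub> x\<rparr>"

definition complex_numbers :: "(complex, complex) module"
  where "complex_numbers = ring.extend complex_field (module.fields (*))"


section \<open>Algebras given by generators and relations\<close>

text \<open>The free unital algebra on \<open>'g\<close> is the monoid algebra of the free monoid on \<open>'g\<close>;
  the multiplication of finitely supported functions is the convolution product.\<close>

datatype 'g word = Word (letters: "'g list")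

instantiation word :: (type) monoid_add
begin

definition zero_word :: "'a word" where "0 = Word []"

definition plus_word :: "'a word \<Rightarrow> 'a word \<Rightarrow> 'a word"
  where "v + w = Word (letters v @ letters w)"

instance
  by standard (simp_all add: zero_word_def plus_word_def)

end

type_synonym 'g free_algebra = "'g word \<Rightarrow>\<^sub>0 complex"

definition free_gen :: "'g \<Rightarrow> 'g free_algebra"
  where "free_gen g = Poly_Mapping.single (Word [g]) 1"

definition free_scalar :: "complex \<Rightarrow> 'g free_algebra"
  where "free_scalar c = Poly_Mapping.single 0 c"

definition relation_ideal :: "'g free_algebra set \<Rightarrow> 'g free_algebra set"
  where "relation_ideal R = genideal ring_of_type_algebra R"

definition presented_class :: "'g free_algebra set \<Rightarrow> 'g free_algebra \<Rightarrow> 'g free_algebra set"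
  where "presented_class R p = relation_ideal R +>\<^bsub>ring_of_type_algebra\<^esub> p"

text \<open>The elements of \<open>R\<close> are set to zero. A scalar \<open>c\<close> acts as multiplication by \<open>c 1\<close>.\<close>

definition presented_algebra :: "'g free_algebra set \<Rightarrow> (complex, 'g free_algebra set) module"
  where "presented_algebra R =
    (let Q = ring_of_type_algebra Quot relation_ideal R
     in ring.extend Q (module.fields (\<lambda>c x. presented_class R (free_scalar c) \<otimes>\<^bsub>Q\<^esub> x)))"

definition presented_gen :: "'g free_algebra set \<Rightarrow> 'g \<Rightarrow> 'g free_algebra set"
  where "presented_gen R g = presented_class R (free_gen g)"

definition free_eval ::
    "(complex, 'a, 'm) module_scheme \<Rightarrow> ('g \<Rightarrow> 'a) \<Rightarrow> 'g free_algebra \<Rightarrow> 'a"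
  where "free_eval A \<phi> p =
    (\<Oplus>\<^bsub>A\<^esub>w\<in>Poly_Mapping.keys p.
       Poly_Mapping.lookup p w \<odot>\<^bsub>A\<^esub> foldr (\<lambda>g x. \<phi> g \<otimes>\<^bsub>A\<^esub> x) (letters w) \<one>\<^bsub>A\<^esub>)"

text \<open>The algebra homomorphism out of a presented algebra with prescribed values on the generators;
  meaningful when those values satisfy the relations, so that \<^const>\<open>free_eval\<close> is constant on
  classes.\<close>

definition presented_lift ::
    "(complex, 'a, 'm) module_scheme \<Rightarrow> ('g \<Rightarrow> 'a) \<Rightarrow> 'g free_algebra set \<Rightarrow> 'a"
  where "presented_lift A \<phi> x = the_elem (free_eval A \<phi> ` x)"


section \<open>Tensor products of complex vector spaces\<close>

text \<open>\<open>V \<otimes> W\<close> is the free vector space on \<open>carrier V \<times> carrier W\<close> modulo the subspace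
  \<open>tensor_null V W\<close> of bilinearity relations.\<close>

definition scale_fun :: "complex \<Rightarrow> ('s \<Rightarrow>\<^sub>0 complex) \<Rightarrow> ('s \<Rightarrow>\<^sub>0 complex)"
  where "scale_fun c p = Poly_Mapping.map ((*) c) p"

definition pure_pair :: "'v \<Rightarrow> 'w \<Rightarrow> ('v \<times> 'w \<Rightarrow>\<^sub>0 complex)"
  where "pure_pair v w = Poly_Mapping.single (v, w) 1"

inductive_set tensor_null ::
    "(complex, 'v, 'm) module_scheme \<Rightarrow> (complex, 'w, 'n) module_scheme \<Rightarrow> ('v \<times> 'w \<Rightarrow>\<^sub>0 complex) set"
  for V W
  where
    zero: "0 \<in> tensor_null V W"
  | add: "\<lbrakk>p \<in> tensor_null V W; r \<in> tensor_null V W\<rbrakk> \<Longrightarrow> p + r \<in> tensor_null V W"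
  | scale: "p \<in> tensor_null V W \<Longrightarrow> scale_fun c p \<in> tensor_null V W"
  | add_left: "\<lbrakk>v \<in> carrier V; v' \<in> carrier V; w \<in> carrier W\<rbrakk>
      \<Longrightarrow> pure_pair (v \<oplus>\<^bsub>V\<^esub> v') w - (pure_pair v w + pure_pair v' w) \<in> tensor_null V W"
  | add_right: "\<lbrakk>v \<in> carrier V; w \<in> carrier W; w' \<in> carrier W\<rbrakk>
      \<Longrightarrow> pure_pair v (w \<oplus>\<^bsub>W\<^esub> w') - (pure_pair v w + pure_pair v w') \<in> tensor_null V W"
  | scale_left: "\<lbrakk>v \<in> carrier V; w \<in> carrier W\<rbrakk>
      \<Longrightarrow> pure_pair (c \<odot>\<^bsub>V\<^esub> v) w - scale_fun c (pure_pair v w) \<in> tensor_null V W"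
  | scale_right: "\<lbrakk>v \<in> carrier V; w \<in> carrier W\<rbrakk>
      \<Longrightarrow> pure_pair v (c \<odot>\<^bsub>W\<^esub> w) - scale_fun c (pure_pair v w) \<in> tensor_null V W"

definition tensor_reps ::
    "(complex, 'v, 'm) module_scheme \<Rightarrow> (complex, 'w, 'n) module_scheme \<Rightarrow> ('v \<times> 'w \<Rightarrow>\<^sub>0 complex) set"
  where "tensor_reps V W = {p. Poly_Mapping.keys p \<subseteq> carrier V \<times> carrier W}"

type_synonym ('v, 'w) tensor = "('v \<times> 'w \<Rightarrow>\<^sub>0 complex) set"

definition tensor_class ::
    "(complex, 'v, 'm) module_scheme \<Rightarrow> (complex, 'w, 'n) module_scheme
      \<Rightarrow> ('v \<times> 'w \<Rightarrow>\<^sub>0 complex) \<Rightarrow> ('v, 'w) tensor"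
  where "tensor_class V W p = {p' \<in> tensor_reps V W. p' - p \<in> tensor_null V W}"

definition tens ::
    "(complex, 'v, 'm) module_scheme \<Rightarrow> (complex, 'w, 'n) module_scheme
      \<Rightarrow> 'v \<Rightarrow> 'w \<Rightarrow> ('v, 'w) tensor"
  where "tens V W v w = tensor_class V W (pure_pair v w)"

text \<open>For bilinear operations \<open>f : V \<times> V' \<rightarrow> V''\<close> and \<open>g : W \<times> W' \<rightarrow> W''\<close>, the operation
  \<open>(v \<otimes> w) (v' \<otimes> w') = f v v' \<otimes> g w w'\<close> from \<open>V \<otimes> W\<close> and \<open>V' \<otimes> W'\<close> to \<open>V'' \<otimes> W''\<close>;
  the first two arguments are \<open>V''\<close> and \<open>W''\<close>.\<close>

definition tensor_op ::
    "(complex, 'v2, 'm) module_scheme \<Rightarrow> (complex, 'w2, 'n) module_scheme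
      \<Rightarrow> ('v \<Rightarrow> 'v1 \<Rightarrow> 'v2) \<Rightarrow> ('w \<Rightarrow> 'w1 \<Rightarrow> 'w2)
      \<Rightarrow> ('v, 'w) tensor \<Rightarrow> ('v1, 'w1) tensor \<Rightarrow> ('v2, 'w2) tensor"
  where "tensor_op V W f g x y =
    (\<Union>p\<in>x. \<Union>r\<in>y. tensor_class V W
       (\<Sum>(v, w)\<in>Poly_Mapping.keys p. \<Sum>(v', w')\<in>Poly_Mapping.keys r.
          Poly_Mapping.single (f v v', g w w')
            (Poly_Mapping.lookup p (v, w) * Poly_Mapping.lookup r (v', w'))))"

text \<open>The vector space \<open>V \<otimes> W\<close>. Its \<open>mult\<close> and \<open>one\<close> are meaningful when \<open>V\<close> and \<open>W\<close> are
  algebras and then make it the tensor product algebra.\<close>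

definition tensor_space ::
    "(complex, 'v, 'm) module_scheme \<Rightarrow> (complex, 'w, 'n) module_scheme
      \<Rightarrow> (complex, ('v, 'w) tensor) module"
  where "tensor_space V W =
    \<lparr>carrier = tensor_class V W ` tensor_reps V W,
     monoid.mult = tensor_op V W (monoid.mult V) (monoid.mult W),
     one = tens V W \<one>\<^bsub>V\<^esub> \<one>\<^bsub>W\<^esub>,
     ring.zero = tensor_class V W 0,
     ring.add = (\<lambda>x y. \<Union>p\<in>x. \<Union>r\<in>y. tensor_class V W (p + r)),
     module.smult = (\<lambda>c x. \<Union>p\<in>x. tensor_class V W (scale_fun c p))\<rparr>"

text \<open>The linear map \<open>v \<otimes> w \<mapsto> \<phi> v w\<close> into \<open>Z\<close> induced by a bilinear map \<open>\<phi>\<close>.\<close>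

definition tensor_lift ::
    "(complex, 'z, 'm) module_scheme \<Rightarrow> ('v \<Rightarrow> 'w \<Rightarrow> 'z) \<Rightarrow> ('v, 'w) tensor \<Rightarrow> 'z"
  where "tensor_lift Z \<phi> x = the_elem
    ((\<lambda>p. \<Oplus>\<^bsub>Z\<^esub>k\<in>Poly_Mapping.keys p. Poly_Mapping.lookup p k \<odot>\<^bsub>Z\<^esub> \<phi> (fst k) (snd k)) ` x)"

definition tensor_map ::
    "(complex, 'v1, 'm) module_scheme \<Rightarrow> (complex, 'w1, 'n) module_scheme
      \<Rightarrow> ('v \<Rightarrow> 'v1) \<Rightarrow> ('w \<Rightarrow> 'w1) \<Rightarrow> ('v, 'w) tensor \<Rightarrow> ('v1, 'w1) tensor"
  where "tensor_map V W f g = tensor_lift (tensor_space V W) (\<lambda>v w. tens V W (f v) (g w))"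

definition tensor_assoc ::
    "(complex, 'u, 'l) module_scheme \<Rightarrow> (complex, 'v, 'm) module_scheme \<Rightarrow> (complex, 'w, 'n) module_scheme
      \<Rightarrow> (('u, 'v) tensor, 'w) tensor \<Rightarrow> ('u, ('v, 'w) tensor) tensor"
  where "tensor_assoc U V W =
    (let T = tensor_space U (tensor_space V W)
     in tensor_lift T (\<lambda>x w. tensor_lift T (\<lambda>u v. tens U (tensor_space V W) u (tens V W v w)) x))"


section \<open>Hopf algebras and their comodules\<close>

text \<open>The record carries the structure maps only; no axioms are imposed by it.\<close>

record 'h hopf_algebra = "(complex, 'h) module" +
  comult :: "'h \<Rightarrow> ('h, 'h) tensor"
  counit :: "'h \<Rightarrow> complex"
  antipode :: "'h \<Rightarrow> 'h"

locale right_comodule = Module.module complex_field V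
  for H :: "'h hopf_algebra" and V :: "(complex, 'v, 'm) module_scheme"
    and \<rho> :: "'v \<Rightarrow> ('v, 'h) tensor" +
  assumes coaction_linear: "\<rho> \<in> complex_linear V (tensor_space V H)"
    and coaction_coassoc: "v \<in> carrier V \<Longrightarrow>
      tensor_assoc V H H (tensor_map (tensor_space V H) H \<rho> id (\<rho> v))
        = tensor_map V (tensor_space H H) id (comult H) (\<rho> v)"
    and coaction_counit: "v \<in> carrier V \<Longrightarrow>
      tensor_lift V (\<lambda>v' h. counit H h \<odot>\<^bsub>V\<^esub> v') (\<rho> v) = v"

locale right_comodule_algebra = complex_algebra A + right_comodule H A \<rho>
  for H :: "'h hopf_algebra" and A :: "(complex, 'a, 'm) module_scheme"
    and \<rho> :: "'a \<Rightarrow> ('a, 'h) tensor" +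
  assumes coaction_algebra_hom: "\<rho> \<in> algebra_hom A (tensor_space A H)"


section \<open>First order differential calculi\<close>

text \<open>The \<open>mult\<close> and \<open>one\<close> fields inherited by this record are not used.\<close>

record ('b, 'w) bimodule = "(complex, 'w) module" +
  lact :: "'b \<Rightarrow> 'w \<Rightarrow> 'w"  (infixr \<open>\<triangleright>\<index>\<close> 70)
  ract :: "'w \<Rightarrow> 'b \<Rightarrow> 'w"  (infixl \<open>\<triangleleft>\<index>\<close> 70)

locale algebra_bimodule = B: complex_algebra B + Module.module complex_field \<Omega>
  for B :: "(complex, 'b, 'm) module_scheme" and \<Omega> :: "('b, 'w, 'n) bimodule_scheme" +
  assumes lact_closed: "\<lbrakk>f \<in> carrier B; \<omega> \<in> carrier \<Omega>\<rbrakk> \<Longrightarrow> f \<triangleright>\<^bsub>\<Omega>\<^esub> \<omega> \<in> carrier \<Omega>"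
    and ract_closed: "\<lbrakk>f \<in> carrier B; \<omega> \<in> carrier \<Omega>\<rbrakk> \<Longrightarrow> \<omega> \<triangleleft>\<^bsub>\<Omega>\<^esub> f \<in> carrier \<Omega>"
    and lact_add_left: "\<lbrakk>f \<in> carrier B; g \<in> carrier B; \<omega> \<in> carrier \<Omega>\<rbrakk>
      \<Longrightarrow> (f \<oplus>\<^bsub>B\<^esub> g) \<triangleright>\<^bsub>\<Omega>\<^esub> \<omega> = f \<triangleright>\<^bsub>\<Omega>\<^esub> \<omega> \<oplus>\<^bsub>\<Omega>\<^esub> g \<triangleright>\<^bsub>\<Omega>\<^esub> \<omega>"
    and lact_add_right: "\<lbrakk>f \<in> carrier B; \<omega> \<in> carrier \<Omega>; \<eta> \<in> carrier \<Omega>\<rbrakk>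
      \<Longrightarrow> f \<triangleright>\<^bsub>\<Omega>\<^esub> (\<omega> \<oplus>\<^bsub>\<Omega>\<^esub> \<eta>) = f \<triangleright>\<^bsub>\<Omega>\<^esub> \<omega> \<oplus>\<^bsub>\<Omega>\<^esub> f \<triangleright>\<^bsub>\<Omega>\<^esub> \<eta>"
    and ract_add_left: "\<lbrakk>f \<in> carrier B; \<omega> \<in> carrier \<Omega>; \<eta> \<in> carrier \<Omega>\<rbrakk>
      \<Longrightarrow> (\<omega> \<oplus>\<^bsub>\<Omega>\<^esub> \<eta>) \<triangleleft>\<^bsub>\<Omega>\<^esub> f = \<omega> \<triangleleft>\<^bsub>\<Omega>\<^esub> f \<oplus>\<^bsub>\<Omega>\<^esub> \<eta> \<triangleleft>\<^bsub>\<Omega>\<^esub> f"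
    and ract_add_right: "\<lbrakk>f \<in> carrier B; g \<in> carrier B; \<omega> \<in> carrier \<Omega>\<rbrakk>
      \<Longrightarrow> \<omega> \<triangleleft>\<^bsub>\<Omega>\<^esub> (f \<oplus>\<^bsub>B\<^esub> g) = \<omega> \<triangleleft>\<^bsub>\<Omega>\<^esub> f \<oplus>\<^bsub>\<Omega>\<^esub> \<omega> \<triangleleft>\<^bsub>\<Omega>\<^esub> g"
    and lact_smult_left: "\<lbrakk>f \<in> carrier B; \<omega> \<in> carrier \<Omega>\<rbrakk>
      \<Longrightarrow> (c \<odot>\<^bsub>B\<^esub> f) \<triangleright>\<^bsub>\<Omega>\<^esub> \<omega> = c \<odot>\<^bsub>\<Omega>\<^esub> (f \<triangleright>\<^bsub>\<Omega>\<^esub> \<omega>)"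
    and lact_smult_right: "\<lbrakk>f \<in> carrier B; \<omega> \<in> carrier \<Omega>\<rbrakk>
      \<Longrightarrow> f \<triangleright>\<^bsub>\<Omega>\<^esub> (c \<odot>\<^bsub>\<Omega>\<^esub> \<omega>) = c \<odot>\<^bsub>\<Omega>\<^esub> (f \<triangleright>\<^bsub>\<Omega>\<^esub> \<omega>)"
    and ract_smult_left: "\<lbrakk>f \<in> carrier B; \<omega> \<in> carrier \<Omega>\<rbrakk>
      \<Longrightarrow> (c \<odot>\<^bsub>\<Omega>\<^esub> \<omega>) \<triangleleft>\<^bsub>\<Omega>\<^esub> f = c \<odot>\<^bsub>\<Omega>\<^esub> (\<omega> \<triangleleft>\<^bsub>\<Omega>\<^esub> f)"
    and ract_smult_right: "\<lbrakk>f \<in> carrier B; \<omega> \<in> carrier \<Omega>\<rbrakk>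
      \<Longrightarrow> \<omega> \<triangleleft>\<^bsub>\<Omega>\<^esub> (c \<odot>\<^bsub>B\<^esub> f) = c \<odot>\<^bsub>\<Omega>\<^esub> (\<omega> \<triangleleft>\<^bsub>\<Omega>\<^esub> f)"
    and lact_one: "\<omega> \<in> carrier \<Omega> \<Longrightarrow> \<one>\<^bsub>B\<^esub> \<triangleright>\<^bsub>\<Omega>\<^esub> \<omega> = \<omega>"
    and ract_one: "\<omega> \<in> carrier \<Omega> \<Longrightarrow> \<omega> \<triangleleft>\<^bsub>\<Omega>\<^esub> \<one>\<^bsub>B\<^esub> = \<omega>"
    and lact_mult: "\<lbrakk>f \<in> carrier B; g \<in> carrier B; \<omega> \<in> carrier \<Omega>\<rbrakk>
      \<Longrightarrow> (f \<otimes>\<^bsub>B\<^esub> g) \<triangleright>\<^bsub>\<Omega>\<^esub> \<omega> = f \<triangleright>\<^bsub>\<Omega>\<^esub> (g \<triangleright>\<^bsub>\<Omega>\<^esub> \<omega>)"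
    and ract_mult: "\<lbrakk>f \<in> carrier B; g \<in> carrier B; \<omega> \<in> carrier \<Omega>\<rbrakk>
      \<Longrightarrow> \<omega> \<triangleleft>\<^bsub>\<Omega>\<^esub> (f \<otimes>\<^bsub>B\<^esub> g) = (\<omega> \<triangleleft>\<^bsub>\<Omega>\<^esub> f) \<triangleleft>\<^bsub>\<Omega>\<^esub> g"
    and lact_ract: "\<lbrakk>f \<in> carrier B; g \<in> carrier B; \<omega> \<in> carrier \<Omega>\<rbrakk>
      \<Longrightarrow> (f \<triangleright>\<^bsub>\<Omega>\<^esub> \<omega>) \<triangleleft>\<^bsub>\<Omega>\<^esub> g = f \<triangleright>\<^bsub>\<Omega>\<^esub> (\<omega> \<triangleleft>\<^bsub>\<Omega>\<^esub> g)"

locale first_order_calculus = algebra_bimodule B \<Omega>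
  for B :: "(complex, 'b, 'm) module_scheme" and \<Omega> :: "('b, 'w, 'n) bimodule_scheme"
    and d :: "'b \<Rightarrow> 'w" +
  assumes d_linear: "d \<in> complex_linear B \<Omega>"
    and leibniz: "\<lbrakk>f \<in> carrier B; g \<in> carrier B\<rbrakk>
      \<Longrightarrow> d (f \<otimes>\<^bsub>B\<^esub> g) = d f \<triangleleft>\<^bsub>\<Omega>\<^esub> g \<oplus>\<^bsub>\<Omega>\<^esub> f \<triangleright>\<^bsub>\<Omega>\<^esub> d g"
    and spanned: "\<omega> \<in> carrier \<Omega> \<Longrightarrow>
      \<exists>(n::nat) f g. f \<in> {..<n} \<rightarrow> carrier B \<and> g \<in> {..<n} \<rightarrow> carrier B \<and>
        \<omega> = (\<Oplus>\<^bsub>\<Omega>\<^esub>i\<in>{..<n}. f i \<triangleright>\<^bsub>\<Omega>\<^esub> d (g i))"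

text \<open>\<open>\<rho>\<close> is the coaction on \<open>B\<close>, and \<open>\<rho>\<Omega>\<close> the one on 1-forms; \<open>B \<otimes> H\<close> acts on \<open>\<Omega> \<otimes> H\<close> from
  either side factorwise.\<close>

locale covariant_calculus =
    first_order_calculus B \<Omega> d + right_comodule_algebra H B \<rho> + forms: right_comodule H \<Omega> \<rho>\<Omega>
  for H :: "'h hopf_algebra"
    and B :: "(complex, 'b, 'm) module_scheme" and \<rho> :: "'b \<Rightarrow> ('b, 'h) tensor"
    and \<Omega> :: "('b, 'w, 'n) bimodule_scheme" and d :: "'b \<Rightarrow> 'w" and \<rho>\<Omega> :: "'w \<Rightarrow> ('w, 'h) tensor" +
  assumes coaction_lact: "\<lbrakk>f \<in> carrier B; \<omega> \<in> carrier \<Omega>\<rbrakk>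
      \<Longrightarrow> \<rho>\<Omega> (f \<triangleright>\<^bsub>\<Omega>\<^esub> \<omega>) = tensor_op \<Omega> H (lact \<Omega>) (monoid.mult H) (\<rho> f) (\<rho>\<Omega> \<omega>)"
    and coaction_ract: "\<lbrakk>f \<in> carrier B; \<omega> \<in> carrier \<Omega>\<rbrakk>
      \<Longrightarrow> \<rho>\<Omega> (\<omega> \<triangleleft>\<^bsub>\<Omega>\<^esub> f) = tensor_op \<Omega> H (ract \<Omega>) (monoid.mult H) (\<rho>\<Omega> \<omega>) (\<rho> f)"
    and coaction_d: "f \<in> carrier B \<Longrightarrow> \<rho>\<Omega> (d f) = tensor_map \<Omega> H d id (\<rho> f)"

definition free_left_basis ::
    "(complex, 'b, 'm) module_scheme \<Rightarrow> ('b, 'w, 'n) bimodule_scheme \<Rightarrow> ('i::finite \<Rightarrow> 'j::finite \<Rightarrow> 'w) \<Rightarrow> bool"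
  where "free_left_basis B \<Omega> e \<longleftrightarrow>
    (\<forall>i j. e i j \<in> carrier \<Omega>) \<and>
    (\<forall>\<omega>\<in>carrier \<Omega>. \<exists>!f. (\<forall>i j. f i j \<in> carrier B) \<and>
       \<omega> = (\<Oplus>\<^bsub>\<Omega>\<^esub>i\<in>UNIV. \<Oplus>\<^bsub>\<Omega>\<^esub>j\<in>UNIV. f i j \<triangleright>\<^bsub>\<Omega>\<^esub> e i j))"

text \<open>\<open>[\<omega>, f]\<^sub>p = \<omega> f - p f \<omega>\<close> for a 1-form \<open>\<omega>\<close> and an algebra element \<open>f\<close>.\<close>

definition qcomm :: "('b, 'w, 'n) bimodule_scheme \<Rightarrow> real \<Rightarrow> 'w \<Rightarrow> 'b \<Rightarrow> 'w"
  where "qcomm \<Omega> p \<omega> f = \<omega> \<triangleleft>\<^bsub>\<Omega>\<^esub> f \<ominus>\<^bsub>\<Omega>\<^esub> complex_of_real p \<odot>\<^bsub>\<Omega>\<^esub> (f \<triangleright>\<^bsub>\<Omega>\<^esub> \<omega>)"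


section \<open>The algebra \<open>B\<^sub>q[SU\<^sub>2]\<close>\<close>

text \<open>Matrix entries are indexed by the two-element type \<open>2\<close>, whose elements are \<open>1\<close> and \<open>2\<close>
  (with \<open>2 = 0\<close>). The generator \<open>(i, j)\<close> is the entry in row \<open>i\<close> and column \<open>j\<close>.\<close>

definition BqSU2_relations :: "real \<Rightarrow> (2 \<times> 2) free_algebra set"
  where "BqSU2_relations q =
    (let \<alpha> = free_gen (1, 1); \<beta> = free_gen (1, 2); \<gamma> = free_gen (2, 1); \<delta> = free_gen (2, 2);
         s = (\<lambda>r::real. free_scalar (complex_of_real r)); \<mu> = 1 - 1 / q\<^sup>2
     in {\<beta> * \<alpha> - s (q\<^sup>2) * \<alpha> * \<beta>,
         \<alpha> * \<gamma> - s (q\<^sup>2) * \<gamma> * \<alpha>,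
         \<delta> * \<alpha> - \<alpha> * \<delta>,
         (\<beta> * \<gamma> - \<gamma> * \<beta>) - s \<mu> * \<alpha> * (\<delta> - \<alpha>),
         (\<delta> * \<beta> - \<beta> * \<delta>) - s \<mu> * \<alpha> * \<beta>,
         (\<gamma> * \<delta> - \<delta> * \<gamma>) - s \<mu> * \<gamma> * \<alpha>,
         (\<alpha> * \<delta> - s (q\<^sup>2) * \<gamma> * \<beta>) - 1})"

type_synonym bq = "(2 \<times> 2) free_algebra set"

definition BqSU2 :: "real \<Rightarrow> (complex, bq) module"
  where "BqSU2 q = presented_algebra (BqSU2_relations q)"

definition u_gen :: "real \<Rightarrow> 2 \<Rightarrow> 2 \<Rightarrow> bq"
  where "u_gen q i j = presented_gen (BqSU2_relations q) (i, j)"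


section \<open>The Hopf algebra \<open>C\<^sub>q[SL\<^sub>2]\<close>\<close>

definition CqSL2_relations :: "real \<Rightarrow> (2 \<times> 2) free_algebra set"
  where "CqSL2_relations q =
    (let a = free_gen (1, 1); b = free_gen (1, 2); c = free_gen (2, 1); d = free_gen (2, 2);
         s = (\<lambda>r::real. free_scalar (complex_of_real r))
     in {b * a - s q * a * b,
         c * a - s q * a * c,
         d * b - s q * b * d,
         d * c - s q * c * d,
         b * c - c * b,
         (d * a - a * d) - s (q - 1 / q) * b * c,
         (a * d - s (1 / q) * b * c) - 1})"

type_synonym cq = "(2 \<times> 2) free_algebra set"

definition CqSL2_algebra :: "real \<Rightarrow> (complex, cq) module"
  where "CqSL2_algebra q = presented_algebra (CqSL2_relations q)"

definition t_gen :: "real \<Rightarrow> 2 \<Rightarrow> 2 \<Rightarrow> cq"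
  where "t_gen q i j = presented_gen (CqSL2_relations q) (i, j)"

text \<open>The inverse of the matrix \<open>t\<close>: the antipode axioms force \<open>S t\<^sup>i\<^sub>j = (t\<^sup>-\<^sup>1)\<^sup>i\<^sub>j\<close>, that is
  \<open>S a = d\<close>, \<open>S b = - q b\<close>, \<open>S c = - q\<^sup>-\<^sup>1 c\<close>, \<open>S d = a\<close>.\<close>

definition t_inverse :: "real \<Rightarrow> 2 \<Rightarrow> 2 \<Rightarrow> cq"
  where "t_inverse q i j =
    (if i = j then (if i = 1 then t_gen q 2 2 else t_gen q 1 1)
     else if i = 1 then complex_of_real (- q) \<odot>\<^bsub>CqSL2_algebra q\<^esub> t_gen q 1 2
     else complex_of_real (- (1 / q)) \<odot>\<^bsub>CqSL2_algebra q\<^esub> t_gen q 2 1)"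

definition CqSL2 :: "real \<Rightarrow> cq hopf_algebra"
  where "CqSL2 q =
    (let H = CqSL2_algebra q; HH = tensor_space H H
     in module.extend H (hopf_algebra.fields
          (presented_lift HH (\<lambda>(i, j). \<Oplus>\<^bsub>HH\<^esub>k\<in>UNIV. tens H H (t_gen q i k) (t_gen q k j)))
          (presented_lift complex_numbers (\<lambda>(i, j). if i = j then 1 else 0))
          (presented_lift (opposite_algebra H) (\<lambda>(i, j). t_inverse q i j))))"

text \<open>The right adjoint coaction \<open>u\<^sup>i\<^sub>j \<mapsto> \<Sum> u\<^sup>m\<^sub>n \<otimes> (S t\<^sup>i\<^sub>m) t\<^sup>n\<^sub>j\<close>.\<close>

definition adjoint_coaction :: "real \<Rightarrow> bq \<Rightarrow> (bq, cq) tensor"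
  where "adjoint_coaction q =
    (let B = BqSU2 q; H = CqSL2 q; BH = tensor_space B H
     in presented_lift BH (\<lambda>(i, j). \<Oplus>\<^bsub>BH\<^esub>m\<in>UNIV. \<Oplus>\<^bsub>BH\<^esub>n\<in>UNIV.
          tens B H (u_gen q m n) (antipode H (t_gen q i m) \<otimes>\<^bsub>H\<^esub> t_gen q n j)))"


section \<open>The bimodule relations of the calculus\<close>

definition calculus_relations :: "real \<Rightarrow> (bq, 'w, 'n) bimodule_scheme \<Rightarrow> (2 \<Rightarrow> 2 \<Rightarrow> 'w) \<Rightarrow> bool"
  where "calculus_relations q \<Omega> e \<longleftrightarrow>
    (let B = BqSU2 q; \<mu> = 1 - 1 / q\<^sup>2; q' = 1 / q;
         \<alpha> = u_gen q 1 1; \<beta> = u_gen q 1 2; \<gamma> = u_gen q 2 1; \<delta> = u_gen q 2 2;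
         e\<^sub>a = e 1 1; e\<^sub>b = e 1 2; e\<^sub>c = e 2 1; e\<^sub>d = e 2 2;
         m = (\<lambda>(r::real) f \<omega>. complex_of_real r \<odot>\<^bsub>\<Omega>\<^esub> (f \<triangleright>\<^bsub>\<Omega>\<^esub> \<omega>))
     in qcomm \<Omega> q e\<^sub>a \<alpha> = \<zero>\<^bsub>\<Omega>\<^esub> \<and>
        qcomm \<Omega> q' e\<^sub>a \<beta> = \<zero>\<^bsub>\<Omega>\<^esub> \<and>
        qcomm \<Omega> q e\<^sub>c \<beta> = \<zero>\<^bsub>\<Omega>\<^esub> \<and>
        qcomm \<Omega> q' e\<^sub>b \<alpha> = \<zero>\<^bsub>\<Omega>\<^esub> \<and>
        qcomm \<Omega> q e\<^sub>b \<gamma> = \<zero>\<^bsub>\<Omega>\<^esub> \<and>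
        qcomm \<Omega> q e\<^sub>a \<gamma> = m \<mu> \<alpha> e\<^sub>b \<and>
        qcomm \<Omega> q' e\<^sub>a \<delta> = m \<mu> \<beta> e\<^sub>b \<oplus>\<^bsub>\<Omega>\<^esub> m (q * \<mu>\<^sup>2) \<alpha> e\<^sub>a \<and>
        qcomm \<Omega> q e\<^sub>c \<alpha> = m (q\<^sup>2 * \<mu>) \<beta> e\<^sub>a \<and>
        qcomm \<Omega> q' e\<^sub>b \<beta> = m \<mu> \<alpha> e\<^sub>a \<and>
        qcomm \<Omega> q e\<^sub>b \<delta> = m (q\<^sup>2 * \<mu>) \<gamma> e\<^sub>a \<and>
        qcomm \<Omega> q' e\<^sub>d \<alpha> = m \<mu> \<beta> e\<^sub>b \<and>
        qcomm \<Omega> q e\<^sub>d \<beta> = m \<mu> \<alpha> e\<^sub>c \<oplus>\<^bsub>\<Omega>\<^esub> m (q * \<mu>\<^sup>2) \<beta> e\<^sub>a \<and>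
        qcomm \<Omega> q' e\<^sub>d \<gamma> = m \<mu> (\<delta> \<ominus>\<^bsub>B\<^esub> \<alpha>) e\<^sub>b \<and>
        qcomm \<Omega> q e\<^sub>d \<delta> =
          m (- \<mu>) \<beta> e\<^sub>b \<oplus>\<^bsub>\<Omega>\<^esub> m (q * \<mu>\<^sup>2) (\<delta> \<ominus>\<^bsub>B\<^esub> \<alpha>) e\<^sub>a \<oplus>\<^bsub>\<Omega>\<^esub> m \<mu> \<gamma> e\<^sub>c \<and>
        qcomm \<Omega> q' e\<^sub>c \<gamma> =
          m \<mu> (\<delta> \<ominus>\<^bsub>B\<^esub> \<alpha>) e\<^sub>a \<oplus>\<^bsub>\<Omega>\<^esub> m \<mu> \<alpha> e\<^sub>d \<oplus>\<^bsub>\<Omega>\<^esub> m (q * \<mu>\<^sup>2) \<beta> e\<^sub>b \<and>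
        qcomm \<Omega> q' e\<^sub>c \<delta> =
          m (\<mu> * (q\<^sup>2 - 2)) \<beta> e\<^sub>a \<oplus>\<^bsub>\<Omega>\<^esub> m (q\<^sup>2 * \<mu>) \<beta> e\<^sub>d \<oplus>\<^bsub>\<Omega>\<^esub> m (q * \<mu>\<^sup>2) \<alpha> e\<^sub>c)"

end

theory Submission
  imports Defs
begin

text \<open>
  The one-forms are \<open>B\<^sup>4\<close> as a left module, with right multiplication given by an algebra homomorphism
  from \<open>B\<close> to the \<open>4 \<times> 4\<close> matrices over \<open>B\<close> whose values on generators are read off from the stated
  bimodule relations. An inner derivation always obeys the Leibniz rule, and the forms
  \<open>f dg\<close> span because suitable left combinations of the \<open>du\<^sub>x\<close> give \<open>e\<^sub>b\<close>, \<open>e\<^sub>c\<close> and two combinations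
  of \<open>e\<^sub>a\<close> and \<open>e\<^sub>d\<close> with nonzero determinant. Sending \<open>f e\<^sub>i\<close> to \<open>\<rho>(f) \<rho>(e\<^sub>i)\<close> defines a coaction; since \<open>\<theta>\<close> is
  coinvariant, it commutes with \<open>d\<close> as soon as it respects right multiplication, which need only be checked on
  generators. All the resulting identities in \<open>B\<close>, \<open>H\<close> and \<open>B \<otimes> H\<close>, with \<open>H = C\<^sub>q[SL\<^sub>2]\<close>, follow by rewriting words with the
  defining relations.
\<close>

section \<open>Complex vector spaces\<close>

text \<open>All algebras here are quotients, so an element has no preferred representative and a map
  is well defined only if it respects the relations. The universal property of a presentation
  reduces each such question (antipode, counit, coproduct, adjoint coaction, right action on forms)
  to finitely many identities between images of generators. Coefficients are integers times powers
  of a symbol that is later set to \<open>q\<close>, so one computation serves every nonzero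
  \<open>q\<close>. Each rewriting rule is an identity of the algebra; hence rewriting preserves
  values in whatever order it proceeds, and a difference that collapses to the empty list is zero.
  Freeness is built in: a form is its family of coefficients, and the content of the bimodule
  relations moves into the matrices of right multiplication. Spanning is where
  \<open>q^2 \<noteq> 1\<close> enters. Left multiplication by the entries of a quantum adjugate of
  u turns the rows of the du_x into scalar combinations of basis forms; what is left to invert are
  \<mu> and one two-by-two determinant, whose only nonzero real zeros are 1 and -1.\<close>

abbreviation cspace :: "(complex, 'v, 'm) module_scheme \<Rightarrow> bool"
  where "cspace V \<equiv> Module.module complex_field V"

lemma ring_of_type_algebra_simps [simp]:
  "carrier (ring_of_type_algebra :: 'a::ring_1 ring) = UNIV"
  "x \<oplus>\<^bsub>ring_of_type_algebra\<^esub> y = x + y"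
  "x \<otimes>\<^bsub>ring_of_type_algebra\<^esub> y = x * y"
  "\<one>\<^bsub>ring_of_type_algebra\<^esub> = (1 :: 'a)"
  "\<zero>\<^bsub>ring_of_type_algebra\<^esub> = (0 :: 'a)"
  by (simp_all add: ring_of_type_algebra_def)

lemma cspaceI:
  fixes V (structure)
  assumes "abelian_group V"
    and "\<And>c x. x \<in> carrier V \<Longrightarrow> c \<odot> x \<in> carrier V"
    and "\<And>c d x. x \<in> carrier V \<Longrightarrow> (c + d) \<odot> x = c \<odot> x \<oplus> d \<odot> x"
    and "\<And>c x y. x \<in> carrier V \<Longrightarrow> y \<in> carrier V \<Longrightarrow> c \<odot> (x \<oplus> y) = c \<odot> x \<oplus> c \<odot> y"
    and "\<And>c d x. x \<in> carrier V \<Longrightarrow> (c * d) \<odot> x = c \<odot> (d \<odot> x)"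
    and "\<And>x. x \<in> carrier V \<Longrightarrow> 1 \<odot> x = x"
  shows "cspace V"
  using assms by (intro moduleI cring_from_type_algebra) simp_all

lemma cspace_abelian_group: "cspace V \<Longrightarrow> abelian_group V"
  by (simp add: module_def)

lemma complex_algebra_cspace [simp]: "complex_algebra A \<Longrightarrow> cspace A"
  by (simp add: complex_algebra_def)

context
  fixes V :: "(complex, 'v, 'm) module_scheme" (structure)
  assumes V: "cspace V"
begin

interpretation Module.module complex_field V by (rule V)

lemma cs_closed [simp]:
  "\<zero> \<in> carrier V"
  "x \<in> carrier V \<Longrightarrow> y \<in> carrier V \<Longrightarrow> x \<oplus> y \<in> carrier V"
  "x \<in> carrier V \<Longrightarrow> \<ominus> x \<in> carrier V"
  "x \<in> carrier V \<Longrightarrow> y \<in> carrier V \<Longrightarrow> x \<ominus> y \<in> carrier V"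
  "x \<in> carrier V \<Longrightarrow> c \<odot> x \<in> carrier V"
  by simp_all

lemma cs_finsum_closed: "f \<in> S \<rightarrow> carrier V \<Longrightarrow> finsum V f S \<in> carrier V"
  by (rule M.finsum_closed)

lemma cs_assoc: "x \<in> carrier V \<Longrightarrow> y \<in> carrier V \<Longrightarrow> z \<in> carrier V \<Longrightarrow> x \<oplus> y \<oplus> z = x \<oplus> (y \<oplus> z)"
  by (rule M.a_assoc)

lemma cs_comm: "x \<in> carrier V \<Longrightarrow> y \<in> carrier V \<Longrightarrow> x \<oplus> y = y \<oplus> x"
  by (rule M.a_comm)

lemma cs_lcomm: "x \<in> carrier V \<Longrightarrow> y \<in> carrier V \<Longrightarrow> z \<in> carrier V \<Longrightarrow> x \<oplus> (y \<oplus> z) = y \<oplus> (x \<oplus> z)"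
  by (rule M.a_lcomm)

lemmas cs_ac = cs_assoc cs_comm cs_lcomm

lemma cs_zero [simp]:
  "x \<in> carrier V \<Longrightarrow> \<zero> \<oplus> x = x"
  "x \<in> carrier V \<Longrightarrow> x \<oplus> \<zero> = x"
  "x \<in> carrier V \<Longrightarrow> x \<ominus> x = \<zero>"
  "x \<in> carrier V \<Longrightarrow> x \<ominus> \<zero> = x"
  "c \<odot> \<zero> = \<zero>"
  "x \<in> carrier V \<Longrightarrow> 0 \<odot> x = \<zero>"
  "x \<in> carrier V \<Longrightarrow> 1 \<odot> x = x"
  "\<ominus> \<zero> = \<zero>"
  using smult_one[of x] smult_l_null[of x] by (simp_all add: a_minus_def M.r_neg)

lemma cs_distrib:
  "x \<in> carrier V \<Longrightarrow> (c + d) \<odot> x = c \<odot> x \<oplus> d \<odot> x"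
  "x \<in> carrier V \<Longrightarrow> y \<in> carrier V \<Longrightarrow> c \<odot> (x \<oplus> y) = c \<odot> x \<oplus> c \<odot> y"
  using smult_l_distr[of c d x] smult_r_distr[of c x y] by simp_all

lemma cs_smult_smult: "x \<in> carrier V \<Longrightarrow> c \<odot> (d \<odot> x) = (c * d) \<odot> x"
  using smult_assoc1[of c d x] by simp

lemma cs_neg: "x \<in> carrier V \<Longrightarrow> \<ominus> x = (- 1) \<odot> x"
proof -
  assume x: "x \<in> carrier V"
  have "(- 1) \<odot> x \<oplus> x = ((- 1) + 1) \<odot> x"
    using x cs_distrib(1)[of x "-1" 1] by simp
  then have "(- 1) \<odot> x \<oplus> x = \<zero>"
    using x by simp
  then show ?thesis
    using M.minus_equality[of "(- 1) \<odot> x" x] x by simp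
qed

lemma cs_minus: "x \<in> carrier V \<Longrightarrow> y \<in> carrier V \<Longrightarrow> x \<ominus> y = x \<oplus> (- 1) \<odot> y"
  by (simp add: a_minus_def cs_neg)

lemma cs_minus_eq_zero_iff:
  assumes "x \<in> carrier V" "y \<in> carrier V"
  shows "x \<ominus> y = \<zero> \<longleftrightarrow> x = y"
proof
  assume "x \<ominus> y = \<zero>"
  moreover have "x = (x \<ominus> y) \<oplus> y"
    using assms by (simp add: a_minus_def M.a_assoc M.l_neg)
  ultimately show "x = y"
    using assms by simp
qed (use assms in simp)

lemma cs_finsum_cong:
  "S = T \<Longrightarrow> g \<in> T \<rightarrow> carrier V \<Longrightarrow> (\<And>i. i \<in> T \<Longrightarrow> f i = g i) \<Longrightarrow> finsum V f S = finsum V g T"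
  by (rule M.finsum_cong')

lemma cs_finsum_add:
  "f \<in> S \<rightarrow> carrier V \<Longrightarrow> g \<in> S \<rightarrow> carrier V
    \<Longrightarrow> (\<Oplus>i\<in>S. f i \<oplus> g i) = finsum V f S \<oplus> finsum V g S"
  by (rule M.finsum_addf)

lemma cs_finsum_insert:
  "finite S \<Longrightarrow> s \<notin> S \<Longrightarrow> f \<in> S \<rightarrow> carrier V \<Longrightarrow> f s \<in> carrier V
    \<Longrightarrow> finsum V f (insert s S) = f s \<oplus> finsum V f S"
  by (rule M.finsum_insert)

lemma cs_finsum_empty [simp]: "finsum V f {} = \<zero>"
  by simp

lemma cs_finsum_zero: "(\<And>i. i \<in> S \<Longrightarrow> f i = \<zero>) \<Longrightarrow> finsum V f S = \<zero>"
  by (rule M.add.finprod_one_eqI)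

lemma cs_finsum_mono_neutral:
  assumes "finite T" "S \<subseteq> T" "\<And>i. i \<in> T - S \<Longrightarrow> f i = \<zero>" "f \<in> T \<rightarrow> carrier V"
  shows "finsum V f T = finsum V f S"
proof -
  have "finsum V f S \<oplus> finsum V f (T - S) = finsum V f (S \<union> (T - S))"
    using assms by (intro M.finsum_Un_disjoint[symmetric]) (auto intro: finite_subset)
  moreover have "finsum V f (T - S) = \<zero>"
    using assms by (intro cs_finsum_zero) auto
  moreover have "S \<union> (T - S) = T"
    using assms by auto
  moreover have "finsum V f S \<in> carrier V"
    using assms by (intro M.finsum_closed) auto
  ultimately show ?thesis
    by simp
qed

end

lemma complex_linear_closed: "f \<in> complex_linear V W \<Longrightarrow> x \<in> carrier V \<Longrightarrow> f x \<in> carrier W"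
  by (auto simp: complex_linear_def)

lemma complex_linear_add:
  "f \<in> complex_linear V W \<Longrightarrow> x \<in> carrier V \<Longrightarrow> y \<in> carrier V \<Longrightarrow> f (x \<oplus>\<^bsub>V\<^esub> y) = f x \<oplus>\<^bsub>W\<^esub> f y"
  by (auto simp: complex_linear_def)

lemma complex_linear_smult:
  "f \<in> complex_linear V W \<Longrightarrow> x \<in> carrier V \<Longrightarrow> f (c \<odot>\<^bsub>V\<^esub> x) = c \<odot>\<^bsub>W\<^esub> f x"
  by (auto simp: complex_linear_def)

lemmas complex_linearD = complex_linear_closed complex_linear_add complex_linear_smult

lemma complex_linearI:
  assumes "\<And>x. x \<in> carrier V \<Longrightarrow> f x \<in> carrier W"
    and "\<And>x y. x \<in> carrier V \<Longrightarrow> y \<in> carrier V \<Longrightarrow> f (x \<oplus>\<^bsub>V\<^esub> y) = f x \<oplus>\<^bsub>W\<^esub> f y"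
    and "\<And>c x. x \<in> carrier V \<Longrightarrow> f (c \<odot>\<^bsub>V\<^esub> x) = c \<odot>\<^bsub>W\<^esub> f x"
  shows "f \<in> complex_linear V W"
  using assms by (auto simp: complex_linear_def)

lemma complex_linear_id: "id \<in> complex_linear V V"
  by (auto simp: complex_linear_def)

lemma complex_linear_zero:
  assumes "cspace V" "cspace W" "f \<in> complex_linear V W"
  shows "f \<zero>\<^bsub>V\<^esub> = \<zero>\<^bsub>W\<^esub>"
proof -
  have "f (0 \<odot>\<^bsub>V\<^esub> \<zero>\<^bsub>V\<^esub>) = 0 \<odot>\<^bsub>W\<^esub> f \<zero>\<^bsub>V\<^esub>"
    using assms by (intro complex_linear_smult[OF assms(3)]) simp
  also have "\<dots> = \<zero>\<^bsub>W\<^esub>"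
    using assms by (intro cs_zero complex_linear_closed[OF assms(3)]) simp_all
  finally show ?thesis
    using assms by simp
qed

lemma complex_linear_comp:
  "f \<in> complex_linear V W \<Longrightarrow> g \<in> complex_linear W Z \<Longrightarrow> (\<lambda>x. g (f x)) \<in> complex_linear V Z"
  by (intro complex_linearI) (simp_all add: complex_linearD[of f] complex_linearD[of g])

lemma complex_linear_finsum:
  assumes "cspace V" "cspace W" "h \<in> complex_linear V W" "f \<in> S \<rightarrow> carrier V"
  shows "h (finsum V f S) = (\<Oplus>\<^bsub>W\<^esub>i\<in>S. h (f i))"
proof (cases "finite S")
  case True
  then show ?thesis
    using assms(4)
  proof (induction S rule: finite_induct)
    case (insert s S)
    have "(\<lambda>i. h (f i)) \<in> S \<rightarrow> carrier W" "h (f s) \<in> carrier W"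
      using insert.prems complex_linear_closed[OF assms(3)] by auto
    moreover have "h (f s \<oplus>\<^bsub>V\<^esub> finsum V f S) = h (f s) \<oplus>\<^bsub>W\<^esub> h (finsum V f S)"
      using insert.prems assms by (intro complex_linear_add[OF assms(3)] cs_finsum_closed) auto
    moreover have "f \<in> S \<rightarrow> carrier V" "f s \<in> carrier V"
      using insert.prems by auto
    ultimately show ?case
      using insert assms(1,2) by (simp add: cs_finsum_insert)
  qed (simp add: assms complex_linear_zero)
next
  case False
  interpret V: Module.module complex_field V by (rule assms)
  interpret W: Module.module complex_field W by (rule assms)
  show ?thesis
    using False assms by (simp add: V.finsum_infinite W.finsum_infinite complex_linear_zero)
qed

lemma smult_complex_linear: "cspace V \<Longrightarrow> (\<lambda>x. c \<odot>\<^bsub>V\<^esub> x) \<in> complex_linear V V"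
  by (rule complex_linearI) (simp_all add: cs_distrib cs_smult_smult mult.commute)

lemma cs_finsum_smult:
  assumes "cspace V" "f \<in> S \<rightarrow> carrier V"
  shows "c \<odot>\<^bsub>V\<^esub> finsum V f S = (\<Oplus>\<^bsub>V\<^esub>i\<in>S. c \<odot>\<^bsub>V\<^esub> f i)"
  by (rule complex_linear_finsum[OF assms(1) assms(1) smult_complex_linear[OF assms(1)] assms(2)])


section \<open>Linear extension of functions on a basis\<close>

lemma lookup_scale_fun [simp]: "Poly_Mapping.lookup (scale_fun c p) k = c * Poly_Mapping.lookup p k"
  by (simp add: scale_fun_def Poly_Mapping.map.rep_eq when_def)

lemma scale_fun_single [simp]: "scale_fun c (Poly_Mapping.single k d) = Poly_Mapping.single k (c * d)"
  by (rule poly_mapping_eqI) (simp add: lookup_single when_def)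

lemma scale_fun_zero [simp]: "scale_fun c 0 = 0"
  by (rule poly_mapping_eqI) simp

lemma scale_fun_add: "scale_fun c (p + r) = scale_fun c p + scale_fun c r"
  by (rule poly_mapping_eqI) (simp add: lookup_add algebra_simps)

lemma scale_fun_diff: "scale_fun c (p - r) = scale_fun c p - scale_fun c r"
  by (rule poly_mapping_eqI) (simp add: lookup_minus algebra_simps)

lemma scale_fun_neg_one: "scale_fun (- 1) p = - p"
  by (rule poly_mapping_eqI) simp

lemma scale_fun_one: "scale_fun 1 p = p"
  by (rule poly_mapping_eqI) simp

lemma scale_fun_scale_fun: "scale_fun c (scale_fun d p) = scale_fun (c * d) p"
  by (rule poly_mapping_eqI) simp

lemma scale_fun_add_left: "scale_fun (c + d) p = scale_fun c p + scale_fun d p"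
  by (rule poly_mapping_eqI) (simp add: lookup_add algebra_simps)

lemma keys_scale_fun: "Poly_Mapping.keys (scale_fun c p) \<subseteq> Poly_Mapping.keys p"
  by (auto simp: in_keys_iff)

lemma poly_mapping_expand:
  "p = (\<Sum>k\<in>Poly_Mapping.keys p. Poly_Mapping.single k (Poly_Mapping.lookup p k))"
proof (rule poly_mapping_eqI)
  fix k
  show "Poly_Mapping.lookup p k =
      Poly_Mapping.lookup (\<Sum>k\<in>Poly_Mapping.keys p. Poly_Mapping.single k (Poly_Mapping.lookup p k)) k"
    by (auto simp: lookup_sum lookup_single when_def in_keys_iff)
qed

lemma poly_mapping_induct_on [consumes 1, case_names zero single add]:
  fixes p :: "'s \<Rightarrow>\<^sub>0 'c::comm_monoid_add"
  assumes "Poly_Mapping.keys p \<subseteq> D" and "P 0"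
    and "\<And>k c. k \<in> D \<Longrightarrow> P (Poly_Mapping.single k c)"
    and "\<And>p r. P p \<Longrightarrow> P r \<Longrightarrow> Poly_Mapping.keys p \<subseteq> D \<Longrightarrow> Poly_Mapping.keys r \<subseteq> D \<Longrightarrow> P (p + r)"
  shows "P p"
proof -
  let ?s = "\<lambda>S. \<Sum>k\<in>S. Poly_Mapping.single k (Poly_Mapping.lookup p k)"
  have "P (?s S) \<and> Poly_Mapping.keys (?s S) \<subseteq> D" if "finite S" "S \<subseteq> D" for S
    using that
  proof (induction S rule: finite_induct)
    case (insert k S)
    have k: "Poly_Mapping.keys (Poly_Mapping.single k (Poly_Mapping.lookup p k)) \<subseteq> D"
      using insert.prems by (auto split: if_splits)
    moreover have "Poly_Mapping.keys (Poly_Mapping.single k (Poly_Mapping.lookup p k) + ?s S) \<subseteq> D"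
      using insert k Poly_Mapping.keys_add[of "Poly_Mapping.single k (Poly_Mapping.lookup p k)" "?s S"] by blast
    moreover have "P (Poly_Mapping.single k (Poly_Mapping.lookup p k))" "P (?s S)"
      "Poly_Mapping.keys (?s S) \<subseteq> D"
      using insert by (auto intro: assms)
    ultimately show ?case
      using insert by (auto intro!: assms(4))
  qed (simp add: assms)
  from this[of "Poly_Mapping.keys p"] assms(1) show ?thesis
    using poly_mapping_expand[of p] by simp
qed

text \<open>The common shape of \<open>free_eval\<close> and of the sum inside
  \<open>tensor_lift\<close>. The lemmas that follow control \<open>f\<close> only on a set
  \<open>D\<close>, because for tensors the pairs in the support have to lie in the
  carriers.\<close>

definition lin_ext :: "(complex, 'z, 'm) module_scheme \<Rightarrow> ('s \<Rightarrow> 'z) \<Rightarrow> ('s \<Rightarrow>\<^sub>0 complex) \<Rightarrow> 'z"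
  where "lin_ext Z f p = (\<Oplus>\<^bsub>Z\<^esub>k\<in>Poly_Mapping.keys p. Poly_Mapping.lookup p k \<odot>\<^bsub>Z\<^esub> f k)"

context
  fixes Z :: "(complex, 'z, 'm) module_scheme" (structure) and f :: "'s \<Rightarrow> 'z" and D :: "'s set"
  assumes Z: "cspace Z" and f: "f \<in> D \<rightarrow> carrier Z"
begin

lemma lin_ext_val: "k \<in> D \<Longrightarrow> f k \<in> carrier Z"
  using f by auto

lemma lin_ext_superset:
  assumes "finite S" "Poly_Mapping.keys p \<subseteq> S" "S \<subseteq> D"
  shows "lin_ext Z f p = (\<Oplus>k\<in>S. Poly_Mapping.lookup p k \<odot> f k)"
  unfolding lin_ext_def using assms Z lin_ext_val
  by (intro cs_finsum_mono_neutral[symmetric]) (auto simp: in_keys_iff subset_iff)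

lemma lin_ext_closed: "Poly_Mapping.keys p \<subseteq> D \<Longrightarrow> lin_ext Z f p \<in> carrier Z"
  unfolding lin_ext_def using lin_ext_val by (intro cs_finsum_closed[OF Z] Pi_I cs_closed(5)[OF Z]) auto

lemma lin_ext_add:
  assumes "Poly_Mapping.keys p \<subseteq> D" "Poly_Mapping.keys r \<subseteq> D"
  shows "lin_ext Z f (p + r) = lin_ext Z f p \<oplus> lin_ext Z f r"
proof -
  let ?S = "Poly_Mapping.keys p \<union> Poly_Mapping.keys r"
  have S: "finite ?S" "?S \<subseteq> D" "Poly_Mapping.keys (p + r) \<subseteq> ?S"
    using assms Poly_Mapping.keys_add[of p r] by auto
  have c: "f k \<in> carrier Z" if "k \<in> ?S" for k
    using that f S by auto
  have "lin_ext Z f (p + r) = (\<Oplus>k\<in>?S. Poly_Mapping.lookup p k \<odot> f k \<oplus> Poly_Mapping.lookup r k \<odot> f k)"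
    using S c Z by (subst lin_ext_superset[OF S(1,3,2)], intro cs_finsum_cong)
      (auto simp: lookup_add cs_distrib)
  also have "\<dots> = lin_ext Z f p \<oplus> lin_ext Z f r"
    using S c Z by (subst cs_finsum_add) (auto simp: lin_ext_superset[of ?S])
  finally show ?thesis .
qed

lemma lin_ext_scale:
  assumes "Poly_Mapping.keys p \<subseteq> D"
  shows "lin_ext Z f (scale_fun c p) = c \<odot> lin_ext Z f p"
proof -
  have c: "f k \<in> carrier Z" if "k \<in> Poly_Mapping.keys p" for k
    using that f assms by auto
  have "lin_ext Z f (scale_fun c p) = (\<Oplus>k\<in>Poly_Mapping.keys p. c \<odot> (Poly_Mapping.lookup p k \<odot> f k))"
    unfolding lin_ext_superset[OF finite_keys keys_scale_fun assms] using c Z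
    by (intro cs_finsum_cong) (auto simp: cs_smult_smult)
  also have "\<dots> = c \<odot> lin_ext Z f p"
    unfolding lin_ext_def using c Z by (intro cs_finsum_smult[symmetric]) auto
  finally show ?thesis .
qed

lemma lin_ext_zero: "lin_ext Z f 0 = \<zero>"
  using Z by (simp add: lin_ext_def)

lemma lin_ext_single: "k \<in> D \<Longrightarrow> lin_ext Z f (Poly_Mapping.single k c) = c \<odot> f k"
  using Z lin_ext_val[of k] lin_ext_superset[of "{k}" "Poly_Mapping.single k c"]
  by (simp add: cs_finsum_insert)

lemma lin_ext_diff:
  assumes "Poly_Mapping.keys p \<subseteq> D" "Poly_Mapping.keys r \<subseteq> D"
  shows "lin_ext Z f (p - r) = lin_ext Z f p \<ominus> lin_ext Z f r"
proof -
  have k: "Poly_Mapping.keys (scale_fun (- 1) r) \<subseteq> D"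
    using keys_scale_fun assms(2) by (rule order_trans)
  have "lin_ext Z f (p - r) = lin_ext Z f (p + scale_fun (- 1) r)"
    by (simp only: scale_fun_neg_one add_uminus_conv_diff)
  also have "\<dots> = lin_ext Z f p \<ominus> lin_ext Z f r"
    by (simp only: lin_ext_add[OF assms(1) k] lin_ext_scale[OF assms(2)]
        cs_minus[OF Z lin_ext_closed[OF assms(1)] lin_ext_closed[OF assms(2)]])
  finally show ?thesis .
qed

end

section \<open>Tensor products\<close>

definition complex_bilinear ::
    "(complex, 'u, 'k) module_scheme \<Rightarrow> (complex, 'v, 'l) module_scheme \<Rightarrow> (complex, 'w, 'm) module_scheme
      \<Rightarrow> ('u \<Rightarrow> 'v \<Rightarrow> 'w) set"
  where "complex_bilinear U V W =
    {f. (\<forall>x\<in>carrier U. f x \<in> complex_linear V W) \<and> (\<forall>y\<in>carrier V. (\<lambda>x. f x y) \<in> complex_linear U W)}"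

lemma complex_bilinearI:
  assumes "\<And>x. x \<in> carrier U \<Longrightarrow> f x \<in> complex_linear V W"
    and "\<And>y. y \<in> carrier V \<Longrightarrow> (\<lambda>x. f x y) \<in> complex_linear U W"
  shows "f \<in> complex_bilinear U V W"
  using assms by (auto simp: complex_bilinear_def)

lemma complex_bilinear_right: "f \<in> complex_bilinear U V W \<Longrightarrow> x \<in> carrier U \<Longrightarrow> f x \<in> complex_linear V W"
  by (auto simp: complex_bilinear_def)

lemma complex_bilinear_left:
  "f \<in> complex_bilinear U V W \<Longrightarrow> y \<in> carrier V \<Longrightarrow> (\<lambda>x. f x y) \<in> complex_linear U W"
  by (auto simp: complex_bilinear_def)

context
  fixes f U V W
  assumes f: "f \<in> complex_bilinear U V W"
begin

lemma complex_bilinear_closed: "x \<in> carrier U \<Longrightarrow> y \<in> carrier V \<Longrightarrow> f x y \<in> carrier W"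
  by (rule complex_linear_closed[OF complex_bilinear_right[OF f]])

lemma complex_bilinear_add_right:
  "x \<in> carrier U \<Longrightarrow> y \<in> carrier V \<Longrightarrow> z \<in> carrier V \<Longrightarrow> f x (y \<oplus>\<^bsub>V\<^esub> z) = f x y \<oplus>\<^bsub>W\<^esub> f x z"
  by (rule complex_linear_add[OF complex_bilinear_right[OF f]])

lemma complex_bilinear_add_left:
  "x \<in> carrier U \<Longrightarrow> y \<in> carrier U \<Longrightarrow> z \<in> carrier V \<Longrightarrow> f (x \<oplus>\<^bsub>U\<^esub> y) z = f x z \<oplus>\<^bsub>W\<^esub> f y z"
  by (rule complex_linear_add[OF complex_bilinear_left[OF f]])

lemma complex_bilinear_smult_right:
  "x \<in> carrier U \<Longrightarrow> y \<in> carrier V \<Longrightarrow> f x (c \<odot>\<^bsub>V\<^esub> y) = c \<odot>\<^bsub>W\<^esub> f x y"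
  by (rule complex_linear_smult[OF complex_bilinear_right[OF f]])

lemma complex_bilinear_smult_left:
  "x \<in> carrier U \<Longrightarrow> y \<in> carrier V \<Longrightarrow> f (c \<odot>\<^bsub>U\<^esub> x) y = c \<odot>\<^bsub>W\<^esub> f x y"
  by (rule complex_linear_smult[OF complex_bilinear_left[OF f]])

lemmas complex_bilinearD = complex_bilinear_closed complex_bilinear_add_right complex_bilinear_add_left
  complex_bilinear_smult_right complex_bilinear_smult_left

end

section \<open>The tensor product as a quotient: representatives and null combinations\<close>

lemma tensor_reps_zero [simp]: "0 \<in> tensor_reps V W"
  by (simp add: tensor_reps_def)

lemma tensor_reps_single [simp]:
  "v \<in> carrier V \<Longrightarrow> w \<in> carrier W \<Longrightarrow> Poly_Mapping.single (v, w) c \<in> tensor_reps V W"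
  by (simp add: tensor_reps_def)

lemma tensor_reps_pure [simp]:
  "v \<in> carrier V \<Longrightarrow> w \<in> carrier W \<Longrightarrow> pure_pair v w \<in> tensor_reps V W"
  by (simp add: pure_pair_def)

lemma tensor_reps_add [simp]:
  assumes "p \<in> tensor_reps V W" "r \<in> tensor_reps V W"
  shows "p + r \<in> tensor_reps V W"
  unfolding tensor_reps_def mem_Collect_eq
  by (rule order_trans[OF Poly_Mapping.keys_add]) (use assms in \<open>simp add: tensor_reps_def\<close>)

lemma tensor_reps_scale [simp]: "p \<in> tensor_reps V W \<Longrightarrow> scale_fun c p \<in> tensor_reps V W"
  unfolding tensor_reps_def mem_Collect_eq by (rule order_trans[OF keys_scale_fun])

lemma tensor_reps_diff [simp]:
  assumes "p \<in> tensor_reps V W" "r \<in> tensor_reps V W"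
  shows "p - r \<in> tensor_reps V W"
  using tensor_reps_add[OF assms(1) tensor_reps_scale[OF assms(2), of "- 1"]]
  by (simp add: scale_fun_neg_one)

lemma tensor_reps_sum [simp]:
  "(\<And>i. i \<in> S \<Longrightarrow> h i \<in> tensor_reps V W) \<Longrightarrow> sum h S \<in> tensor_reps V W"
  by (induction S rule: infinite_finite_induct) auto

lemma tensor_null_uminus: "p \<in> tensor_null V W \<Longrightarrow> - p \<in> tensor_null V W"
  using tensor_null.scale[of p V W "- 1"] by (simp add: scale_fun_neg_one)

lemma tensor_null_diff:
  "p \<in> tensor_null V W \<Longrightarrow> r \<in> tensor_null V W \<Longrightarrow> p - r \<in> tensor_null V W"
  using tensor_null.add[OF _ tensor_null_uminus, of p V W r] by simp

text \<open>The null space sees only carriers, sums and scalar multiples. This serves to identify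
  tensors over \<open>CqSL2_algebra q\<close> with tensors over \<open>CqSL2 q\<close>, two records
  of different type with the same operations.\<close>

lemma tensor_null_cong:
  assumes "carrier V = carrier V'" "carrier W = carrier W'"
    "(\<oplus>\<^bsub>V\<^esub>) = (\<oplus>\<^bsub>V'\<^esub>)" "(\<oplus>\<^bsub>W\<^esub>) = (\<oplus>\<^bsub>W'\<^esub>)" "(\<odot>\<^bsub>V\<^esub>) = (\<odot>\<^bsub>V'\<^esub>)" "(\<odot>\<^bsub>W\<^esub>) = (\<odot>\<^bsub>W'\<^esub>)"
  shows "tensor_null V W = tensor_null V' W'"
proof
  show "tensor_null V W \<subseteq> tensor_null V' W'"
  proof
    fix p assume "p \<in> tensor_null V W"
    then show "p \<in> tensor_null V' W'"
      by induction (simp_all add: assms tensor_null.intros)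
  qed
  show "tensor_null V' W' \<subseteq> tensor_null V W"
  proof
    fix p assume "p \<in> tensor_null V' W'"
    then show "p \<in> tensor_null V W"
      by induction (simp_all add: assms[symmetric] tensor_null.intros)
  qed
qed

lemma mem_tensor_class: "p \<in> tensor_reps V W \<Longrightarrow> p \<in> tensor_class V W p"
  by (simp add: tensor_class_def tensor_null.zero)

lemma tensor_class_eqI:
  assumes "p - r \<in> tensor_null V W"
  shows "tensor_class V W p = tensor_class V W r"
proof -
  have "p' - p \<in> tensor_null V W \<longleftrightarrow> p' - r \<in> tensor_null V W" for p'
    using tensor_null.add[OF _ assms, of "p' - p"] tensor_null_diff[OF _ assms, of "p' - r"] by auto
  then show ?thesis
    by (simp add: tensor_class_def)
qed

lemma mem_tensor_classD:
  "p' \<in> tensor_class V W p \<Longrightarrow> p' \<in> tensor_reps V W \<and> tensor_class V W p' = tensor_class V W p"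
  using tensor_class_eqI[of p' p V W] by (simp add: tensor_class_def)

text \<open>Operations on classes are unions over all choices of representatives. Once the result is
  the same for every choice, the union collapses to it; this is how well-definedness is used
  throughout.\<close>

lemma UN_constant_on: "x \<noteq> {} \<Longrightarrow> (\<And>p. p \<in> x \<Longrightarrow> F p = c) \<Longrightarrow> (\<Union>p\<in>x. F p) = c"
  by auto

lemma image_constant_on: "x \<noteq> {} \<Longrightarrow> (\<And>p. p \<in> x \<Longrightarrow> F p = c) \<Longrightarrow> F ` x = {c}"
  by auto

lemma tensor_space_simps:
  "carrier (tensor_space V W) = tensor_class V W ` tensor_reps V W"
  "(\<otimes>\<^bsub>tensor_space V W\<^esub>) = tensor_op V W (\<otimes>\<^bsub>V\<^esub>) (\<otimes>\<^bsub>W\<^esub>)"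
  "\<one>\<^bsub>tensor_space V W\<^esub> = tens V W \<one>\<^bsub>V\<^esub> \<one>\<^bsub>W\<^esub>"
  "\<zero>\<^bsub>tensor_space V W\<^esub> = tensor_class V W 0"
  by (simp_all add: tensor_space_def)

lemma tensor_space_ops:
  "x \<oplus>\<^bsub>tensor_space V W\<^esub> y = (\<Union>p\<in>x. \<Union>r\<in>y. tensor_class V W (p + r))"
  "c \<odot>\<^bsub>tensor_space V W\<^esub> x = (\<Union>p\<in>x. tensor_class V W (scale_fun c p))"
  by (simp_all add: tensor_space_def)

lemma tensor_class_nonempty: "p \<in> tensor_reps V W \<Longrightarrow> tensor_class V W p \<noteq> {}"
  using mem_tensor_class by blast

lemma tensor_add_class:
  assumes "p \<in> tensor_reps V W" "r \<in> tensor_reps V W"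
  shows "tensor_class V W p \<oplus>\<^bsub>tensor_space V W\<^esub> tensor_class V W r = tensor_class V W (p + r)"
proof -
  have "tensor_class V W (p' + r') = tensor_class V W (p + r)"
    if "p' \<in> tensor_class V W p" "r' \<in> tensor_class V W r" for p' r'
  proof (rule tensor_class_eqI)
    have "(p' - p) + (r' - r) \<in> tensor_null V W"
      using that by (intro tensor_null.add) (auto simp: tensor_class_def)
    then show "(p' + r') - (p + r) \<in> tensor_null V W"
      by (simp add: algebra_simps)
  qed
  then show ?thesis
    unfolding tensor_space_ops using assms
    by (intro UN_constant_on tensor_class_nonempty) simp_all
qed

lemma tensor_smult_class:
  assumes "p \<in> tensor_reps V W"
  shows "c \<odot>\<^bsub>tensor_space V W\<^esub> tensor_class V W p = tensor_class V W (scale_fun c p)"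
proof -
  have "tensor_class V W (scale_fun c p') = tensor_class V W (scale_fun c p)"
    if "p' \<in> tensor_class V W p" for p'
  proof (rule tensor_class_eqI)
    have "scale_fun c (p' - p) \<in> tensor_null V W"
      using that by (intro tensor_null.scale) (auto simp: tensor_class_def)
    then show "scale_fun c p' - scale_fun c p \<in> tensor_null V W"
      by (simp add: scale_fun_diff)
  qed
  then show ?thesis
    unfolding tensor_space_ops using assms
    by (intro UN_constant_on tensor_class_nonempty) simp_all
qed

lemma tensor_space_cspace [simp]: "cspace (tensor_space V W)"
proof (rule cspaceI)
  show "abelian_group (tensor_space V W)"
  proof (rule abelian_groupI)
    fix x assume "x \<in> carrier (tensor_space V W)"
    then obtain p where p: "p \<in> tensor_reps V W" "x = tensor_class V W p"
      by (auto simp: tensor_space_simps)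
    then have "tensor_class V W (scale_fun (- 1) p) \<oplus>\<^bsub>tensor_space V W\<^esub> x = \<zero>\<^bsub>tensor_space V W\<^esub>"
      by (simp add: tensor_add_class tensor_space_simps scale_fun_neg_one[symmetric])
        (simp add: scale_fun_neg_one)
    then show "\<exists>y\<in>carrier (tensor_space V W). y \<oplus>\<^bsub>tensor_space V W\<^esub> x = \<zero>\<^bsub>tensor_space V W\<^esub>"
      using p by (intro bexI) (auto simp: tensor_space_simps)
  qed (auto simp: tensor_space_simps tensor_add_class ac_simps)
qed (auto simp: tensor_space_simps tensor_add_class tensor_smult_class scale_fun_one scale_fun_add
      scale_fun_add_left scale_fun_scale_fun)

lemma tens_closed [simp]:
  "v \<in> carrier V \<Longrightarrow> w \<in> carrier W \<Longrightarrow> tens V W v w \<in> carrier (tensor_space V W)"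
  by (simp add: tens_def tensor_space_simps)

lemma tens_bilinear:
  assumes "cspace V" "cspace W"
  shows "tens V W \<in> complex_bilinear V W (tensor_space V W)"
  using assms
  by (intro complex_bilinearI complex_linearI)
    (simp_all, simp_all add: tens_def tensor_add_class tensor_smult_class, 
      auto intro!: tensor_class_eqI tensor_null.intros)

lemmas tens_simps = complex_bilinearD(2-5)[OF tens_bilinear]

lemma tensor_class_single:
  assumes "v \<in> carrier V" "w \<in> carrier W"
  shows "tensor_class V W (Poly_Mapping.single (v, w) c) = c \<odot>\<^bsub>tensor_space V W\<^esub> tens V W v w"
  using assms by (simp add: tens_def tensor_smult_class) (simp add: pure_pair_def)

lemma tensor_class_linear_sum:
  assumes "\<And>i. i \<in> S \<Longrightarrow> h i \<in> tensor_reps V W"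
  shows "tensor_class V W (sum h S) = (\<Oplus>\<^bsub>tensor_space V W\<^esub>i\<in>S. tensor_class V W (h i))"
proof (cases "finite S")
  case True
  then show ?thesis
    using assms
  proof (induction S rule: finite_induct)
    case (insert s S)
    have c: "tensor_class V W (h i) \<in> carrier (tensor_space V W)" if "i \<in> insert s S" for i
      using insert.prems[OF that] by (simp add: tensor_space_simps)
    have "tensor_class V W (sum h (insert s S))
        = tensor_class V W (h s) \<oplus>\<^bsub>tensor_space V W\<^esub> tensor_class V W (sum h S)"
      using insert.hyps insert.prems by (simp add: tensor_add_class)
    also have "\<dots> = (\<Oplus>\<^bsub>tensor_space V W\<^esub>i\<in>insert s S. tensor_class V W (h i))"
      using insert c by (subst cs_finsum_insert) auto
    finally show ?case .
  qed (simp add: tensor_space_simps[symmetric])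
next
  case False
  interpret Module.module complex_field "tensor_space V W" by simp
  show ?thesis
    using False by (simp add: finsum_infinite tensor_space_simps)
qed

text \<open>Pure tensors and sums suffice because a scalar can be absorbed into the left factor of a
  pure tensor.\<close>

lemma tensor_induct [consumes 3, case_names tens add]:
  assumes V: "cspace V" and W: "cspace W" and x: "x \<in> carrier (tensor_space V W)"
    and tens: "\<And>v w. v \<in> carrier V \<Longrightarrow> w \<in> carrier W \<Longrightarrow> P (tens V W v w)"
    and add: "\<And>x y. x \<in> carrier (tensor_space V W) \<Longrightarrow> y \<in> carrier (tensor_space V W)
      \<Longrightarrow> P x \<Longrightarrow> P y \<Longrightarrow> P (x \<oplus>\<^bsub>tensor_space V W\<^esub> y)"
  shows "P x"
proof -
  have smult: "P (c \<odot>\<^bsub>tensor_space V W\<^esub> tens V W v w)" if "v \<in> carrier V" "w \<in> carrier W" for c v w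
    using tens[of "c \<odot>\<^bsub>V\<^esub> v" w] that V W by (simp add: tens_simps)
  obtain p where p: "p \<in> tensor_reps V W" "x = tensor_class V W p"
    using x by (auto simp: tensor_space_simps)
  from p(1) have "Poly_Mapping.keys p \<subseteq> carrier V \<times> carrier W"
    by (simp add: tensor_reps_def)
  then have "P (tensor_class V W p)"
  proof (induction p rule: poly_mapping_induct_on)
    case zero
    show ?case
      using smult[of "\<zero>\<^bsub>V\<^esub>" "\<zero>\<^bsub>W\<^esub>" 0] V W by (simp add: tensor_space_simps(4))
  next
    case (single k c)
    then show ?case
      using smult[of "fst k" "snd k" c] tensor_class_single[of "fst k" V "snd k" W c] by auto
  next
    case (add p r)
    then have "p \<in> tensor_reps V W" "r \<in> tensor_reps V W"
      by (simp_all add: tensor_reps_def)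
    with add show ?case
      using assms(5)[of "tensor_class V W p" "tensor_class V W r"]
      by (simp add: tensor_add_class tensor_space_simps)
  qed
  with p show ?thesis
    by simp
qed

section \<open>The universal property: linear maps out of a tensor product\<close>

context
  fixes V :: "(complex, 'v, 'k) module_scheme" and W :: "(complex, 'w, 'l) module_scheme"
    and Z :: "(complex, 'z, 'm) module_scheme" and \<phi> :: "'v \<Rightarrow> 'w \<Rightarrow> 'z"
  assumes V: "cspace V" and W: "cspace W" and Z: "cspace Z" and \<phi>: "\<phi> \<in> complex_bilinear V W Z"
begin

private abbreviation "ev \<equiv> lin_ext Z (\<lambda>k. \<phi> (fst k) (snd k))"

private lemma ev_fun: "(\<lambda>k. \<phi> (fst k) (snd k)) \<in> carrier V \<times> carrier W \<rightarrow> carrier Z"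
  using complex_bilinear_closed[OF \<phi>] by auto

private lemmas ev_simps = lin_ext_add[OF Z ev_fun] lin_ext_diff[OF Z ev_fun] lin_ext_scale[OF Z ev_fun]
  lin_ext_zero[OF Z ev_fun]

private lemma reps_keys: "p \<in> tensor_reps V W \<Longrightarrow> Poly_Mapping.keys p \<subseteq> carrier V \<times> carrier W"
  by (simp add: tensor_reps_def)

private lemma ev_pure: "v \<in> carrier V \<Longrightarrow> w \<in> carrier W \<Longrightarrow> ev (pure_pair v w) = \<phi> v w"
  using complex_bilinear_closed[OF \<phi>] by (simp add: pure_pair_def lin_ext_single[OF Z ev_fun] Z)

text \<open>The generators of the null space are the defects of bilinearity, which a bilinear map
  annihilates. The support condition is carried along because linear extension is known to be
  additive only for supports inside the carriers.\<close>

private lemma ev_null: "p \<in> tensor_null V W \<Longrightarrow> p \<in> tensor_reps V W \<and> ev p = \<zero>\<^bsub>Z\<^esub>"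
proof (induction rule: tensor_null.induct)
  case zero
  then show ?case by (simp add: ev_simps)
next
  case (add p r)
  then show ?case by (simp add: ev_simps reps_keys Z)
next
  case (scale p c)
  then show ?case by (simp add: ev_simps reps_keys Z)
next
  case (add_left v v' w)
  then show ?case
    using complex_bilinearD[OF \<phi>]
    by (simp add: ev_simps reps_keys Z V W ev_pure)
next
  case (add_right v w w')
  then show ?case
    using complex_bilinearD[OF \<phi>]
    by (simp add: ev_simps reps_keys Z V W ev_pure)
next
  case (scale_left v w c)
  then show ?case
    using complex_bilinearD[OF \<phi>]
    by (simp add: ev_simps reps_keys Z V W ev_pure)
next
  case (scale_right v w c)
  then show ?case
    using complex_bilinearD[OF \<phi>]
    by (simp add: ev_simps reps_keys Z V W ev_pure)
qed

lemma tensor_lift_class: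
  assumes "p \<in> tensor_reps V W"
  shows "tensor_lift Z \<phi> (tensor_class V W p) = lin_ext Z (\<lambda>k. \<phi> (fst k) (snd k)) p"
proof -
  have "ev p' = ev p" if "p' \<in> tensor_class V W p" for p'
  proof -
    have p': "p' \<in> tensor_reps V W" "p' - p \<in> tensor_null V W"
      using that by (simp_all add: tensor_class_def)
    have "ev p' \<ominus>\<^bsub>Z\<^esub> ev p = ev (p' - p)"
      by (rule ev_simps(2)[OF reps_keys[OF p'(1)] reps_keys[OF assms], symmetric])
    also have "\<dots> = \<zero>\<^bsub>Z\<^esub>"
      using ev_null[OF p'(2)] by (rule conjunct2)
    finally show ?thesis
      by (rule iffD1[OF cs_minus_eq_zero_iff[OF Z lin_ext_closed[OF Z ev_fun reps_keys[OF p'(1)]]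
            lin_ext_closed[OF Z ev_fun reps_keys[OF assms]]]])
  qed
  then have "ev ` tensor_class V W p = {ev p}"
    by (intro image_constant_on tensor_class_nonempty[OF assms])
  then show ?thesis
    by (simp add: tensor_lift_def lin_ext_def[abs_def])
qed

lemma tensor_lift_linear: "tensor_lift Z \<phi> \<in> complex_linear (tensor_space V W) Z"
  by (rule complex_linearI)
    (auto simp: tensor_space_simps tensor_add_class tensor_smult_class tensor_lift_class reps_keys
      ev_simps lin_ext_closed[OF Z ev_fun])

lemma tensor_lift_tens: "v \<in> carrier V \<Longrightarrow> w \<in> carrier W \<Longrightarrow> tensor_lift Z \<phi> (tens V W v w) = \<phi> v w"
  by (simp add: tens_def tensor_lift_class ev_pure)

end

lemma complex_bilinear_comp:
  assumes "\<phi> \<in> complex_bilinear U' V' Z" "h \<in> complex_linear U U'" "k \<in> complex_linear V V'"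
  shows "(\<lambda>x y. \<phi> (h x) (k y)) \<in> complex_bilinear U V Z"
  by (intro complex_bilinearI complex_linearI)
    (simp_all add: complex_linearD[OF assms(2)] complex_linearD[OF assms(3)] complex_bilinearD[OF assms(1)])

section \<open>Factorwise products of two bilinear operations\<close>

context
  fixes V :: "(complex, 'v, 'k) module_scheme" and V1 :: "(complex, 'v1, 'k1) module_scheme"
    and V2 :: "(complex, 'v2, 'k2) module_scheme" and W :: "(complex, 'w, 'l) module_scheme"
    and W1 :: "(complex, 'w1, 'l1) module_scheme" and W2 :: "(complex, 'w2, 'l2) module_scheme"
    and f :: "'v \<Rightarrow> 'v1 \<Rightarrow> 'v2" and g :: "'w \<Rightarrow> 'w1 \<Rightarrow> 'w2"
  assumes f: "f \<in> complex_bilinear V V1 V2" and g: "g \<in> complex_bilinear W W1 W2"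
    and V: "cspace V" and V1: "cspace V1" and V2: "cspace V2"
    and W: "cspace W" and W1: "cspace W1" and W2: "cspace W2"
begin

private abbreviation "T \<equiv> tensor_space V2 W2"

private abbreviation "\<psi> v w \<equiv> tensor_lift T (\<lambda>v' w'. tens V2 W2 (f v v') (g w w'))"

private abbreviation "\<Phi> x y \<equiv> tensor_lift T (\<lambda>v w. \<psi> v w y) x"

private lemma inner_bilinear:
  assumes "v \<in> carrier V" "w \<in> carrier W"
  shows "(\<lambda>v' w'. tens V2 W2 (f v v') (g w w')) \<in> complex_bilinear V1 W1 T"
  by (rule complex_bilinear_comp[OF tens_bilinear[OF V2 W2] complex_bilinear_right[OF f assms(1)]
        complex_bilinear_right[OF g assms(2)]])

private lemmas psi_linear = tensor_lift_linear[OF V1 W1 tensor_space_cspace inner_bilinear]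
private lemmas psi_tens = tensor_lift_tens[OF V1 W1 tensor_space_cspace inner_bilinear]

text \<open>The argument \<open>y\<close> is a class, so the laws in \<open>v\<close> and
  \<open>w\<close> are first seen on pure tensors \<open>y\<close>, where they are the bilinearity
  of \<open>f\<close>, \<open>g\<close> and \<open>tens\<close>, and then pass to sums.\<close>

private lemma psi_bilinear:
  assumes "y \<in> carrier (tensor_space V1 W1)"
  shows "(\<lambda>v w. \<psi> v w y) \<in> complex_bilinear V W T"
proof -
  note fg = complex_bilinearD[OF f] complex_bilinearD[OF g]
  note psi = complex_linearD[OF psi_linear] psi_tens
  note t = tens_simps[OF V2 W2]
  have c: "\<psi> v w y \<in> carrier T" if "v \<in> carrier V" "w \<in> carrier W" for v w
    using that assms by (intro psi(1))
  have "\<psi> (v \<oplus>\<^bsub>V\<^esub> u) w y = \<psi> v w y \<oplus>\<^bsub>T\<^esub> \<psi> u w y"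
    if "v \<in> carrier V" "u \<in> carrier V" "w \<in> carrier W" for v u w
    using V1 W1 assms
    by (induction y rule: tensor_induct) (simp_all add: that V psi fg t cs_ac[OF tensor_space_cspace])
  moreover have "\<psi> v (w \<oplus>\<^bsub>W\<^esub> u) y = \<psi> v w y \<oplus>\<^bsub>T\<^esub> \<psi> v u y"
    if "v \<in> carrier V" "w \<in> carrier W" "u \<in> carrier W" for v u w
    using V1 W1 assms
    by (induction y rule: tensor_induct) (simp_all add: that W psi fg t cs_ac[OF tensor_space_cspace])
  moreover have "\<psi> (c \<odot>\<^bsub>V\<^esub> v) w y = c \<odot>\<^bsub>T\<^esub> \<psi> v w y" if "v \<in> carrier V" "w \<in> carrier W" for c v w
    using V1 W1 assms
    by (induction y rule: tensor_induct) (simp_all add: that V psi fg t cs_distrib[OF tensor_space_cspace])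
  moreover have "\<psi> v (c \<odot>\<^bsub>W\<^esub> w) y = c \<odot>\<^bsub>T\<^esub> \<psi> v w y" if "v \<in> carrier V" "w \<in> carrier W" for c v w
    using V1 W1 assms
    by (induction y rule: tensor_induct) (simp_all add: that W psi fg t cs_distrib[OF tensor_space_cspace])
  ultimately show ?thesis
    using c by (intro complex_bilinearI complex_linearI)
qed

private lemmas Phi_linear = tensor_lift_linear[OF V W tensor_space_cspace psi_bilinear]
private lemmas Phi_tens = tensor_lift_tens[OF V W tensor_space_cspace psi_bilinear]

private lemma Phi_bilinear: "(\<lambda>x y. \<Phi> x y) \<in> complex_bilinear (tensor_space V W) (tensor_space V1 W1) T"
proof (rule complex_bilinearI)
  fix y assume y: "y \<in> carrier (tensor_space V1 W1)"
  then show "(\<lambda>x. \<Phi> x y) \<in> complex_linear (tensor_space V W) T"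
    by (rule Phi_linear)
next
  note psi = complex_linearD[OF psi_linear]
  note Phi = complex_linearD[OF Phi_linear] Phi_tens
  fix x assume x: "x \<in> carrier (tensor_space V W)"
  have "\<Phi> x (y \<oplus>\<^bsub>tensor_space V1 W1\<^esub> z) = \<Phi> x y \<oplus>\<^bsub>T\<^esub> \<Phi> x z"
    if "y \<in> carrier (tensor_space V1 W1)" "z \<in> carrier (tensor_space V1 W1)" for y z
    using V W x
    by (induction x rule: tensor_induct) (simp_all add: that psi Phi cs_ac[OF tensor_space_cspace])
  moreover have "\<Phi> x (c \<odot>\<^bsub>tensor_space V1 W1\<^esub> y) = c \<odot>\<^bsub>T\<^esub> \<Phi> x y"
    if "y \<in> carrier (tensor_space V1 W1)" for y c
    using V W x
    by (induction x rule: tensor_induct) (simp_all add: that psi Phi cs_distrib[OF tensor_space_cspace])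
  ultimately show "\<Phi> x \<in> complex_linear (tensor_space V1 W1) T"
    using x Phi(1) by (intro complex_linearI)
qed

private lemma tensor_op_class:
  assumes p: "p \<in> tensor_reps V W" and r: "r \<in> tensor_reps V1 W1"
  shows "tensor_class V2 W2
       (\<Sum>(v, w)\<in>Poly_Mapping.keys p. \<Sum>(v', w')\<in>Poly_Mapping.keys r.
          Poly_Mapping.single (f v v', g w w')
            (Poly_Mapping.lookup p (v, w) * Poly_Mapping.lookup r (v', w')))
    = \<Phi> (tensor_class V W p) (tensor_class V1 W1 r)"
proof -
  let ?P = "Poly_Mapping.lookup p" and ?R = "Poly_Mapping.lookup r"
  let ?t = "\<lambda>k l. tens V2 W2 (f (fst k) (fst l)) (g (snd k) (snd l))"
  let ?s = "\<lambda>k l. Poly_Mapping.single (f (fst k) (fst l), g (snd k) (snd l)) (?P k * ?R l)"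
  have k: "fst k \<in> carrier V" "snd k \<in> carrier W" if "k \<in> Poly_Mapping.keys p" for k
    using p that by (auto simp: tensor_reps_def)
  have l: "fst l \<in> carrier V1" "snd l \<in> carrier W1" if "l \<in> Poly_Mapping.keys r" for l
    using r that by (auto simp: tensor_reps_def)
  note c = complex_bilinear_closed[OF f] complex_bilinear_closed[OF g]
  have t: "?t k l \<in> carrier T" if "k \<in> Poly_Mapping.keys p" "l \<in> Poly_Mapping.keys r" for k l
    using k[OF that(1)] l[OF that(2)] by (simp add: c)
  have s: "?s k l \<in> tensor_reps V2 W2" if "k \<in> Poly_Mapping.keys p" "l \<in> Poly_Mapping.keys r" for k l
    using k[OF that(1)] l[OF that(2)] by (simp add: c)
  have class_r: "tensor_class V1 W1 r \<in> carrier (tensor_space V1 W1)"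
    using r by (simp add: tensor_space_simps)
  have inner: "tensor_class V2 W2 (\<Sum>l\<in>Poly_Mapping.keys r. ?s k l)
      = ?P k \<odot>\<^bsub>T\<^esub> \<psi> (fst k) (snd k) (tensor_class V1 W1 r)"
    if kp: "k \<in> Poly_Mapping.keys p" for k
  proof -
    have "tensor_class V2 W2 (\<Sum>l\<in>Poly_Mapping.keys r. ?s k l)
        = (\<Oplus>\<^bsub>T\<^esub>l\<in>Poly_Mapping.keys r. tensor_class V2 W2 (?s k l))"
      using s[OF kp] by (rule tensor_class_linear_sum)
    also have "\<dots> = (\<Oplus>\<^bsub>T\<^esub>l\<in>Poly_Mapping.keys r. ?P k \<odot>\<^bsub>T\<^esub> (?R l \<odot>\<^bsub>T\<^esub> ?t k l))"
    proof (intro cs_finsum_cong[OF tensor_space_cspace] refl Pi_I)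
      fix l assume lr: "l \<in> Poly_Mapping.keys r"
      show "tensor_class V2 W2 (?s k l) = ?P k \<odot>\<^bsub>T\<^esub> (?R l \<odot>\<^bsub>T\<^esub> ?t k l)"
        using k[OF kp] l[OF lr] by (simp add: c tensor_class_single cs_smult_smult[OF tensor_space_cspace])
      show "?P k \<odot>\<^bsub>T\<^esub> (?R l \<odot>\<^bsub>T\<^esub> ?t k l) \<in> carrier T"
        using t[OF kp lr] by simp
    qed
    also have "\<dots> = ?P k \<odot>\<^bsub>T\<^esub> (\<Oplus>\<^bsub>T\<^esub>l\<in>Poly_Mapping.keys r. ?R l \<odot>\<^bsub>T\<^esub> ?t k l)"
      using t[OF kp] by (intro cs_finsum_smult[symmetric] Pi_I) simp_all
    also have "\<dots> = ?P k \<odot>\<^bsub>T\<^esub> \<psi> (fst k) (snd k) (tensor_class V1 W1 r)"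
      by (subst tensor_lift_class[OF V1 W1 tensor_space_cspace inner_bilinear[OF k[OF kp]] r])
        (simp add: lin_ext_def)
    finally show ?thesis .
  qed
  have "tensor_class V2 W2 (\<Sum>k\<in>Poly_Mapping.keys p. \<Sum>l\<in>Poly_Mapping.keys r. ?s k l)
      = (\<Oplus>\<^bsub>T\<^esub>k\<in>Poly_Mapping.keys p. tensor_class V2 W2 (\<Sum>l\<in>Poly_Mapping.keys r. ?s k l))"
    using s by (intro tensor_class_linear_sum tensor_reps_sum)
  also have "\<dots> = (\<Oplus>\<^bsub>T\<^esub>k\<in>Poly_Mapping.keys p. ?P k \<odot>\<^bsub>T\<^esub> \<psi> (fst k) (snd k) (tensor_class V1 W1 r))"
    using k complex_linear_closed[OF psi_linear class_r] inner
    by (intro cs_finsum_cong[OF tensor_space_cspace] refl Pi_I) simp_all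
  also have "\<dots> = \<Phi> (tensor_class V W p) (tensor_class V1 W1 r)"
    by (simp only: tensor_lift_class[OF V W tensor_space_cspace psi_bilinear[OF class_r] p] lin_ext_def)
  finally show ?thesis
    by (simp add: case_prod_beta)
qed

text \<open>Two nested applications of the universal property give the operation that is defined
  through representatives; bilinearity and the value on pure tensors then come for free.\<close>

lemma tensor_op_eq_lift:
  assumes "x \<in> carrier (tensor_space V W)" "y \<in> carrier (tensor_space V1 W1)"
  shows "tensor_op V2 W2 f g x y = \<Phi> x y"
proof -
  obtain p r where p: "p \<in> tensor_reps V W" "x = tensor_class V W p"
    and r: "r \<in> tensor_reps V1 W1" "y = tensor_class V1 W1 r"
    using assms by (auto simp: tensor_space_simps)
  have "tensor_class V2 W2
       (\<Sum>(v, w)\<in>Poly_Mapping.keys p'. \<Sum>(v', w')\<in>Poly_Mapping.keys r'.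
          Poly_Mapping.single (f v v', g w w')
            (Poly_Mapping.lookup p' (v, w) * Poly_Mapping.lookup r' (v', w'))) = \<Phi> x y"
    if "p' \<in> x" "r' \<in> y" for p' r'
    using tensor_op_class[of p' r'] mem_tensor_classD[of p' V W p] mem_tensor_classD[of r' V1 W1 r] that p r
    by simp
  then show ?thesis
    unfolding tensor_op_def using tensor_class_nonempty[OF p(1)] tensor_class_nonempty[OF r(1)] p(2) r(2)
    by (intro UN_constant_on) simp_all
qed

lemma tensor_op_bilinear:
  "tensor_op V2 W2 f g \<in> complex_bilinear (tensor_space V W) (tensor_space V1 W1) (tensor_space V2 W2)"
  by (intro complex_bilinearI complex_linearI)
    (simp_all add: tensor_op_eq_lift complex_bilinearD[OF Phi_bilinear])

lemma tensor_op_tens: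
  assumes "v \<in> carrier V" "w \<in> carrier W" "v' \<in> carrier V1" "w' \<in> carrier W1"
  shows "tensor_op V2 W2 f g (tens V W v w) (tens V1 W1 v' w') = tens V2 W2 (f v v') (g w w')"
  using assms by (simp add: tensor_op_eq_lift Phi_tens psi_tens)

end

text \<open>Four operations per factor are allowed so that one induction over pure tensors covers
  both the associativity of a tensor product algebra and the three module laws for B \<otimes> H
  acting on \<Omega> \<otimes> H from the left, from the right and from both sides.\<close>

lemma tensor_op_assoc:
  assumes f: "f1 \<in> complex_bilinear U V P" "f2 \<in> complex_bilinear P W Q"
      "f3 \<in> complex_bilinear V W R" "f4 \<in> complex_bilinear U R Q"
    and g: "g1 \<in> complex_bilinear U' V' P'" "g2 \<in> complex_bilinear P' W' Q'"
      "g3 \<in> complex_bilinear V' W' R'" "g4 \<in> complex_bilinear U' R' Q'"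
    and cs: "cspace U" "cspace V" "cspace W" "cspace P" "cspace Q" "cspace R"
      "cspace U'" "cspace V'" "cspace W'" "cspace P'" "cspace Q'" "cspace R'"
    and fa: "\<And>x y z. x \<in> carrier U \<Longrightarrow> y \<in> carrier V \<Longrightarrow> z \<in> carrier W \<Longrightarrow> f2 (f1 x y) z = f4 x (f3 y z)"
    and ga: "\<And>x y z. x \<in> carrier U' \<Longrightarrow> y \<in> carrier V' \<Longrightarrow> z \<in> carrier W' \<Longrightarrow> g2 (g1 x y) z = g4 x (g3 y z)"
    and x: "x \<in> carrier (tensor_space U U')" and y: "y \<in> carrier (tensor_space V V')"
    and z: "z \<in> carrier (tensor_space W W')"
  shows "tensor_op Q Q' f2 g2 (tensor_op P P' f1 g1 x y) z = tensor_op Q Q' f4 g4 x (tensor_op R R' f3 g3 y z)"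
proof -
  note c = complex_bilinear_closed[OF f(1)] complex_bilinear_closed[OF f(2)]
    complex_bilinear_closed[OF f(3)] complex_bilinear_closed[OF f(4)]
    complex_bilinear_closed[OF g(1)] complex_bilinear_closed[OF g(2)]
    complex_bilinear_closed[OF g(3)] complex_bilinear_closed[OF g(4)]
  note b1 = tensor_op_bilinear[OF f(1) g(1) cs(1,2,4,7,8,10)]
  note b2 = tensor_op_bilinear[OF f(2) g(2) cs(4,3,5,10,9,11)]
  note b3 = tensor_op_bilinear[OF f(3) g(3) cs(2,3,6,8,9,12)]
  note b4 = tensor_op_bilinear[OF f(4) g(4) cs(1,6,5,7,12,11)]
  note t = tensor_op_tens[OF f(1) g(1) cs(1,2,4,7,8,10)] tensor_op_tens[OF f(2) g(2) cs(4,3,5,10,9,11)]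
    tensor_op_tens[OF f(3) g(3) cs(2,3,6,8,9,12)] tensor_op_tens[OF f(4) g(4) cs(1,6,5,7,12,11)]
  note D = complex_bilinearD[OF b1] complex_bilinearD[OF b2] complex_bilinearD[OF b3] complex_bilinearD[OF b4]
  show ?thesis
    using cs(1,7) x
  proof (induction x rule: tensor_induct)
    case (tens u u')
    show ?case
      using cs(2,8) y
    proof (induction y rule: tensor_induct)
      case (tens v v')
      show ?case
        using cs(3,9) z
        by (induction z rule: tensor_induct)
          (simp_all add: t c D fa ga \<open>u \<in> carrier U\<close> \<open>u' \<in> carrier U'\<close> tens)
    qed (simp_all add: D tens z)
  qed (simp_all add: D y z)
qed

section \<open>Tensor products of linear maps\<close>

context
  fixes V V1 W W1 f g
  assumes f: "f \<in> complex_linear V V1" and g: "g \<in> complex_linear W W1"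
    and V: "cspace V" and V1: "cspace V1" and W: "cspace W" and W1: "cspace W1"
begin

private lemma tensor_map_aux:
  "(\<lambda>v w. tens V1 W1 (f v) (g w)) \<in> complex_bilinear V W (tensor_space V1 W1)"
  by (rule complex_bilinear_comp[OF tens_bilinear[OF V1 W1] f g])

lemma tensor_map_linear: "tensor_map V1 W1 f g \<in> complex_linear (tensor_space V W) (tensor_space V1 W1)"
  unfolding tensor_map_def by (rule tensor_lift_linear[OF V W tensor_space_cspace tensor_map_aux])

lemma tensor_map_tens:
  "v \<in> carrier V \<Longrightarrow> w \<in> carrier W \<Longrightarrow> tensor_map V1 W1 f g (tens V W v w) = tens V1 W1 (f v) (g w)"
  unfolding tensor_map_def by (rule tensor_lift_tens[OF V W tensor_space_cspace tensor_map_aux])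

end

text \<open>Bilinearity reduces the claim to pure tensors, where it is \<open>hf\<close> and
  \<open>kg\<close>. Applied to multiplications it makes a tensor product of homomorphisms
  multiplicative; applied to actions it moves the coaction on forms past a left
  multiplication.\<close>

lemma tensor_map_op:
  assumes f: "f \<in> complex_bilinear V V1 V2" "f' \<in> complex_bilinear V' V1' V2'"
    and g: "g \<in> complex_bilinear W W1 W2" "g' \<in> complex_bilinear W' W1' W2'"
    and h: "h \<in> complex_linear V V'" "h1 \<in> complex_linear V1 V1'" "h2 \<in> complex_linear V2 V2'"
    and k: "k \<in> complex_linear W W'" "k1 \<in> complex_linear W1 W1'" "k2 \<in> complex_linear W2 W2'"
    and cs: "cspace V" "cspace V1" "cspace V2" "cspace W" "cspace W1" "cspace W2"
      "cspace V'" "cspace V1'" "cspace V2'" "cspace W'" "cspace W1'" "cspace W2'"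
    and hf: "\<And>v v'. v \<in> carrier V \<Longrightarrow> v' \<in> carrier V1 \<Longrightarrow> h2 (f v v') = f' (h v) (h1 v')"
    and kg: "\<And>w w'. w \<in> carrier W \<Longrightarrow> w' \<in> carrier W1 \<Longrightarrow> k2 (g w w') = g' (k w) (k1 w')"
    and x: "x \<in> carrier (tensor_space V W)" and y: "y \<in> carrier (tensor_space V1 W1)"
  shows "tensor_map V2' W2' h2 k2 (tensor_op V2 W2 f g x y)
    = tensor_op V2' W2' f' g' (tensor_map V' W' h k x) (tensor_map V1' W1' h1 k1 y)"
proof -
  note c = complex_bilinear_closed[OF f(1)] complex_bilinear_closed[OF g(1)]
    complex_linear_closed[OF h(1)] complex_linear_closed[OF h(2)]
    complex_linear_closed[OF k(1)] complex_linear_closed[OF k(2)]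
  note D = complex_bilinearD[OF tensor_op_bilinear[OF f(1) g(1) cs(1-6)]]
    complex_bilinearD[OF tensor_op_bilinear[OF f(2) g(2) cs(7-12)]]
    complex_linearD[OF tensor_map_linear[OF h(1) k(1) cs(1,7,4,10)]]
    complex_linearD[OF tensor_map_linear[OF h(2) k(2) cs(2,8,5,11)]]
    complex_linearD[OF tensor_map_linear[OF h(3) k(3) cs(3,9,6,12)]]
  note t = tensor_op_tens[OF f(1) g(1) cs(1-6)] tensor_op_tens[OF f(2) g(2) cs(7-12)]
    tensor_map_tens[OF h(1) k(1) cs(1,7,4,10)] tensor_map_tens[OF h(2) k(2) cs(2,8,5,11)]
    tensor_map_tens[OF h(3) k(3) cs(3,9,6,12)]
  show ?thesis
    using cs(1,4) x
  proof (induction x rule: tensor_induct)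
    case (tens v w)
    show ?case
      using cs(2,5) y
      by (induction y rule: tensor_induct) (simp_all add: t c D hf kg tens)
  qed (simp_all add: D y)
qed

section \<open>Threefold tensor products and their reassociation\<close>

lemma tensor_induct3 [consumes 4, case_names tens add]:
  assumes U: "cspace U" and V: "cspace V" and W: "cspace W"
    and x: "x \<in> carrier (tensor_space (tensor_space U V) W)"
    and tens: "\<And>u v w. u \<in> carrier U \<Longrightarrow> v \<in> carrier V \<Longrightarrow> w \<in> carrier W
      \<Longrightarrow> P (tens (tensor_space U V) W (tens U V u v) w)"
    and add: "\<And>x y. x \<in> carrier (tensor_space (tensor_space U V) W)
      \<Longrightarrow> y \<in> carrier (tensor_space (tensor_space U V) W)
      \<Longrightarrow> P x \<Longrightarrow> P y \<Longrightarrow> P (x \<oplus>\<^bsub>tensor_space (tensor_space U V) W\<^esub> y)"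
  shows "P x"
  using tensor_space_cspace W x
proof (induction x rule: tensor_induct)
  case (tens y w)
  show ?case
    using U V tens(1)
    by (induction y rule: tensor_induct) (simp_all add: assms(5,6) W tens(2) tens_simps)
qed (rule add)

context
  fixes U V W
  assumes U: "cspace U" and V: "cspace V" and W: "cspace W"
begin

private abbreviation "T' \<equiv> tensor_space U (tensor_space V W)"

private abbreviation "\<psi>' w \<equiv> tensor_lift T' (\<lambda>u v. tens U (tensor_space V W) u (tens V W v w))"

private lemma assoc_inner:
  "w \<in> carrier W \<Longrightarrow> (\<lambda>u v. tens U (tensor_space V W) u (tens V W v w)) \<in> complex_bilinear U V T'"
  using complex_bilinear_comp[OF tens_bilinear[OF U tensor_space_cspace] complex_linear_id
      complex_bilinear_left[OF tens_bilinear[OF V W]]] by simp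

private lemmas assoc_inner_linear = tensor_lift_linear[OF U V tensor_space_cspace assoc_inner]
private lemmas assoc_inner_tens = tensor_lift_tens[OF U V tensor_space_cspace assoc_inner]

private lemma assoc_outer: "(\<lambda>x w. \<psi>' w x) \<in> complex_bilinear (tensor_space U V) W T'"
proof (rule complex_bilinearI)
  fix w assume "w \<in> carrier W"
  then show "\<psi>' w \<in> complex_linear (tensor_space U V) T'"
    by (rule assoc_inner_linear)
next
  fix x assume x: "x \<in> carrier (tensor_space U V)"
  note s = complex_linearD[OF assoc_inner_linear] assoc_inner_tens tens_simps[OF V W]
    tens_simps[OF U tensor_space_cspace]
  have "\<psi>' (w \<oplus>\<^bsub>W\<^esub> w') x = \<psi>' w x \<oplus>\<^bsub>T'\<^esub> \<psi>' w' x" if "w \<in> carrier W" "w' \<in> carrier W" for w w'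
    using U V x
    by (induction x rule: tensor_induct) (simp_all add: that W s cs_ac[OF tensor_space_cspace])
  moreover have "\<psi>' (c \<odot>\<^bsub>W\<^esub> w) x = c \<odot>\<^bsub>T'\<^esub> \<psi>' w x" if "w \<in> carrier W" for w c
    using U V x
    by (induction x rule: tensor_induct) (simp_all add: that W s cs_distrib[OF tensor_space_cspace])
  ultimately show "(\<lambda>w. \<psi>' w x) \<in> complex_linear W T'"
    using x s(1) by (intro complex_linearI)
qed

lemma tensor_assoc_linear: "tensor_assoc U V W \<in> complex_linear (tensor_space (tensor_space U V) W)
    (tensor_space U (tensor_space V W))"
  unfolding tensor_assoc_def Let_def
  by (rule tensor_lift_linear[OF tensor_space_cspace W tensor_space_cspace assoc_outer])

lemma tensor_assoc_tens:
  "u \<in> carrier U \<Longrightarrow> v \<in> carrier V \<Longrightarrow> w \<in> carrier W \<Longrightarrow>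
    tensor_assoc U V W (tens (tensor_space U V) W (tens U V u v) w)
      = tens U (tensor_space V W) u (tens V W v w)"
  unfolding tensor_assoc_def Let_def
  by (simp add: tensor_lift_tens[OF tensor_space_cspace W tensor_space_cspace assoc_outer] assoc_inner_tens)

end

lemma tensor_assoc_op:
  assumes f: "f \<in> complex_bilinear U U1 U2" "g \<in> complex_bilinear V V1 V2" "h \<in> complex_bilinear W W1 W2"
    and cs: "cspace U" "cspace V" "cspace W" "cspace U1" "cspace V1" "cspace W1"
      "cspace U2" "cspace V2" "cspace W2"
    and x: "x \<in> carrier (tensor_space (tensor_space U V) W)"
    and y: "y \<in> carrier (tensor_space (tensor_space U1 V1) W1)"
  shows "tensor_assoc U2 V2 W2 (tensor_op (tensor_space U2 V2) W2 (tensor_op U2 V2 f g) h x y)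
    = tensor_op U2 (tensor_space V2 W2) f (tensor_op V2 W2 g h) (tensor_assoc U V W x) (tensor_assoc U1 V1 W1 y)"
proof -
  note c = complex_bilinear_closed[OF f(1)] complex_bilinear_closed[OF f(2)] complex_bilinear_closed[OF f(3)]
  note fg = tensor_op_bilinear[OF f(1,2) cs(1,4,7,2,5,8)] and gh = tensor_op_bilinear[OF f(2,3) cs(2,5,8,3,6,9)]
  note fgh = tensor_op_bilinear[OF fg f(3) tensor_space_cspace tensor_space_cspace tensor_space_cspace cs(3,6,9)]
  note fgh' = tensor_op_bilinear[OF f(1) gh cs(1,4,7) tensor_space_cspace tensor_space_cspace tensor_space_cspace]
  note D = complex_bilinearD[OF fgh] complex_bilinearD[OF fgh'] complex_linearD[OF tensor_assoc_linear[OF cs(1-3)]]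
    complex_linearD[OF tensor_assoc_linear[OF cs(4-6)]] complex_linearD[OF tensor_assoc_linear[OF cs(7-9)]]
  note t = tensor_op_tens[OF f(1,2) cs(1,4,7,2,5,8)] tensor_op_tens[OF f(2,3) cs(2,5,8,3,6,9)]
    tensor_op_tens[OF fg f(3) tensor_space_cspace tensor_space_cspace tensor_space_cspace cs(3,6,9)]
    tensor_op_tens[OF f(1) gh cs(1,4,7) tensor_space_cspace tensor_space_cspace tensor_space_cspace]
    tensor_assoc_tens[OF cs(1-3)] tensor_assoc_tens[OF cs(4-6)] tensor_assoc_tens[OF cs(7-9)]
  show ?thesis
    using cs(1-3) x
  proof (induction x rule: tensor_induct3)
    case (tens u v w)
    show ?case
      using cs(4-6) y
      by (induction y rule: tensor_induct3) (simp_all add: t c D tens)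
  qed (simp_all add: D y)
qed

section \<open>Algebras\<close>

context
  fixes A :: "(complex, 'a, 'm) module_scheme" (structure)
  assumes A: "complex_algebra A"
begin

interpretation complex_algebra A by (rule A)

lemma ca_one_closed [simp]: "\<one> \<in> carrier A"
  by simp

lemma ca_mult_closed [simp]: "x \<in> carrier A \<Longrightarrow> y \<in> carrier A \<Longrightarrow> x \<otimes> y \<in> carrier A"
  by simp

lemma ca_one [simp]: "x \<in> carrier A \<Longrightarrow> \<one> \<otimes> x = x" "x \<in> carrier A \<Longrightarrow> x \<otimes> \<one> = x"
  by simp_all

lemma ca_zero [simp]: "x \<in> carrier A \<Longrightarrow> \<zero> \<otimes> x = \<zero>" "x \<in> carrier A \<Longrightarrow> x \<otimes> \<zero> = \<zero>"
  by simp_all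

lemma ca_assoc: "x \<in> carrier A \<Longrightarrow> y \<in> carrier A \<Longrightarrow> z \<in> carrier A \<Longrightarrow> x \<otimes> y \<otimes> z = x \<otimes> (y \<otimes> z)"
  by (rule m_assoc)

lemma ca_mult_bilinear: "(\<otimes>) \<in> complex_bilinear A A A"
  by (intro complex_bilinearI complex_linearI)
    (simp_all add: l_distr r_distr smult_mult_left smult_mult_right)

lemma ca_distrib:
  "x \<in> carrier A \<Longrightarrow> y \<in> carrier A \<Longrightarrow> z \<in> carrier A \<Longrightarrow> (x \<oplus> y) \<otimes> z = x \<otimes> z \<oplus> y \<otimes> z"
  "x \<in> carrier A \<Longrightarrow> y \<in> carrier A \<Longrightarrow> z \<in> carrier A \<Longrightarrow> x \<otimes> (y \<oplus> z) = x \<otimes> y \<oplus> x \<otimes> z"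
  by (simp_all add: l_distr r_distr)

lemma ca_smult:
  "x \<in> carrier A \<Longrightarrow> y \<in> carrier A \<Longrightarrow> (c \<odot> x) \<otimes> y = c \<odot> (x \<otimes> y)"
  "x \<in> carrier A \<Longrightarrow> y \<in> carrier A \<Longrightarrow> x \<otimes> (c \<odot> y) = c \<odot> (x \<otimes> y)"
  by (simp_all add: smult_mult_left smult_mult_right)

lemma ca_finsum_mult:
  assumes "f \<in> S \<rightarrow> carrier A" "x \<in> carrier A"
  shows "finsum A f S \<otimes> x = (\<Oplus>i\<in>S. f i \<otimes> x)" "x \<otimes> finsum A f S = (\<Oplus>i\<in>S. x \<otimes> f i)"
proof -
  have cs: "cspace A"
    using A by simp
  show "finsum A f S \<otimes> x = (\<Oplus>i\<in>S. f i \<otimes> x)"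
    by (rule complex_linear_finsum[OF cs cs complex_bilinear_left[OF ca_mult_bilinear assms(2)] assms(1)])
  show "x \<otimes> finsum A f S = (\<Oplus>i\<in>S. x \<otimes> f i)"
    by (rule complex_linear_finsum[OF cs cs complex_bilinear_right[OF ca_mult_bilinear assms(2)] assms(1)])
qed

end

lemma complex_algebraI:
  fixes A (structure)
  assumes cs: "cspace A" and mult: "(\<otimes>) \<in> complex_bilinear A A A" and one: "\<one> \<in> carrier A"
    and "\<And>x. x \<in> carrier A \<Longrightarrow> \<one> \<otimes> x = x" "\<And>x. x \<in> carrier A \<Longrightarrow> x \<otimes> \<one> = x"
    and "\<And>x y z. x \<in> carrier A \<Longrightarrow> y \<in> carrier A \<Longrightarrow> z \<in> carrier A \<Longrightarrow> x \<otimes> y \<otimes> z = x \<otimes> (y \<otimes> z)"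
  shows "complex_algebra A"
proof -
  note D = complex_bilinearD[OF mult]
  have "monoid A"
    using assms by (intro monoidI) (simp_all add: D)
  then have "ring A"
    using cs by (intro ringI cspace_abelian_group) (simp_all add: D)
  then show ?thesis
    using cs by (intro complex_algebra.intro complex_algebra_axioms.intro) (simp_all add: D)
qed

lemma algebra_hom_linear: "f \<in> algebra_hom A B \<Longrightarrow> f \<in> complex_linear A B"
  by (simp add: algebra_hom_def)

lemma algebra_hom_mult:
  "f \<in> algebra_hom A B \<Longrightarrow> x \<in> carrier A \<Longrightarrow> y \<in> carrier A \<Longrightarrow> f (x \<otimes>\<^bsub>A\<^esub> y) = f x \<otimes>\<^bsub>B\<^esub> f y"
  by (simp add: algebra_hom_def ring_hom_def)

lemma algebra_hom_one: "f \<in> algebra_hom A B \<Longrightarrow> f \<one>\<^bsub>A\<^esub> = \<one>\<^bsub>B\<^esub>"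
  by (simp add: algebra_hom_def ring_hom_def)

lemma algebra_homI:
  assumes "f \<in> complex_linear A B" "f \<one>\<^bsub>A\<^esub> = \<one>\<^bsub>B\<^esub>"
    and "\<And>x y. x \<in> carrier A \<Longrightarrow> y \<in> carrier A \<Longrightarrow> f (x \<otimes>\<^bsub>A\<^esub> y) = f x \<otimes>\<^bsub>B\<^esub> f y"
  shows "f \<in> algebra_hom A B"
  unfolding algebra_hom_def using assms complex_linear_closed[OF assms(1)] complex_linear_add[OF assms(1)]
  by (intro IntI ring_hom_memI)

lemma algebra_hom_id: "id \<in> algebra_hom A A"
  by (rule algebra_homI) (simp_all add: complex_linear_id)

lemma algebra_hom_comp:
  assumes f: "f \<in> algebra_hom A B" and g: "g \<in> algebra_hom B C"
  shows "(\<lambda>x. g (f x)) \<in> algebra_hom A C"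
  by (rule algebra_homI)
    (simp_all add: complex_linear_comp[OF algebra_hom_linear[OF f] algebra_hom_linear[OF g]]
      algebra_hom_one[OF f] algebra_hom_one[OF g] algebra_hom_mult[OF f] algebra_hom_mult[OF g]
      complex_linear_closed[OF algebra_hom_linear[OF f]])

lemma tensor_mult_bilinear:
  assumes "complex_algebra A" "complex_algebra A'"
  shows "(\<otimes>\<^bsub>tensor_space A A'\<^esub>) \<in> complex_bilinear (tensor_space A A') (tensor_space A A') (tensor_space A A')"
  unfolding tensor_space_simps using assms
  by (intro tensor_op_bilinear ca_mult_bilinear) simp_all

lemma tensor_mult_tens:
  assumes "complex_algebra A" "complex_algebra A'" "x \<in> carrier A" "y \<in> carrier A'"
    "x' \<in> carrier A" "y' \<in> carrier A'"
  shows "tens A A' x y \<otimes>\<^bsub>tensor_space A A'\<^esub> tens A A' x' y' = tens A A' (x \<otimes>\<^bsub>A\<^esub> x') (y \<otimes>\<^bsub>A'\<^esub> y')"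
  unfolding tensor_space_simps using assms
  by (intro tensor_op_tens ca_mult_bilinear) simp_all

lemma tensor_algebra [simp]:
  assumes A: "complex_algebra A" and A': "complex_algebra A'"
  shows "complex_algebra (tensor_space A A')"
proof (rule complex_algebraI)
  let ?T = "tensor_space A A'"
  have cs: "cspace A" "cspace A'"
    using assms by simp_all
  note m = tensor_mult_tens[OF A A']
  note b = tensor_mult_bilinear[OF A A']
  show "cspace ?T" by simp
  show "(\<otimes>\<^bsub>?T\<^esub>) \<in> complex_bilinear ?T ?T ?T"
    by (rule b)
  show one: "\<one>\<^bsub>?T\<^esub> \<in> carrier ?T"
    using assms by (simp add: tensor_space_simps(3))
  show "\<one>\<^bsub>?T\<^esub> \<otimes>\<^bsub>?T\<^esub> x = x" if "x \<in> carrier ?T" for x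
    using cs that
    by (induction x rule: tensor_induct)
      (simp_all add: tensor_space_simps(3) assms m complex_bilinear_add_right[OF b])
  show "x \<otimes>\<^bsub>?T\<^esub> \<one>\<^bsub>?T\<^esub> = x" if "x \<in> carrier ?T" for x
    using cs that
    by (induction x rule: tensor_induct)
      (simp_all add: tensor_space_simps(3) assms m complex_bilinear_add_left[OF b])
  show "x \<otimes>\<^bsub>?T\<^esub> y \<otimes>\<^bsub>?T\<^esub> z = x \<otimes>\<^bsub>?T\<^esub> (y \<otimes>\<^bsub>?T\<^esub> z)"
    if "x \<in> carrier ?T" "y \<in> carrier ?T" "z \<in> carrier ?T" for x y z
    unfolding tensor_space_simps(2)
    by (rule tensor_op_assoc[OF ca_mult_bilinear[OF A] ca_mult_bilinear[OF A] ca_mult_bilinear[OF A]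
          ca_mult_bilinear[OF A] ca_mult_bilinear[OF A'] ca_mult_bilinear[OF A'] ca_mult_bilinear[OF A']
          ca_mult_bilinear[OF A'] cs(1) cs(1) cs(1) cs(1) cs(1) cs(1) cs(2) cs(2) cs(2) cs(2) cs(2) cs(2)
          ca_assoc[OF A] ca_assoc[OF A'] that])
qed

lemma tensor_map_algebra_hom:
  assumes f: "f \<in> algebra_hom A B" and g: "g \<in> algebra_hom A' B'"
    and alg: "complex_algebra A" "complex_algebra B" "complex_algebra A'" "complex_algebra B'"
  shows "tensor_map B B' f g \<in> algebra_hom (tensor_space A A') (tensor_space B B')"
proof (rule algebra_homI)
  note l = algebra_hom_linear[OF f] algebra_hom_linear[OF g]
  have cs: "cspace A" "cspace B" "cspace A'" "cspace B'"
    using alg by simp_all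
  note mb = ca_mult_bilinear
  show "tensor_map B B' f g \<in> complex_linear (tensor_space A A') (tensor_space B B')"
    by (rule tensor_map_linear[OF l cs])
  show "tensor_map B B' f g \<one>\<^bsub>tensor_space A A'\<^esub> = \<one>\<^bsub>tensor_space B B'\<^esub>"
    using alg by (simp add: tensor_space_simps(3) tensor_map_tens[OF l cs] algebra_hom_one[OF f] algebra_hom_one[OF g])
  show "tensor_map B B' f g (x \<otimes>\<^bsub>tensor_space A A'\<^esub> y)
      = tensor_map B B' f g x \<otimes>\<^bsub>tensor_space B B'\<^esub> tensor_map B B' f g y"
    if "x \<in> carrier (tensor_space A A')" "y \<in> carrier (tensor_space A A')" for x y
    unfolding tensor_space_simps(2)
    by (rule tensor_map_op[OF mb[OF alg(1)] mb[OF alg(2)] mb[OF alg(3)] mb[OF alg(4)] l(1) l(1) l(1)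
          l(2) l(2) l(2) cs(1) cs(1) cs(1) cs(3) cs(3) cs(3) cs(2) cs(2) cs(2) cs(4) cs(4) cs(4)
          algebra_hom_mult[OF f] algebra_hom_mult[OF g] that])
qed

lemma tensor_assoc_algebra_hom:
  assumes alg: "complex_algebra A" "complex_algebra B" "complex_algebra C"
  shows "tensor_assoc A B C \<in> algebra_hom (tensor_space (tensor_space A B) C) (tensor_space A (tensor_space B C))"
proof (rule algebra_homI)
  have cs: "cspace A" "cspace B" "cspace C"
    using alg by simp_all
  show "tensor_assoc A B C \<in> complex_linear (tensor_space (tensor_space A B) C) (tensor_space A (tensor_space B C))"
    by (rule tensor_assoc_linear[OF cs])
  show "tensor_assoc A B C \<one>\<^bsub>tensor_space (tensor_space A B) C\<^esub> = \<one>\<^bsub>tensor_space A (tensor_space B C)\<^esub>"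
    using alg by (simp add: tensor_space_simps(3) tensor_assoc_tens[OF cs])
  show "tensor_assoc A B C (x \<otimes>\<^bsub>tensor_space (tensor_space A B) C\<^esub> y)
      = tensor_assoc A B C x \<otimes>\<^bsub>tensor_space A (tensor_space B C)\<^esub> tensor_assoc A B C y"
    if "x \<in> carrier (tensor_space (tensor_space A B) C)" "y \<in> carrier (tensor_space (tensor_space A B) C)" for x y
    unfolding tensor_space_simps(2)
    by (rule tensor_assoc_op[OF ca_mult_bilinear[OF alg(1)] ca_mult_bilinear[OF alg(2)]
          ca_mult_bilinear[OF alg(3)] cs cs cs that])
qed


section \<open>Algebras given by generators and relations\<close>

lemma letters_zero [simp]: "letters 0 = []"
  by (simp add: zero_word_def)

abbreviation free_ring :: "'g free_algebra ring" where "free_ring \<equiv> ring_of_type_algebra"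

lemma ring_free_ring: "ring (free_ring :: 'g free_algebra ring)"
proof (rule ringI)
  show "abelian_group (free_ring :: 'g free_algebra ring)"
  proof (rule abelian_groupI)
    fix x :: "'g free_algebra" assume "x \<in> carrier free_ring"
    show "\<exists>y\<in>carrier free_ring. y \<oplus>\<^bsub>free_ring\<^esub> x = \<zero>\<^bsub>free_ring\<^esub>"
      by (rule bexI[of _ "- x"]) simp_all
  qed (simp_all add: ac_simps)
  show "monoid (free_ring :: 'g free_algebra ring)"
    by (rule monoidI) (simp_all add: mult.assoc)
qed (simp_all add: algebra_simps)

lemma ideal_relation_ideal: "ideal (relation_ideal R) free_ring"
  unfolding relation_ideal_def by (rule ring.genideal_ideal[OF ring_free_ring]) simp

text \<open>Constants are central in the free algebra. Hence the scalar action of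
  \<open>presented_algebra\<close>, given there as multiplication by the class of a constant, is
  plain rescaling of a representative.\<close>

lemma free_scalar_mult: "free_scalar c * p = scale_fun c p" "p * free_scalar c = scale_fun c p"
  for p :: "'g free_algebra"
proof -
  have "Poly_Mapping.keys p \<subseteq> UNIV" by simp
  then have "free_scalar c * p = scale_fun c p \<and> p * free_scalar c = scale_fun c p"
    by (induction p rule: poly_mapping_induct_on)
      (simp_all add: free_scalar_def mult_single scale_fun_add distrib_left distrib_right mult.commute)
  then show "free_scalar c * p = scale_fun c p" "p * free_scalar c = scale_fun c p"
    by simp_all
qed

context
  fixes R :: "'g free_algebra set"
begin

interpretation ideal "relation_ideal R" "free_ring :: 'g free_algebra ring"
  by (rule ideal_relation_ideal)

lemma presented_class_ops:
  "\<one>\<^bsub>presented_algebra R\<^esub> = presented_class R 1"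
  "\<zero>\<^bsub>presented_algebra R\<^esub> = presented_class R 0"
  "presented_class R p \<oplus>\<^bsub>presented_algebra R\<^esub> presented_class R r = presented_class R (p + r)"
  "presented_class R p \<otimes>\<^bsub>presented_algebra R\<^esub> presented_class R r = presented_class R (p * r)"
  "c \<odot>\<^bsub>presented_algebra R\<^esub> presented_class R p = presented_class R (scale_fun c p)"
  "carrier (presented_algebra R) = range (presented_class R)"
proof -
  note hom = rcos_ring_hom
  have m: "presented_class R p \<otimes>\<^bsub>free_ring Quot relation_ideal R\<^esub> presented_class R r = presented_class R (p * r)" for p r
    using ring_hom_mult[OF hom, of p r] by (simp add: presented_class_def)
  show "\<one>\<^bsub>presented_algebra R\<^esub> = presented_class R 1"
    using ring_hom_one[OF hom] by (simp add: presented_class_def presented_algebra_def ring.defs Let_def)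
  show "\<zero>\<^bsub>presented_algebra R\<^esub> = presented_class R 0"
    using ring_hom_zero[OF hom ring_free_ring quotient_is_ring]
    by (simp add: presented_class_def presented_algebra_def ring.defs Let_def)
  show "presented_class R p \<oplus>\<^bsub>presented_algebra R\<^esub> presented_class R r = presented_class R (p + r)"
    using ring_hom_add[OF hom, of p r] by (simp add: presented_class_def presented_algebra_def ring.defs Let_def)
  show "presented_class R p \<otimes>\<^bsub>presented_algebra R\<^esub> presented_class R r = presented_class R (p * r)"
    using m by (simp add: presented_algebra_def ring.defs Let_def)
  show "c \<odot>\<^bsub>presented_algebra R\<^esub> presented_class R p = presented_class R (scale_fun c p)"
    using m[of "free_scalar c" p]
    by (simp add: presented_algebra_def ring.defs module.defs Let_def free_scalar_mult)
  have "carrier (presented_algebra R) = carrier (free_ring Quot relation_ideal R)"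
    by (simp add: presented_algebra_def ring.defs Let_def)
  also have "\<dots> = a_rcosets\<^bsub>free_ring\<^esub> relation_ideal R"
    by (simp only: FactRing_def partial_object.select_convs)
  also have "\<dots> = range (presented_class R)"
    unfolding A_RCOSETS_def' presented_class_def[abs_def] by (simp add: UNION_singleton_eq_range)
  finally show "carrier (presented_algebra R) = range (presented_class R)" .
qed

lemma mem_presented_class: "x \<in> presented_class R p \<longleftrightarrow> x - p \<in> relation_ideal R"
proof -
  have "x \<in> presented_class R p \<longleftrightarrow> (\<exists>i\<in>relation_ideal R. x = i + p)"
    by (simp add: presented_class_def a_r_coset_def')
  then show ?thesis
    by (auto intro: bexI[of _ "x - p"])
qed

lemma presented_class_relation:
  assumes "r \<in> R"
  shows "presented_class R r = presented_class R 0"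
proof -
  have "r \<in> relation_ideal R"
    using ring.genideal_self[OF ring_free_ring, of R] assms by (auto simp: relation_ideal_def)
  then show ?thesis
    unfolding presented_class_def
    using a_coset_join2[OF _ a_subgroup, of r] a_coset_join2[OF _ a_subgroup, of 0]
      additive_subgroup.zero_closed[OF ideal.axioms(1)[OF ideal_relation_ideal[of R]]] by simp
qed

end

lemma presented_algebra_complex_algebra [simp]: "complex_algebra (presented_algebra R)"
proof (rule complex_algebraI)
  show "cspace (presented_algebra R)"
  proof (rule cspaceI)
    show "abelian_group (presented_algebra R)"
    proof (rule abelian_groupI)
      fix x assume "x \<in> carrier (presented_algebra R)"
      then obtain p where "x = presented_class R p"
        by (auto simp: presented_class_ops)
      then show "\<exists>y\<in>carrier (presented_algebra R). y \<oplus>\<^bsub>presented_algebra R\<^esub> x = \<zero>\<^bsub>presented_algebra R\<^esub>"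
        by (intro bexI[of _ "presented_class R (- p)"]) (simp_all add: presented_class_ops)
    qed (auto simp: presented_class_ops ac_simps)
  qed (auto simp: presented_class_ops scale_fun_add scale_fun_add_left scale_fun_scale_fun scale_fun_one)
  show "(\<otimes>\<^bsub>presented_algebra R\<^esub>)
      \<in> complex_bilinear (presented_algebra R) (presented_algebra R) (presented_algebra R)"
  proof (intro complex_bilinearI complex_linearI)
    fix c x y assume "x \<in> carrier (presented_algebra R)" "y \<in> carrier (presented_algebra R)"
    then obtain p r where "x = presented_class R p" "y = presented_class R r"
      by (auto simp: presented_class_ops)
    moreover have "scale_fun c p * r = scale_fun c (p * r)"
      by (simp only: free_scalar_mult(1)[symmetric] mult.assoc)
    moreover have "p * scale_fun c r = scale_fun c (p * r)"
      by (simp only: free_scalar_mult(2)[symmetric] mult.assoc)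
    ultimately show "x \<otimes>\<^bsub>presented_algebra R\<^esub> (c \<odot>\<^bsub>presented_algebra R\<^esub> y)
        = c \<odot>\<^bsub>presented_algebra R\<^esub> (x \<otimes>\<^bsub>presented_algebra R\<^esub> y)"
      "(c \<odot>\<^bsub>presented_algebra R\<^esub> x) \<otimes>\<^bsub>presented_algebra R\<^esub> y
        = c \<odot>\<^bsub>presented_algebra R\<^esub> (x \<otimes>\<^bsub>presented_algebra R\<^esub> y)"
      by (simp_all add: presented_class_ops)
  qed (auto simp: presented_class_ops distrib_left distrib_right)
qed (auto simp: presented_class_ops mult.assoc)

lemma presented_gen_closed [simp]: "presented_gen R g \<in> carrier (presented_algebra R)"
  by (simp add: presented_gen_def presented_class_ops)

lemma presented_class_single:
  fixes R :: "'g free_algebra set"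
  shows
  "presented_class R (Poly_Mapping.single (Word w) c) = c \<odot>\<^bsub>presented_algebra R\<^esub>
    foldr (\<lambda>g x. presented_gen R g \<otimes>\<^bsub>presented_algebra R\<^esub> x) w \<one>\<^bsub>presented_algebra R\<^esub>"
proof (induction w arbitrary: c)
  case Nil
  have "(Poly_Mapping.single (Word []) c :: 'g free_algebra) = scale_fun c 1"
    by (simp only: free_scalar_mult(2)[symmetric] free_scalar_def zero_word_def mult_1_left)
  then show ?case
    by (simp add: presented_class_ops)
next
  case (Cons g w)
  have "free_gen g * Poly_Mapping.single (Word w) 1 = Poly_Mapping.single (Word (g # w)) 1"
    by (simp add: free_gen_def mult_single plus_word_def)
  then have "presented_class R (Poly_Mapping.single (Word (g # w)) 1)
      = presented_gen R g \<otimes>\<^bsub>presented_algebra R\<^esub> presented_class R (Poly_Mapping.single (Word w) 1)"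
    by (simp add: presented_class_ops presented_gen_def)
  moreover have "presented_class R (Poly_Mapping.single (Word (g # w)) c)
      = c \<odot>\<^bsub>presented_algebra R\<^esub> presented_class R (Poly_Mapping.single (Word (g # w)) 1)"
    by (simp add: presented_class_ops)
  moreover have "foldr (\<lambda>g x. presented_gen R g \<otimes>\<^bsub>presented_algebra R\<^esub> x) w \<one>\<^bsub>presented_algebra R\<^esub>
      \<in> carrier (presented_algebra R)"
    by (induction w) simp_all
  ultimately show ?case
    by (simp add: Cons.IH)
qed

text \<open>Every class is a linear combination of words, and a word arises from the unit by
  prefixing generators one at a time.\<close>

lemma presented_induct [consumes 1, case_names one gen smult add]:
  fixes R :: "'g free_algebra set"
  defines "B \<equiv> presented_algebra R"
  assumes x: "x \<in> carrier B"
    and one: "P \<one>\<^bsub>B\<^esub>"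
    and gen: "\<And>g x. x \<in> carrier B \<Longrightarrow> P x \<Longrightarrow> P (presented_gen R g \<otimes>\<^bsub>B\<^esub> x)"
    and smult: "\<And>c x. x \<in> carrier B \<Longrightarrow> P x \<Longrightarrow> P (c \<odot>\<^bsub>B\<^esub> x)"
    and add: "\<And>x y. x \<in> carrier B \<Longrightarrow> y \<in> carrier B \<Longrightarrow> P x \<Longrightarrow> P y \<Longrightarrow> P (x \<oplus>\<^bsub>B\<^esub> y)"
  shows "P x"
proof -
  have B: "complex_algebra B"
    by (simp add: B_def)
  have pg: "presented_gen R g \<in> carrier B" for g
    by (simp add: B_def)
  have word: "foldr (\<lambda>g x. presented_gen R g \<otimes>\<^bsub>B\<^esub> x) w \<one>\<^bsub>B\<^esub> \<in> carrier B \<and>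
      P (foldr (\<lambda>g x. presented_gen R g \<otimes>\<^bsub>B\<^esub> x) w \<one>\<^bsub>B\<^esub>)" for w
    by (induction w) (simp_all add: one gen B pg)
  obtain p where p: "x = presented_class R p"
    using x by (auto simp: B_def presented_class_ops)
  have "Poly_Mapping.keys p \<subseteq> UNIV" by simp
  then have "presented_class R p \<in> carrier B \<and> P (presented_class R p)"
  proof (induction p rule: poly_mapping_induct_on)
    case zero
    have "0 \<odot>\<^bsub>B\<^esub> \<one>\<^bsub>B\<^esub> = \<zero>\<^bsub>B\<^esub>"
      using B by simp
    then show ?case
      using smult[OF _ one, of 0] B by (simp add: B_def presented_class_ops)
  next
    case (single k c)
    obtain w where "k = Word w" by (cases k)
    then show ?case
      using word[of w] smult B by (simp add: presented_class_single B_def)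
  next
    case (add p r)
    then show ?case
      using assms(6)[of "presented_class R p" "presented_class R r"]
      by (simp add: B_def presented_class_ops)
  qed
  with p show ?thesis by simp
qed

section \<open>Evaluation of free polynomials and the universal property of a presentation\<close>

context
  fixes A :: "(complex, 'a, 'm) module_scheme" and \<phi> :: "'g \<Rightarrow> 'a"
  assumes A: "complex_algebra A" and \<phi>: "\<And>g. \<phi> g \<in> carrier A"
begin

private abbreviation "ev_word w \<equiv> foldr (\<lambda>g x. \<phi> g \<otimes>\<^bsub>A\<^esub> x) (letters w) \<one>\<^bsub>A\<^esub>"

private lemma ev_word_closed: "ev_word w \<in> carrier A"
proof -
  have "foldr (\<lambda>g x. \<phi> g \<otimes>\<^bsub>A\<^esub> x) l \<one>\<^bsub>A\<^esub> \<in> carrier A" for l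
    using A \<phi> by (induction l) simp_all
  then show ?thesis by simp
qed

private lemma ev_word_add: "ev_word (v + w) = ev_word v \<otimes>\<^bsub>A\<^esub> ev_word w"
proof -
  have "foldr (\<lambda>g x. \<phi> g \<otimes>\<^bsub>A\<^esub> x) (l @ letters w) \<one>\<^bsub>A\<^esub>
      = foldr (\<lambda>g x. \<phi> g \<otimes>\<^bsub>A\<^esub> x) l \<one>\<^bsub>A\<^esub> \<otimes>\<^bsub>A\<^esub> ev_word w" for l
  proof (induction l)
    case (Cons g l)
    then show ?case
      using A \<phi> ev_word_closed[of "Word l"] ev_word_closed[of w] by (simp add: ca_assoc)
  qed (simp add: A ev_word_closed)
  then show ?thesis
    by (simp add: plus_word_def)
qed

private lemma word_fun: "ev_word \<in> UNIV \<rightarrow> carrier A"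
  using ev_word_closed by simp

private lemma free_eval_eq: "free_eval A \<phi> = lin_ext A ev_word"
  by (rule ext) (simp add: free_eval_def lin_ext_def)

private lemmas word_ext = complex_algebra_cspace[OF A] word_fun

lemma free_eval_closed: "free_eval A \<phi> p \<in> carrier A"
  unfolding free_eval_eq by (rule lin_ext_closed[OF word_ext]) simp

lemma free_eval_add: "free_eval A \<phi> (p + r) = free_eval A \<phi> p \<oplus>\<^bsub>A\<^esub> free_eval A \<phi> r"
  unfolding free_eval_eq by (rule lin_ext_add[OF word_ext]) simp_all

lemma free_eval_diff: "free_eval A \<phi> (p - r) = free_eval A \<phi> p \<ominus>\<^bsub>A\<^esub> free_eval A \<phi> r"
  unfolding free_eval_eq by (rule lin_ext_diff[OF word_ext]) simp_all

lemma free_eval_scale: "free_eval A \<phi> (scale_fun c p) = c \<odot>\<^bsub>A\<^esub> free_eval A \<phi> p"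
  unfolding free_eval_eq by (rule lin_ext_scale[OF word_ext]) simp_all

lemma free_eval_zero: "free_eval A \<phi> 0 = \<zero>\<^bsub>A\<^esub>"
  unfolding free_eval_eq by (rule lin_ext_zero[OF word_ext])

private lemma free_eval_single: "free_eval A \<phi> (Poly_Mapping.single w c) = c \<odot>\<^bsub>A\<^esub> ev_word w"
  unfolding free_eval_eq by (rule lin_ext_single[OF word_ext]) simp

lemma free_eval_mult: "free_eval A \<phi> (p * r) = free_eval A \<phi> p \<otimes>\<^bsub>A\<^esub> free_eval A \<phi> r"
proof -
  have "Poly_Mapping.keys p \<subseteq> UNIV" by simp
  then show ?thesis
  proof (induction p rule: poly_mapping_induct_on)
    case zero
    then show ?case using A by (simp add: free_eval_zero free_eval_closed)
  next
    case (single v c)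
    have "Poly_Mapping.keys r \<subseteq> UNIV" by simp
    then show ?case
    proof (induction r rule: poly_mapping_induct_on)
      case zero
      then show ?case using A by (simp add: free_eval_zero free_eval_closed)
    next
      case (single w d)
      then show ?case
        using A ev_word_closed[of v] ev_word_closed[of w]
        by (simp add: mult_single free_eval_single ev_word_add ca_smult cs_smult_smult mult.commute[of c d])
    next
      case (add p r)
      then show ?case
        using A by (simp add: distrib_left free_eval_add ca_distrib free_eval_closed)
    qed
  next
    case (add p r)
    then show ?case
      using A by (simp add: distrib_right free_eval_add ca_distrib free_eval_closed)
  qed
qed

lemma free_eval_one: "free_eval A \<phi> 1 = \<one>\<^bsub>A\<^esub>"
  using free_eval_single[of 0 1] A by simp

lemma free_eval_gen: "free_eval A \<phi> (free_gen g) = \<phi> g"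
  using A \<phi> by (simp add: free_gen_def free_eval_single)

lemma free_eval_scalar_mult: "free_eval A \<phi> (free_scalar c * p) = c \<odot>\<^bsub>A\<^esub> free_eval A \<phi> p"
  by (simp add: free_scalar_mult free_eval_scale)

lemmas free_eval_simps = free_eval_add free_eval_diff free_eval_scalar_mult free_eval_mult free_eval_one
  free_eval_gen free_eval_zero

context
  fixes R :: "'g free_algebra set"
  assumes R: "\<And>r. r \<in> R \<Longrightarrow> free_eval A \<phi> r = \<zero>\<^bsub>A\<^esub>"
begin

text \<open>The polynomials that evaluate to zero form a two-sided ideal containing
  \<open>R\<close>, so they contain the smallest such ideal.\<close>

private lemma free_eval_ideal: "p \<in> relation_ideal R \<Longrightarrow> free_eval A \<phi> p = \<zero>\<^bsub>A\<^esub>"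
proof -
  let ?K = "{p. free_eval A \<phi> p = \<zero>\<^bsub>A\<^esub>}"
  have sub: "subgroup ?K (add_monoid free_ring)"
  proof (rule group.subgroupI[OF abelian_group.a_group[OF ring.is_abelian_group[OF ring_free_ring]]])
    fix p assume p: "p \<in> ?K"
    have "inv\<^bsub>add_monoid free_ring\<^esub> p = - p"
      using ring_free_ring
      by (intro group.inv_equality[OF abelian_group.a_group[OF ring.is_abelian_group]]) simp_all
    moreover have "free_eval A \<phi> (- p) = \<zero>\<^bsub>A\<^esub>"
      using free_eval_diff[of 0 p] p A by (simp add: free_eval_zero)
    ultimately show "inv\<^bsub>add_monoid free_ring\<^esub> p \<in> ?K" by simp
  qed (use A free_eval_zero in \<open>auto simp: free_eval_add\<close>)
  have "ideal ?K free_ring"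
    using A by (intro idealI ring_free_ring sub) (simp_all add: free_eval_mult free_eval_closed)
  then have "relation_ideal R \<subseteq> ?K"
    unfolding relation_ideal_def using R by (intro ring.genideal_minimal[OF ring_free_ring]) auto
  then show "p \<in> relation_ideal R \<Longrightarrow> free_eval A \<phi> p = \<zero>\<^bsub>A\<^esub>"
    by auto
qed

text \<open>Two representatives differ by an element of the ideal, so evaluation takes a single
  value on the class and \<open>the_elem\<close> returns it.\<close>

lemma presented_lift_class: "presented_lift A \<phi> (presented_class R p) = free_eval A \<phi> p"
proof -
  have const: "free_eval A \<phi> x = free_eval A \<phi> p" if "x \<in> presented_class R p" for x
  proof -
    have "free_eval A \<phi> x \<ominus>\<^bsub>A\<^esub> free_eval A \<phi> p = \<zero>\<^bsub>A\<^esub>"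
      using that free_eval_ideal[of "x - p"] by (simp add: mem_presented_class free_eval_diff)
    then show ?thesis
      by (rule iffD1[OF cs_minus_eq_zero_iff[OF complex_algebra_cspace[OF A] free_eval_closed free_eval_closed]])
  qed
  have "p \<in> presented_class R p"
    using additive_subgroup.zero_closed[OF ideal.axioms(1)[OF ideal_relation_ideal[of R]]]
    by (simp add: mem_presented_class)
  then have "presented_class R p \<noteq> {}"
    by auto
  then have "free_eval A \<phi> ` presented_class R p = {free_eval A \<phi> p}"
    by (rule image_constant_on[OF _ const])
  then show ?thesis
    by (simp add: presented_lift_def)
qed

lemma presented_lift_hom: "presented_lift A \<phi> \<in> algebra_hom (presented_algebra R) A"
  by (intro algebra_homI complex_linearI)
    (auto simp: presented_class_ops presented_lift_class free_eval_simps free_eval_scale free_eval_closed)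

lemma presented_lift_gen: "presented_lift A \<phi> (presented_gen R g) = \<phi> g"
  by (simp add: presented_gen_def presented_lift_class free_eval_gen)

end

end

lemma presented_hom_eqI:
  assumes A: "complex_algebra A" and x: "x \<in> carrier (presented_algebra R)"
    and f: "f \<in> algebra_hom (presented_algebra R) A" and g: "g \<in> algebra_hom (presented_algebra R) A"
    and "\<And>i. f (presented_gen R i) = g (presented_gen R i)"
  shows "f x = g x"
  using x
  by (induction x rule: presented_induct)
    (simp_all add: assms(5) algebra_hom_one[OF f] algebra_hom_one[OF g] algebra_hom_mult[OF f] algebra_hom_mult[OF g]
      complex_linearD[OF algebra_hom_linear[OF f]] complex_linearD[OF algebra_hom_linear[OF g]])

section \<open>Noncommutative Laurent polynomials as data\<close>

text \<open>A list of triples \<open>(k, e, w)\<close> stands for the sum of the terms \<open>k z\<^sup>e w\<close>, where \<open>z\<close> is a nonzero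
  scalar (later \<open>q\<close>) and \<open>w\<close> a word in the generators; identities between such polynomials are
  decided by rewriting words with the defining relations.\<close>

type_synonym 'g ncpoly = "(int \<times> int \<times> 'g list) list"

lemma ncpoly_induct [case_names Nil Cons]:
  assumes "P []" "\<And>k e w Q. P Q \<Longrightarrow> P ((k, e, w) # Q)"
  shows "P (Q :: 'g ncpoly)"
  using assms by (induction Q) auto

definition coef :: "complex \<Rightarrow> int \<Rightarrow> int \<Rightarrow> complex"
  where "coef z k e = of_int k * z powi e"

fun word_eval :: "(complex, 'a, 'm) module_scheme \<Rightarrow> ('g \<Rightarrow> 'a) \<Rightarrow> 'g list \<Rightarrow> 'a"
  where "word_eval A \<phi> [] = \<one>\<^bsub>A\<^esub>"
  | "word_eval A \<phi> (x # w) = \<phi> x \<otimes>\<^bsub>A\<^esub> word_eval A \<phi> w"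

fun peval :: "(complex, 'a, 'm) module_scheme \<Rightarrow> complex \<Rightarrow> ('g \<Rightarrow> 'a) \<Rightarrow> 'g ncpoly \<Rightarrow> 'a"
  where "peval A z \<phi> [] = \<zero>\<^bsub>A\<^esub>"
  | "peval A z \<phi> ((k, e, w) # P) = coef z k e \<odot>\<^bsub>A\<^esub> word_eval A \<phi> w \<oplus>\<^bsub>A\<^esub> peval A z \<phi> P"

definition pscale :: "int \<Rightarrow> int \<Rightarrow> 'g ncpoly \<Rightarrow> 'g ncpoly"
  where "pscale k e P = map (\<lambda>(l, f, w). (k * l, e + f, w)) P"

definition pneg :: "'g ncpoly \<Rightarrow> 'g ncpoly"
  where "pneg P = pscale (- 1) 0 P"

fun pmul :: "'g ncpoly \<Rightarrow> 'g ncpoly \<Rightarrow> 'g ncpoly"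
  where "pmul [] Q = []"
  | "pmul ((k, e, v) # P) Q = map (\<lambda>(l, f, w). (k * l, e + f, v @ w)) Q @ pmul P Q"

definition psum :: "('i \<Rightarrow> 'g ncpoly) \<Rightarrow> 'i list \<Rightarrow> 'g ncpoly"
  where "psum f is = concat (map f is)"

fun wsubst :: "('h \<Rightarrow> 'g ncpoly) \<Rightarrow> 'h list \<Rightarrow> 'g ncpoly"
  where "wsubst \<sigma> [] = [(1, 0, [])]"
  | "wsubst \<sigma> (x # w) = pmul (\<sigma> x) (wsubst \<sigma> w)"

fun psubst :: "('h \<Rightarrow> 'g ncpoly) \<Rightarrow> 'h ncpoly \<Rightarrow> 'g ncpoly"
  where "psubst \<sigma> [] = []"
  | "psubst \<sigma> ((k, e, w) # P) = pscale k e (wsubst \<sigma> w) @ psubst \<sigma> P"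

fun pmap :: "('g \<Rightarrow> 'h) \<Rightarrow> 'g ncpoly \<Rightarrow> 'h ncpoly"
  where "pmap h [] = []"
  | "pmap h ((k, e, w) # P) = (k, e, map h w) # pmap h P"

type_synonym 'g rules = "'g \<Rightarrow> 'g \<Rightarrow> 'g ncpoly option"

fun reduce_word :: "'g rules \<Rightarrow> 'g list \<Rightarrow> 'g ncpoly option"
  where "reduce_word \<rho> (x # y # w) = (case \<rho> x y of
      Some P \<Rightarrow> Some (map (\<lambda>(k, e, v). (k, e, v @ w)) P)
    | None \<Rightarrow> map_option (map (\<lambda>(k, e, v). (k, e, x # v))) (reduce_word \<rho> (y # w)))"
  | "reduce_word \<rho> _ = None"

text \<open>The number bounds the depth of rewriting. When it is used up the word is left as it
  stands, which is still a correct value, so every bound is sound and a larger one only makes the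
  test stronger.\<close>

primrec normalize_word :: "'g rules \<Rightarrow> nat \<Rightarrow> 'g list \<Rightarrow> 'g ncpoly"
  where "normalize_word \<rho> 0 w = [(1, 0, w)]"
  | "normalize_word \<rho> (Suc n) w = (case reduce_word \<rho> w of None \<Rightarrow> [(1, 0, w)]
      | Some P \<Rightarrow> psum (\<lambda>(k, e, v). pscale k e (normalize_word \<rho> n v)) P)"

fun insert_term :: "int \<times> int \<times> 'g list \<Rightarrow> 'g ncpoly \<Rightarrow> 'g ncpoly"
  where "insert_term t [] = [t]"
  | "insert_term (k, e, w) ((l, f, v) # P) =
      (if e = f \<and> w = v then (if k + l = 0 then P else (k + l, f, v) # P)
       else (l, f, v) # insert_term (k, e, w) P)"

definition normalize :: "'g rules \<Rightarrow> nat \<Rightarrow> 'g ncpoly \<Rightarrow> 'g ncpoly"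
  where "normalize \<rho> n P = fold insert_term (psum (\<lambda>(k, e, w). pscale k e (normalize_word \<rho> n w)) P) []"

text \<open>A sufficient test: collecting equal terms must cancel everything. Terms are compared by
  exponent and word, so a success is an identity of Laurent polynomials and holds for all nonzero
  values of the parameter at once.\<close>

definition reduces_to_zero :: "'g rules \<Rightarrow> nat \<Rightarrow> 'g ncpoly \<Rightarrow> bool"
  where "reduces_to_zero \<rho> n P \<longleftrightarrow> normalize \<rho> n P = []"

definition rules_sound :: "(complex, 'a, 'm) module_scheme \<Rightarrow> complex \<Rightarrow> ('g \<Rightarrow> 'a) \<Rightarrow> 'g rules \<Rightarrow> bool"
  where "rules_sound A z \<phi> \<rho> \<longleftrightarrow>
    (\<forall>x y P. \<rho> x y = Some P \<longrightarrow> \<phi> x \<otimes>\<^bsub>A\<^esub> \<phi> y = peval A z \<phi> P)"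

section \<open>Soundness of rewriting: values in an algebra are preserved\<close>

context
  fixes A :: "(complex, 'a, 'm) module_scheme" and z :: complex and \<phi> :: "'g \<Rightarrow> 'a"
  assumes A: "complex_algebra A" and \<phi>: "\<And>g. \<phi> g \<in> carrier A"
begin

lemma word_eval_closed: "word_eval A \<phi> w \<in> carrier A"
  using A \<phi> by (induction w) simp_all

lemma peval_closed: "peval A z \<phi> P \<in> carrier A"
  using A by (induction P rule: ncpoly_induct) (simp_all add: word_eval_closed)

lemma word_eval_append: "word_eval A \<phi> (v @ w) = word_eval A \<phi> v \<otimes>\<^bsub>A\<^esub> word_eval A \<phi> w"
  using A \<phi> by (induction v) (simp_all add: word_eval_closed ca_assoc)

lemma peval_append: "peval A z \<phi> (P @ Q) = peval A z \<phi> P \<oplus>\<^bsub>A\<^esub> peval A z \<phi> Q"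
  using A by (induction P rule: ncpoly_induct) (simp_all add: word_eval_closed peval_closed cs_assoc)

lemma peval_word: "peval A z \<phi> [(1, 0, w)] = word_eval A \<phi> w"
  using A by (simp add: coef_def word_eval_closed)

lemma peval_rules:
  assumes "rules_sound A z \<phi> \<rho>" "\<rho> x y = Some P"
  shows "\<phi> x \<otimes>\<^bsub>A\<^esub> \<phi> y = peval A z \<phi> P"
  using assms by (simp add: rules_sound_def)

lemma peval_append_word:
  "peval A z \<phi> (map (\<lambda>(k, e, v). (k, e, v @ w)) P) = peval A z \<phi> P \<otimes>\<^bsub>A\<^esub> word_eval A \<phi> w"
  using A by (induction P rule: ncpoly_induct)
    (simp_all add: word_eval_closed peval_closed word_eval_append ca_distrib ca_smult)

lemma peval_Cons_word:
  "peval A z \<phi> (map (\<lambda>(k, e, v). (k, e, x # v)) P) = \<phi> x \<otimes>\<^bsub>A\<^esub> peval A z \<phi> P"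
  using A \<phi> by (induction P rule: ncpoly_induct)
    (simp_all add: word_eval_closed peval_closed ca_distrib ca_smult)

lemma peval_psum:
  "(\<And>i. i \<in> set is \<Longrightarrow> peval A z \<phi> (f i) = peval A z \<phi> (g i)) \<Longrightarrow>
    peval A z \<phi> (psum f is) = peval A z \<phi> (psum g is)"
  unfolding psum_def by (induction "is") (simp_all add: peval_append)

lemma psum_term: "psum (\<lambda>t. [t]) P = P"
  unfolding psum_def by (induction P) simp_all

lemma peval_reduce_word:
  assumes "rules_sound A z \<phi> \<rho>"
  shows "reduce_word \<rho> w = Some P \<Longrightarrow> peval A z \<phi> P = word_eval A \<phi> w"
proof (induction w arbitrary: P)
  case (Cons x w)
  then obtain y v where w: "w = y # v"
    by (cases w) simp_all
  show ?case
  proof (cases "\<rho> x y")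
    case None
    then obtain Q where Q: "reduce_word \<rho> w = Some Q" "P = map (\<lambda>(k, e, v). (k, e, x # v)) Q"
      using Cons.prems w by auto
    then show ?thesis
      by (simp add: peval_Cons_word Cons.IH)
  next
    case (Some Q)
    then have "P = map (\<lambda>(k, e, u). (k, e, u @ v)) Q"
      using Cons.prems w by simp
    then show ?thesis
      using A \<phi> peval_rules[OF assms Some]
      by (simp add: w peval_append_word ca_assoc[symmetric] word_eval_closed)
  qed
qed simp

context
  assumes z: "z \<noteq> 0"
begin

lemma coef_mult: "coef z (k * l) (e + f) = coef z k e * coef z l f"
  using z by (simp add: coef_def power_int_add)

lemma peval_pscale: "peval A z \<phi> (pscale k e P) = coef z k e \<odot>\<^bsub>A\<^esub> peval A z \<phi> P"
  unfolding pscale_def using A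
  by (induction P rule: ncpoly_induct)
    (simp_all add: word_eval_closed peval_closed coef_mult cs_distrib cs_smult_smult)

lemma peval_pneg: "peval A z \<phi> (pneg P) = \<ominus>\<^bsub>A\<^esub> peval A z \<phi> P"
  using A by (simp add: pneg_def peval_pscale coef_def cs_neg peval_closed)

lemma peval_pmul: "peval A z \<phi> (pmul P Q) = peval A z \<phi> P \<otimes>\<^bsub>A\<^esub> peval A z \<phi> Q"
proof (induction P Q rule: pmul.induct)
  case (1 Q)
  then show ?case using A by (simp add: peval_closed)
next
  case (2 k e v P Q)
  have "peval A z \<phi> (map (\<lambda>(l, f, w). (k * l, e + f, v @ w)) Q)
      = (coef z k e \<odot>\<^bsub>A\<^esub> word_eval A \<phi> v) \<otimes>\<^bsub>A\<^esub> peval A z \<phi> Q"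
    using A by (induction Q rule: ncpoly_induct)
      (simp_all add: word_eval_closed peval_closed word_eval_append coef_mult ca_distrib ca_smult cs_smult_smult
        mult.commute[where 'a = complex])
  then show ?case
    using A 2 by (simp add: peval_append ca_distrib word_eval_closed peval_closed)
qed

lemma peval_term:
  assumes "peval A z \<phi> Q = word_eval A \<phi> w"
  shows "peval A z \<phi> (pscale k e Q) = peval A z \<phi> [(k, e, w)]"
  using A by (simp add: peval_pscale assms word_eval_closed)

lemma peval_normalize_word:
  assumes "rules_sound A z \<phi> \<rho>"
  shows "peval A z \<phi> (normalize_word \<rho> n w) = word_eval A \<phi> w"
proof (induction n arbitrary: w)
  case 0
  show ?case by (simp only: normalize_word.simps peval_word)
next
  case (Suc n)
  show ?case
  proof (cases "reduce_word \<rho> w")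
    case None
    then show ?thesis by (simp only: normalize_word.simps option.case peval_word)
  next
    case (Some P)
    have "peval A z \<phi> (psum (\<lambda>(k, e, v). pscale k e (normalize_word \<rho> n v)) P)
        = peval A z \<phi> (psum (\<lambda>t. [t]) P)"
    proof (rule peval_psum)
      fix t show "peval A z \<phi> (case t of (k, e, v) \<Rightarrow> pscale k e (normalize_word \<rho> n v)) = peval A z \<phi> [t]"
        by (cases t) (simp only: prod.case peval_term[OF Suc.IH])
    qed
    then show ?thesis
      using Some peval_reduce_word[OF assms Some] by (simp only: normalize_word.simps option.case psum_term)
  qed
qed

lemma peval_insert_term: "peval A z \<phi> (insert_term t P) = peval A z \<phi> [t] \<oplus>\<^bsub>A\<^esub> peval A z \<phi> P"
proof (induction t P rule: insert_term.induct)
  case (1 t)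
  then show ?case using A by (cases t) (simp add: word_eval_closed)
next
  case (2 k e w l f v P)
  let ?w = "word_eval A \<phi> w"
  note c = word_eval_closed peval_closed
  have "coef z (k + l) e = coef z k e + coef z l e"
    by (simp add: coef_def algebra_simps)
  then have kl: "coef z k e \<odot>\<^bsub>A\<^esub> ?w \<oplus>\<^bsub>A\<^esub> (coef z l e \<odot>\<^bsub>A\<^esub> ?w \<oplus>\<^bsub>A\<^esub> peval A z \<phi> P)
      = coef z (k + l) e \<odot>\<^bsub>A\<^esub> ?w \<oplus>\<^bsub>A\<^esub> peval A z \<phi> P"
    using A by (simp add: cs_distrib cs_assoc c)
  show ?case
  proof (cases "e = f \<and> w = v")
    case True
    then show ?thesis
      using kl A by (cases "k + l = 0") (simp_all add: c coef_def)
  next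
    case False
    then show ?thesis
      using 2 A by (auto simp: c cs_ac)
  qed
qed

lemma peval_normalize:
  assumes "rules_sound A z \<phi> \<rho>"
  shows "peval A z \<phi> (normalize \<rho> n P) = peval A z \<phi> P"
proof -
  have fold: "peval A z \<phi> (fold insert_term Q R) = peval A z \<phi> Q \<oplus>\<^bsub>A\<^esub> peval A z \<phi> R" for Q R
  proof (induction Q arbitrary: R)
    case (Cons t Q)
    then show ?case
      using A by (cases t) (simp add: peval_insert_term word_eval_closed peval_closed cs_ac)
  qed (simp add: A peval_closed)
  have "peval A z \<phi> (psum (\<lambda>(k, e, w). pscale k e (normalize_word \<rho> n w)) P) = peval A z \<phi> (psum (\<lambda>t. [t]) P)"
  proof (rule peval_psum)
    fix t show "peval A z \<phi> (case t of (k, e, v) \<Rightarrow> pscale k e (normalize_word \<rho> n v)) = peval A z \<phi> [t]"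
      by (cases t) (simp only: prod.case peval_term[OF peval_normalize_word[OF assms]])
  qed
  then show ?thesis
    using A by (simp add: normalize_def fold psum_term peval_closed)
qed

text \<open>The bridge from computation to algebra: every finite check below is turned into an
  identity through this lemma.\<close>

lemma peval_eqI:
  assumes "rules_sound A z \<phi> \<rho>" "reduces_to_zero \<rho> n (P @ pneg Q)"
  shows "peval A z \<phi> P = peval A z \<phi> Q"
proof -
  have "peval A z \<phi> (P @ pneg Q) = \<zero>\<^bsub>A\<^esub>"
    using peval_normalize[OF assms(1), of n "P @ pneg Q"] assms(2) by (simp add: reduces_to_zero_def)
  then have "peval A z \<phi> P \<ominus>\<^bsub>A\<^esub> peval A z \<phi> Q = \<zero>\<^bsub>A\<^esub>"
    by (simp add: peval_append peval_pneg a_minus_def)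
  then show ?thesis
    by (rule iffD1[OF cs_minus_eq_zero_iff[OF complex_algebra_cspace[OF A] peval_closed peval_closed]])
qed

text \<open>When the images of generators under a map are themselves polynomials in the generators
  of the target, a relation evaluated at those images becomes a polynomial in the target, to which
  rewriting applies.\<close>

lemma peval_psubst:
  "peval A z (\<lambda>x. peval A z \<phi> (\<sigma> x)) P = peval A z \<phi> (psubst \<sigma> P)"
proof -
  have w: "word_eval A (\<lambda>x. peval A z \<phi> (\<sigma> x)) w = peval A z \<phi> (wsubst \<sigma> w)" for w
  proof (induction w)
    case Nil
    show ?case by (simp only: word_eval.simps wsubst.simps peval_word)
  qed (simp add: peval_pmul)
  show ?thesis
    by (induction P rule: ncpoly_induct) (simp_all add: w peval_append peval_pscale)
qed

end

end

lemma peval_pmap: "peval A z \<phi> (pmap h P) = peval A z (\<lambda>x. \<phi> (h x)) P"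
proof -
  have "word_eval A \<phi> (map h w) = word_eval A (\<lambda>x. \<phi> (h x)) w" for w
    by (induction w) simp_all
  then show ?thesis
    by (induction P rule: ncpoly_induct) simp_all
qed

lemma peval_hom:
  assumes A: "complex_algebra A" and h: "h \<in> algebra_hom A B" and B: "complex_algebra B"
    and \<phi>: "\<And>x. \<phi> x \<in> carrier A"
  shows "h (peval A z \<phi> P) = peval B z (\<lambda>x. h (\<phi> x)) P"
proof -
  note l = algebra_hom_linear[OF h]
  have w: "h (word_eval A \<phi> w) = word_eval B (\<lambda>x. h (\<phi> x)) w" for w
    by (induction w) (simp_all add: algebra_hom_one[OF h] algebra_hom_mult[OF h] \<phi> word_eval_closed[OF A])
  show ?thesis
    by (induction P rule: ncpoly_induct)
      (simp_all add: A B w complex_linear_zero[OF _ _ l] complex_linearD[OF l] word_eval_closed[OF A] \<phi>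
        peval_closed[OF A])
qed

subsection \<open>Two commuting families of generators\<close>

datatype ('g, 'h) two = Fst 'g | Snd 'h

text \<open>Rules for a tensor product of two algebras: letters of the second family are moved to
  the right of those of the first, after which each block is reduced by its own rules. Nesting the
  construction handles B \<otimes> (H \<otimes> H).\<close>

fun two_rules :: "'g rules \<Rightarrow> 'h rules \<Rightarrow> ('g, 'h) two rules"
  where "two_rules \<rho>1 \<rho>2 (Fst x) (Fst y) = map_option (pmap Fst) (\<rho>1 x y)"
  | "two_rules \<rho>1 \<rho>2 (Snd x) (Snd y) = map_option (pmap Snd) (\<rho>2 x y)"
  | "two_rules \<rho>1 \<rho>2 (Snd x) (Fst y) = Some [(1, 0, [Fst y, Snd x])]"
  | "two_rules \<rho>1 \<rho>2 (Fst x) (Snd y) = None"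

definition two_gen ::
    "(complex, 'a, 'm) module_scheme \<Rightarrow> (complex, 'b, 'n) module_scheme \<Rightarrow> ('g \<Rightarrow> 'a) \<Rightarrow> ('h \<Rightarrow> 'b)
      \<Rightarrow> ('g, 'h) two \<Rightarrow> ('a, 'b) tensor"
  where "two_gen A B \<phi> \<psi> t = (case t of Fst x \<Rightarrow> tens A B (\<phi> x) \<one>\<^bsub>B\<^esub> | Snd y \<Rightarrow> tens A B \<one>\<^bsub>A\<^esub> (\<psi> y))"

lemma tens_one_right_hom:
  assumes "complex_algebra A" "complex_algebra B"
  shows "(\<lambda>x. tens A B x \<one>\<^bsub>B\<^esub>) \<in> algebra_hom A (tensor_space A B)"
  using assms
  by (intro algebra_homI complex_linearI) (simp_all add: tens_simps tensor_mult_tens tensor_space_simps(3))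

lemma tens_one_left_hom:
  assumes "complex_algebra A" "complex_algebra B"
  shows "(\<lambda>y. tens A B \<one>\<^bsub>A\<^esub> y) \<in> algebra_hom B (tensor_space A B)"
  using assms
  by (intro algebra_homI complex_linearI) (simp_all add: tens_simps tensor_mult_tens tensor_space_simps(3))

context
  fixes A :: "(complex, 'a, 'm) module_scheme" and B :: "(complex, 'b, 'n) module_scheme"
    and \<phi> :: "'g \<Rightarrow> 'a" and \<psi> :: "'h \<Rightarrow> 'b"
  assumes A: "complex_algebra A" and B: "complex_algebra B"
    and \<phi>: "\<And>x. \<phi> x \<in> carrier A" and \<psi>: "\<And>x. \<psi> x \<in> carrier B"
begin

lemma two_gen_closed: "two_gen A B \<phi> \<psi> t \<in> carrier (tensor_space A B)"
  using A B \<phi> \<psi> by (simp add: two_gen_def split: two.split)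

lemma tens_peval:
  assumes "z \<noteq> 0"
  shows "tens A B (peval A z \<phi> P) (peval B z \<psi> Q)
    = peval (tensor_space A B) z (two_gen A B \<phi> \<psi>) (pmul (pmap Fst P) (pmap Snd Q))"
proof -
  have 1: "tens A B (peval A z \<phi> P) \<one>\<^bsub>B\<^esub> = peval (tensor_space A B) z (two_gen A B \<phi> \<psi>) (pmap Fst P)"
    using peval_hom[OF A tens_one_right_hom[OF A B] tensor_algebra[OF A B] \<phi>]
    by (simp add: peval_pmap two_gen_def)
  have 2: "tens A B \<one>\<^bsub>A\<^esub> (peval B z \<psi> Q) = peval (tensor_space A B) z (two_gen A B \<phi> \<psi>) (pmap Snd Q)"
    using peval_hom[OF B tens_one_left_hom[OF A B] tensor_algebra[OF A B] \<psi>]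
    by (simp add: peval_pmap two_gen_def)
  have "tens A B (peval A z \<phi> P) (peval B z \<psi> Q)
      = tens A B (peval A z \<phi> P) \<one>\<^bsub>B\<^esub> \<otimes>\<^bsub>tensor_space A B\<^esub> tens A B \<one>\<^bsub>A\<^esub> (peval B z \<psi> Q)"
    using A B by (simp add: tensor_mult_tens peval_closed[OF A \<phi>] peval_closed[OF B \<psi>])
  also have "\<dots> = peval (tensor_space A B) z (two_gen A B \<phi> \<psi>) (pmul (pmap Fst P) (pmap Snd Q))"
    by (simp only: 1 2 peval_pmul[OF tensor_algebra[OF A B] two_gen_closed assms])
  finally show ?thesis .
qed

text \<open>Rules within one family are transported along the embeddings x \<mapsto> x \<otimes> 1
  and y \<mapsto> 1 \<otimes> y; the exchange rule holds because the images of these embeddings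
  commute.\<close>

lemma two_rules_sound:
  assumes "rules_sound A z \<phi> \<rho>1" "rules_sound B z \<psi> \<rho>2"
  shows "rules_sound (tensor_space A B) z (two_gen A B \<phi> \<psi>) (two_rules \<rho>1 \<rho>2)"
  unfolding rules_sound_def
proof (intro allI impI)
  fix s t P assume st: "two_rules \<rho>1 \<rho>2 s t = Some P"
  let ?T = "tensor_space A B" and ?g = "two_gen A B \<phi> \<psi>"
  show "?g s \<otimes>\<^bsub>?T\<^esub> ?g t = peval ?T z ?g P"
  proof (cases s)
    case s: (Fst x)
    then obtain y where t: "t = Fst y"
      using st by (cases t) auto
    then obtain Q where Q: "\<rho>1 x y = Some Q" "P = pmap Fst Q"
      using st s by auto
    then have "\<phi> x \<otimes>\<^bsub>A\<^esub> \<phi> y = peval A z \<phi> Q"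
      using assms by (simp add: rules_sound_def)
    moreover have "tens A B (peval A z \<phi> Q) \<one>\<^bsub>B\<^esub> = peval ?T z ?g P"
      using peval_hom[OF A tens_one_right_hom[OF A B] tensor_algebra[OF A B] \<phi>]
      by (simp add: Q peval_pmap two_gen_def)
    ultimately show ?thesis
      using A B \<phi> by (simp add: s t two_gen_def tensor_mult_tens)
  next
    case s: (Snd x)
    show ?thesis
    proof (cases t)
      case t: (Fst y)
      have "P = [(1, 0, [Fst y, Snd x])]"
        using st s t by simp
      then show ?thesis
        using A B \<phi> \<psi> by (simp add: s t two_gen_def tensor_mult_tens coef_def tensor_space_simps(3)
            complex_algebra_cspace[OF tensor_algebra])
    next
      case t: (Snd y)
      then obtain Q where Q: "\<rho>2 x y = Some Q" "P = pmap Snd Q"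
        using st s by auto
      then have "\<psi> x \<otimes>\<^bsub>B\<^esub> \<psi> y = peval B z \<psi> Q"
        using assms by (simp add: rules_sound_def)
      moreover have "tens A B \<one>\<^bsub>A\<^esub> (peval B z \<psi> Q) = peval ?T z ?g P"
        using peval_hom[OF B tens_one_left_hom[OF A B] tensor_algebra[OF A B] \<psi>]
        by (simp add: Q peval_pmap two_gen_def)
      ultimately show ?thesis
        using A B \<psi> by (simp add: s t two_gen_def tensor_mult_tens)
    qed
  qed
qed

end

text \<open>The certificate expresses each rule as a linear combination of the relations.\<close>

lemma rules_sound_cert:
  fixes A :: "(complex, 'a, 'm) module_scheme" and \<phi> :: "'g \<Rightarrow> 'a"
  assumes A: "complex_algebra A" and \<phi>: "\<And>g. \<phi> g \<in> carrier A" and z: "z \<noteq> 0"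
    and rels: "\<And>r. r \<in> set rels \<Longrightarrow> peval A z \<phi> r = \<zero>\<^bsub>A\<^esub>"
    and cert: "\<And>x y P. \<rho> x y = Some P \<Longrightarrow> list_all (\<lambda>(k, e, i). i < length rels) (cert x y) \<and>
      reduces_to_zero (\<lambda>_ _. None) 0
        ([(1, 0, [x, y])] @ pneg (P @ psum (\<lambda>(k, e, i). pscale k e (rels ! i)) (cert x y)))"
  shows "rules_sound A z \<phi> \<rho>"
  unfolding rules_sound_def
proof (intro allI impI)
  fix x y P assume P: "\<rho> x y = Some P"
  have "peval A z \<phi> (psum (\<lambda>(k, e, i). pscale k e (rels ! i)) c) = \<zero>\<^bsub>A\<^esub>"
    if "list_all (\<lambda>(k, e, i). i < length rels) c" for c
    using that
  proof (induction c)
    case (Cons t c)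
    obtain k e i where t: "t = (k, e, i)"
      by (cases t)
    have "rels ! i \<in> set rels"
      using Cons.prems t by simp
    then show ?case
      using Cons A by (simp add: psum_def t peval_append[OF A \<phi>] peval_pscale[OF A \<phi> z] rels)
  qed (simp add: psum_def)
  then have "peval A z \<phi> (psum (\<lambda>(k, e, i). pscale k e (rels ! i)) (cert x y)) = \<zero>\<^bsub>A\<^esub>"
    using cert[OF P] by blast
  moreover have "rules_sound A z \<phi> (\<lambda>_ _. None)"
    by (simp add: rules_sound_def)
  then have "peval A z \<phi> [(1, 0, [x, y])]
      = peval A z \<phi> (P @ psum (\<lambda>(k, e, i). pscale k e (rels ! i)) (cert x y))"
    using cert[OF P] by (intro peval_eqI[OF A \<phi> z]) auto
  ultimately show "\<phi> x \<otimes>\<^bsub>A\<^esub> \<phi> y = peval A z \<phi> P"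
    using A \<phi> by (simp add: peval_append[OF A \<phi>] peval_closed[OF A \<phi>] coef_def)
qed

section \<open>The presentations of \<open>B\<^sub>q[SU\<^sub>2]\<close> and \<open>C\<^sub>q[SL\<^sub>2]\<close>\<close>

text \<open>Matrix entries are indexed by pairs of Booleans; \<open>False\<close> and \<open>True\<close> stand for the
  indices \<open>1\<close> and \<open>2\<close>.\<close>

type_synonym entry = "bool \<times> bool"

abbreviation (input) "cA \<equiv> (False, False)"
abbreviation (input) "cB \<equiv> (False, True)"
abbreviation (input) "cC \<equiv> (True, False)"
abbreviation (input) "cD \<equiv> (True, True)"

text \<open>Same order as in \<open>BqSU2_relations\<close>, with \<mu> expanded as 1 - q^-2; the
  certificates refer to positions in this list.\<close>

definition bq_rels :: "entry ncpoly list"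
  where "bq_rels =
    [[(1, 0, [cB, cA]), (- 1, 2, [cA, cB])],
     [(1, 0, [cA, cC]), (- 1, 2, [cC, cA])],
     [(1, 0, [cD, cA]), (- 1, 0, [cA, cD])],
     [(1, 0, [cB, cC]), (- 1, 0, [cC, cB]), (- 1, 0, [cA, cD]), (1, - 2, [cA, cD]), (1, 0, [cA, cA]), (- 1, - 2, [cA, cA])],
     [(1, 0, [cD, cB]), (- 1, 0, [cB, cD]), (- 1, 0, [cA, cB]), (1, - 2, [cA, cB])],
     [(1, 0, [cC, cD]), (- 1, 0, [cD, cC]), (- 1, 0, [cC, cA]), (1, - 2, [cC, cA])],
     [(1, 0, [cA, cD]), (- 1, 2, [cC, cB]), (- 1, 0, [])]]"

text \<open>Irreducible words have the form \<gamma>^i \<beta>^j \<alpha>^k or \<gamma>^i \<beta>^j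
  \<delta>^k: the determinant relation removes every neighbouring pair of \<alpha> and \<delta>. The
  rule for \<beta>\<gamma> is its commutation relation after this elimination of
  \<alpha>\<delta>.\<close>

fun bq_rules :: "entry rules"
  where "bq_rules cA cB = Some [(1, - 2, [cB, cA])]"
  | "bq_rules cA cC = Some [(1, 2, [cC, cA])]"
  | "bq_rules cA cD = Some [(1, 2, [cC, cB]), (1, 0, [])]"
  | "bq_rules cB cC = Some [(1, - 2, [cA, cA]), (- 1, 0, [cA, cA]), (1, 2, [cC, cB]), (- 1, - 2, []), (1, 0, [])]"
  | "bq_rules cD cA = Some [(1, 2, [cC, cB]), (1, 0, [])]"
  | "bq_rules cD cB = Some [(- 1, - 4, [cB, cA]), (1, - 2, [cB, cA]), (1, 0, [cB, cD])]"
  | "bq_rules cD cC = Some [(1, - 2, [cC, cA]), (- 1, 0, [cC, cA]), (1, 0, [cC, cD])]"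
  | "bq_rules _ _ = None"

text \<open>A triple \<open>(k, e, i)\<close> means k z^e times relation number \<open>i\<close>.
  Scalar combinations are enough, so the check runs with an empty set of rules and depth 0: it only
  collects equal terms.\<close>

fun bq_cert :: "entry \<Rightarrow> entry \<Rightarrow> (int \<times> int \<times> nat) list"
  where "bq_cert cA cB = [(- 1, - 2, 0)]"
  | "bq_cert cA cC = [(1, 0, 1)]"
  | "bq_cert cA cD = [(1, 0, 6)]"
  | "bq_cert cB cC = [(1, 0, 3), (1, 0, 6), (- 1, - 2, 6)]"
  | "bq_cert cD cA = [(1, 0, 2), (1, 0, 6)]"
  | "bq_cert cD cB = [(1, 0, 4), (- 1, - 2, 0), (1, - 4, 0)]"
  | "bq_cert cD cC = [(- 1, 0, 5)]"
  | "bq_cert _ _ = []"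

definition hq_rels :: "entry ncpoly list"
  where "hq_rels =
    [[(1, 0, [cB, cA]), (- 1, 1, [cA, cB])],
     [(1, 0, [cC, cA]), (- 1, 1, [cA, cC])],
     [(1, 0, [cD, cB]), (- 1, 1, [cB, cD])],
     [(1, 0, [cD, cC]), (- 1, 1, [cC, cD])],
     [(1, 0, [cB, cC]), (- 1, 0, [cC, cB])],
     [(1, 0, [cD, cA]), (- 1, 0, [cA, cD]), (- 1, 1, [cB, cC]), (1, - 1, [cB, cC])],
     [(1, 0, [cA, cD]), (- 1, - 1, [cB, cC]), (- 1, 0, [])]]"

text \<open>Irreducible words have the form b^i c^j a^k or b^i c^j d^k; neighbouring a and d are
  eliminated by the quantum determinant.\<close>

fun hq_rules :: "entry rules"
  where "hq_rules cA cB = Some [(1, - 1, [cB, cA])]"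
  | "hq_rules cA cC = Some [(1, - 1, [cC, cA])]"
  | "hq_rules cA cD = Some [(1, - 1, [cB, cC]), (1, 0, [])]"
  | "hq_rules cC cB = Some [(1, 0, [cB, cC])]"
  | "hq_rules cD cA = Some [(1, 1, [cB, cC]), (1, 0, [])]"
  | "hq_rules cD cB = Some [(1, 1, [cB, cD])]"
  | "hq_rules cD cC = Some [(1, 1, [cC, cD])]"
  | "hq_rules _ _ = None"

fun hq_cert :: "entry \<Rightarrow> entry \<Rightarrow> (int \<times> int \<times> nat) list"
  where "hq_cert cA cB = [(- 1, - 1, 0)]"
  | "hq_cert cA cC = [(- 1, - 1, 1)]"
  | "hq_cert cA cD = [(1, 0, 6)]"
  | "hq_cert cC cB = [(- 1, 0, 4)]"
  | "hq_cert cD cA = [(1, 0, 5), (1, 0, 6)]"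
  | "hq_cert cD cB = [(1, 0, 2)]"
  | "hq_cert cD cC = [(1, 0, 3)]"
  | "hq_cert _ _ = []"

text \<open>Generator first, form second: \<open>bq_row x i\<close> lists the nonzero components of
  e_i u_x. Each entry solves a stated commutator for e_i u_x and expands \<mu>; for instance q
  \<mu>^2 becomes q - 2 q^-1 + q^-3.\<close>

fun bq_row :: "entry \<Rightarrow> entry \<Rightarrow> (entry \<times> entry ncpoly) list"
  where "bq_row cA cA = [(cA, [(1, 1, [cA])])]"
  | "bq_row cA cB = [(cB, [(1, - 1, [cA])])]"
  | "bq_row cA cC = [(cA, [(- 1, 0, [cB]), (1, 2, [cB])]), (cC, [(1, 1, [cA])])]"
  | "bq_row cA cD = [(cB, [(- 1, - 2, [cB]), (1, 0, [cB])]), (cD, [(1, - 1, [cA])])]"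
  | "bq_row cB cA = [(cA, [(1, - 1, [cB])])]"
  | "bq_row cB cB = [(cA, [(- 1, - 2, [cA]), (1, 0, [cA])]), (cB, [(1, - 1, [cB])])]"
  | "bq_row cB cC = [(cC, [(1, 1, [cB])])]"
  | "bq_row cB cD = [(cA, [(1, - 3, [cB]), (- 2, - 1, [cB]), (1, 1, [cB])]), (cC, [(- 1, - 2, [cA]), (1, 0, [cA])]), (cD, [(1, 1, [cB])])]"
  | "bq_row cC cA = [(cA, [(1, 1, [cC])]), (cB, [(- 1, - 2, [cA]), (1, 0, [cA])])]"
  | "bq_row cC cB = [(cB, [(1, 1, [cC])])]"
  | "bq_row cC cC = [(cA, [(1, - 2, [cA]), (- 1, 0, [cA]), (- 1, - 2, [cD]), (1, 0, [cD])]), (cB, [(1, - 3, [cB]), (- 2, - 1, [cB]), (1, 1, [cB])]), (cC, [(1, - 1, [cC])]), (cD, [(- 1, - 2, [cA]), (1, 0, [cA])])]"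
  | "bq_row cC cD = [(cB, [(1, - 2, [cA]), (- 1, 0, [cA]), (- 1, - 2, [cD]), (1, 0, [cD])]), (cD, [(1, - 1, [cC])])]"
  | "bq_row cD cA = [(cA, [(1, - 3, [cA]), (- 2, - 1, [cA]), (1, 1, [cA]), (1, - 1, [cD])]), (cB, [(- 1, - 2, [cB]), (1, 0, [cB])])]"
  | "bq_row cD cB = [(cA, [(- 1, 0, [cC]), (1, 2, [cC])]), (cB, [(1, 1, [cD])])]"
  | "bq_row cD cC = [(cA, [(2, - 2, [cB]), (- 3, 0, [cB]), (1, 2, [cB])]), (cC, [(1, - 3, [cA]), (- 2, - 1, [cA]), (1, 1, [cA]), (1, - 1, [cD])]), (cD, [(- 1, 0, [cB]), (1, 2, [cB])])]"
  | "bq_row cD cD = [(cA, [(- 1, - 3, [cA]), (2, - 1, [cA]), (- 1, 1, [cA]), (1, - 3, [cD]), (- 2, - 1, [cD]), (1, 1, [cD])]), (cB, [(1, - 2, [cB]), (- 1, 0, [cB])]), (cC, [(- 1, - 2, [cC]), (1, 0, [cC])]), (cD, [(1, 1, [cD])])]"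


section \<open>Polynomial data for the right action, the coactions and the Hopf structure\<close>

definition entries :: "entry list" where "entries = [cA, cB, cC, cD]"

definition bq_action :: "entry \<Rightarrow> entry \<Rightarrow> entry \<Rightarrow> entry ncpoly"
  where "bq_action x i j = psum (\<lambda>(k, P). if k = j then P else []) (bq_row x i)"

text \<open>A symbolic matrix product: entry (i, j) of the matrix of right multiplication by a word,
  as a polynomial in the generators of B.\<close>

fun msubst_word :: "entry list \<Rightarrow> entry \<Rightarrow> entry \<Rightarrow> entry ncpoly"
  where "msubst_word [] i j = (if i = j then [(1, 0, [])] else [])"
  | "msubst_word (x # w) i j = psum (\<lambda>k. pmul (bq_action x i k) (msubst_word w k j)) entries"

fun msubst :: "entry ncpoly \<Rightarrow> entry \<Rightarrow> entry \<Rightarrow> entry ncpoly"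
  where "msubst [] i j = []"
  | "msubst ((k, e, w) # P) i j = pscale k e (msubst_word w i j) @ msubst P i j"

fun hq_antipode :: "entry \<Rightarrow> entry ncpoly"
  where "hq_antipode cA = [(1, 0, [cD])]"
  | "hq_antipode cB = [(- 1, 1, [cB])]"
  | "hq_antipode cC = [(- 1, - 1, [cC])]"
  | "hq_antipode cD = [(1, 0, [cA])]"

text \<open>The coefficient in H of u_s in the adjoint coaction of u_x: with x = (i, j) and s = (m,
  n) it is (S t^i_m) t^n_j.\<close>

definition adj :: "entry \<Rightarrow> entry \<Rightarrow> entry ncpoly"
  where "adj x s = pmul (hq_antipode (fst x, fst s)) [(1, 0, [(snd s, snd x)])]"

definition bq_coaction :: "entry \<Rightarrow> (entry, entry) two ncpoly"
  where "bq_coaction x = psum (\<lambda>s. pmul (pmap Fst [(1, 0, [s])]) (pmap Snd (adj x s))) entries"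

text \<open>The coefficient in H of e_k in the coaction of e_i: with i = (\<alpha>, \<beta>) and k =
  (m, n) it is t^m_\<alpha> S t^\<beta>_n.\<close>

definition form_coaction :: "entry \<Rightarrow> entry \<Rightarrow> entry ncpoly"
  where "form_coaction i k = pmul [(1, 0, [(fst k, fst i)])] (hq_antipode (snd i, snd k))"

definition hq_comult :: "entry \<Rightarrow> (entry, entry) two ncpoly"
  where "hq_comult x = psum (\<lambda>k. [(1, 0, [Fst (fst x, k), Snd (k, snd x)])]) [False, True]"

text \<open>Reversing words turns evaluation in the opposite algebra into evaluation in the algebra
  itself; needed because the antipode reverses products.\<close>

definition prev :: "'g ncpoly \<Rightarrow> 'g ncpoly"
  where "prev P = map (\<lambda>(k, e, w). (k, e, rev w)) P"

definition hq_counit :: "entry \<Rightarrow> entry ncpoly"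
  where "hq_counit x = (if fst x = snd x then [(1, 0, [])] else [])"

text \<open>The coefficient in B \<otimes> H of e_l \<otimes> 1 in the coaction of e_i u_x, computed
  by first multiplying and then coacting.\<close>

definition cov_left :: "entry \<Rightarrow> entry \<Rightarrow> entry \<Rightarrow> (entry, entry) two ncpoly"
  where "cov_left x i l =
    psum (\<lambda>j. pmul (psubst bq_coaction (bq_action x i j)) (pmap Snd (form_coaction j l))) entries"

text \<open>The same coefficient computed in the other order: the coaction of e_i is multiplied on
  the right by the coaction of u_x.\<close>

definition cov_right :: "entry \<Rightarrow> entry \<Rightarrow> entry \<Rightarrow> (entry, entry) two ncpoly"
  where "cov_right x i l = psum (\<lambda>k. psum (\<lambda>s.
    pmul (pmap Fst (bq_action s k l)) (pmap Snd (pmul (form_coaction i k) (adj x s)))) entries) entries"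

text \<open>The embedding y \<mapsto> y \<otimes> 1 of B \<otimes> H into B \<otimes> (H \<otimes>
  H), on generators.\<close>

fun reassoc :: "('f, 'g) two \<Rightarrow> ('f, ('g, 'h) two) two"
  where "reassoc (Fst x) = Fst x" | "reassoc (Snd y) = Snd (Fst y)"

fun coassoc_left :: "(entry, entry) two \<Rightarrow> (entry, (entry, entry) two) two ncpoly"
  where "coassoc_left (Fst x) = pmap reassoc (bq_coaction x)"
  | "coassoc_left (Snd y) = [(1, 0, [Snd (Snd y)])]"

fun coassoc_right :: "(entry, entry) two \<Rightarrow> (entry, (entry, entry) two) two ncpoly"
  where "coassoc_right (Fst x) = [(1, 0, [Fst x])]"
  | "coassoc_right (Snd y) = pmap Snd (hq_comult y)"

fun counit_subst :: "(entry, entry) two \<Rightarrow> entry ncpoly"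
  where "counit_subst (Fst x) = [(1, 0, [x])]"
  | "counit_subst (Snd y) = hq_counit y"

text \<open>\<open>theta x\<close> is the row of components of \<open>\<mu> du\<^sub>x = \<theta> u\<^sub>x - u\<^sub>x \<theta>\<close>.\<close>

definition theta :: "entry \<Rightarrow> entry \<Rightarrow> entry ncpoly"
  where "theta x j = bq_action x cA j @ bq_action x cD j @
    (if j = cA \<or> j = cD then [(- 1, 0, [x])] else [])"

section \<open>The finite polynomial identities, established by computation\<close>

lemma bq_cert_check: "list_all (\<lambda>x. list_all (\<lambda>y. case bq_rules x y of None \<Rightarrow> True
  | Some P \<Rightarrow> list_all (\<lambda>(k, e, i). i < length bq_rels) (bq_cert x y) \<and> reduces_to_zero (\<lambda>_ _. None) 0
      ([(1, 0, [x, y])] @ pneg (P @ psum (\<lambda>(k, e, i). pscale k e (bq_rels ! i)) (bq_cert x y)))) entries) entries"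
  by code_simp

lemma hq_cert_check: "list_all (\<lambda>x. list_all (\<lambda>y. case hq_rules x y of None \<Rightarrow> True
  | Some P \<Rightarrow> list_all (\<lambda>(k, e, i). i < length hq_rels) (hq_cert x y) \<and> reduces_to_zero (\<lambda>_ _. None) 0
      ([(1, 0, [x, y])] @ pneg (P @ psum (\<lambda>(k, e, i). pscale k e (hq_rels ! i)) (hq_cert x y)))) entries) entries"
  by code_simp

lemma antipode_check: "list_all (\<lambda>r. reduces_to_zero hq_rules 10 (psubst hq_antipode (prev r) @ pneg [])) hq_rels"
  by code_simp

lemma comult_check:
  "list_all (\<lambda>r. reduces_to_zero (two_rules hq_rules hq_rules) 20 (psubst hq_comult r @ pneg [])) hq_rels"
  by code_simp

text \<open>The consistency of the bimodule relations: the matrices read off from them satisfy the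
  seven relations of B, entry by entry.\<close>

lemma action_check: "list_all (\<lambda>r. list_all (\<lambda>i. list_all (\<lambda>j.
    reduces_to_zero bq_rules 20 (msubst r i j @ pneg [])) entries) entries) bq_rels"
  by code_simp

lemma coaction_check:
  "list_all (\<lambda>r. reduces_to_zero (two_rules bq_rules hq_rules) 40 (psubst bq_coaction r @ pneg [])) bq_rels"
  by code_simp

lemma coassoc_check: "list_all (\<lambda>x. reduces_to_zero (two_rules bq_rules (two_rules hq_rules hq_rules)) 40
    (psubst coassoc_left (bq_coaction x) @ pneg (psubst coassoc_right (bq_coaction x)))) entries"
  by code_simp

lemma counit_check: "list_all (\<lambda>x. reduces_to_zero bq_rules 10
    (psubst counit_subst (bq_coaction x) @ pneg [(1, 0, [x])])) entries"
  by code_simp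

text \<open>Write e_i \<mapsto> sum over k of e_k \<otimes> T_ik. Comparing coefficients of e_l,
  coassociativity says that the coproduct of T_il is the sum of T_kl \<otimes> T_ik; the indices run
  in this order because the coaction is on the right.\<close>

lemma form_coassoc_check: "list_all (\<lambda>i. list_all (\<lambda>l. reduces_to_zero (two_rules hq_rules hq_rules) 20
    (psubst hq_comult (form_coaction i l) @
      pneg (psum (\<lambda>k. pmul (pmap Fst (form_coaction k l)) (pmap Snd (form_coaction i k))) entries))) entries) entries"
  by code_simp

text \<open>For k = (m, n) the left side is the sum over \<alpha> of t^m_\<alpha> S t^\<alpha>_n,
  which the antipode axiom contracts to the counit of t^m_n. It says that \<theta>, the trace of the
  matrix of forms, is coinvariant.\<close>

lemma form_theta_check: "list_all (\<lambda>k. reduces_to_zero hq_rules 20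
    ((form_coaction cA k @ form_coaction cD k) @ pneg (hq_counit k))) entries"
  by code_simp

lemma covariance_check: "list_all (\<lambda>x. list_all (\<lambda>i. list_all (\<lambda>l. reduces_to_zero (two_rules bq_rules hq_rules) 40
    (cov_left x i l @ pneg (cov_right x i l))) entries) entries) entries"
  by code_simp

text \<open>Each multiple of a basis form below is a left \<open>B\<close>-combination of the \<open>\<mu> du\<^sub>x\<close>; the determinant of the
  combinations giving \<open>e\<^sub>a\<close> and \<open>e\<^sub>d\<close> is \<open>q\<^sup>-\<^sup>6 (1 - q) (q\<^sup>3 - 1) (q\<^sup>2 - 1)\<close>.\<close>

definition spanP :: "entry \<Rightarrow> entry ncpoly"
  where "spanP x = (if x = cD then [(1, 0, [cA])] else if x = cB then [(- 1, 2, [cC])] else [])"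

definition spanQ :: "entry \<Rightarrow> entry ncpoly"
  where "spanQ x = (if x = cA then [(1, 0, [cD]), (- 1, 0, [cA]), (1, - 2, [cA])]
    else if x = cC then [(- 1, 0, [cB])] else [])"

text \<open>Summed against the rows \<open>theta x\<close>, \<open>spanP\<close> yields (q - 1 -
  q^-1 + q^-3) e_a + (q - 1) e_d and \<open>spanQ\<close> yields q^-2 ((q - 1) e_a + (q^-1 - 1)
  e_d): the relations turn the products of generators into multiples of the quantum determinant or
  into zero. The cases e_a and e_d apply Cramer's rule to these two combinations. For e_b the pair
  \<alpha>, -q^2 \<gamma> is attached to d\<gamma> and d\<alpha> instead, leaving \<mu> e_b; for e_c
  the pair \<delta> - \<mu> \<alpha>, -\<beta> is attached to d\<beta> and d\<delta>, leaving q^-2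
  \<mu> e_c.\<close>

definition span_coeff :: "entry \<Rightarrow> entry \<Rightarrow> entry ncpoly"
  where "span_coeff i x =
    (if i = cA then pmul [(1, - 3, []), (- 1, - 2, [])] (spanP x) @ pmul [(1, 0, []), (- 1, 1, [])] (spanQ x)
     else if i = cB then (if x = cC then [(1, 0, [cA])] else if x = cA then [(- 1, 2, [cC])] else [])
     else if i = cC then (if x = cB then [(1, 0, [cD]), (- 1, 0, [cA]), (1, - 2, [cA])]
       else if x = cD then [(- 1, 0, [cB])] else [])
     else pmul [(1, - 2, []), (- 1, - 1, [])] (spanP x)
       @ pmul [(- 1, 0, []), (1, - 3, []), (1, 1, []), (- 1, - 1, [])] (spanQ x))"

definition span_scale :: "entry \<Rightarrow> entry ncpoly"
  where "span_scale i = (if i = cB then [(1, 0, []), (- 1, - 2, [])]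
    else if i = cC then [(1, - 2, []), (- 1, - 4, [])]
    else [(1, - 6, []), (- 1, - 5, []), (- 1, - 4, []), (1, - 2, []), (1, - 1, []), (- 1, 0, [])])"

lemma span_check: "list_all (\<lambda>i. list_all (\<lambda>j. reduces_to_zero bq_rules 10
    (psum (\<lambda>x. pmul (span_coeff i x) (theta x j)) entries @ pneg (if i = j then span_scale i else []))) entries) entries"
  by code_simp

section \<open>Matching the computed data with the index type \<open>2\<close> and the stated
  relations\<close>

definition idx :: "bool \<Rightarrow> 2"
  where "idx b = (if b then 2 else 1)"

definition ix :: "entry \<Rightarrow> 2 \<times> 2"
  where "ix x = (idx (fst x), idx (snd x))"

lemma UNIV_two: "(UNIV :: 2 set) = {1, 2}"
  by (rule card_subset_eq[symmetric]) simp_all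

lemma idx_cases: obtains b where "i = idx b"
proof -
  have "i \<in> {1, 2}"
    using UNIV_two by auto
  then have "i = idx False \<or> i = idx True"
    by (auto simp: idx_def)
  then show ?thesis
    using that by blast
qed

lemma ix_cases: obtains x where "p = ix x"
proof -
  obtain b c where "fst p = idx b" "snd p = idx c"
    using idx_cases by metis
  then have "p = ix (b, c)"
    by (simp add: ix_def prod_eq_iff)
  then show ?thesis ..
qed

lemma idx_eq_iff [simp]: "idx b = idx c \<longleftrightarrow> b = c"
  by (simp add: idx_def)

lemma all_entries: "list_all P entries \<longleftrightarrow> (\<forall>x. P x)"
  by (auto simp: entries_def all_bool_eq)

lemma set_entries: "set entries = UNIV"
  by (auto simp: entries_def)

lemma finsum_two:
  assumes "cspace V" "f 1 \<in> carrier V" "f 2 \<in> carrier V"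
  shows "finsum V f (UNIV :: 2 set) = f 1 \<oplus>\<^bsub>V\<^esub> f 2"
proof -
  have "finsum V f {1, 2} = f 1 \<oplus>\<^bsub>V\<^esub> finsum V f {2}"
    using assms by (intro cs_finsum_insert) auto
  also have "finsum V f {2} = f 2"
    using assms by (subst cs_finsum_insert) auto
  finally show ?thesis
    by (simp add: UNIV_two)
qed

lemma cs_combine:
  assumes "cspace V" "x \<in> carrier V"
  shows "c \<odot>\<^bsub>V\<^esub> x \<oplus>\<^bsub>V\<^esub> d \<odot>\<^bsub>V\<^esub> x = (c + d) \<odot>\<^bsub>V\<^esub> x"
    and "y \<in> carrier V \<Longrightarrow> c \<odot>\<^bsub>V\<^esub> x \<oplus>\<^bsub>V\<^esub> (d \<odot>\<^bsub>V\<^esub> x \<oplus>\<^bsub>V\<^esub> y) = (c + d) \<odot>\<^bsub>V\<^esub> x \<oplus>\<^bsub>V\<^esub> y"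
    and "x \<oplus>\<^bsub>V\<^esub> d \<odot>\<^bsub>V\<^esub> x = (1 + d) \<odot>\<^bsub>V\<^esub> x"
  using assms by (simp_all add: cs_distrib cs_assoc)

text \<open>An ordered copy of the set of relations, so that it can be compared position by position
  with \<open>bq_rels\<close>.\<close>

definition bq_relation_list :: "real \<Rightarrow> (2 \<times> 2) free_algebra list"
  where "bq_relation_list q =
    (let \<alpha> = free_gen (1, 1); \<beta> = free_gen (1, 2); \<gamma> = free_gen (2, 1); \<delta> = free_gen (2, 2);
         s = (\<lambda>r::real. free_scalar (complex_of_real r)); \<mu> = 1 - 1 / q\<^sup>2
     in [\<beta> * \<alpha> - s (q\<^sup>2) * \<alpha> * \<beta>,
         \<alpha> * \<gamma> - s (q\<^sup>2) * \<gamma> * \<alpha>,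
         \<delta> * \<alpha> - \<alpha> * \<delta>,
         (\<beta> * \<gamma> - \<gamma> * \<beta>) - s \<mu> * \<alpha> * (\<delta> - \<alpha>),
         (\<delta> * \<beta> - \<beta> * \<delta>) - s \<mu> * \<alpha> * \<beta>,
         (\<gamma> * \<delta> - \<delta> * \<gamma>) - s \<mu> * \<gamma> * \<alpha>,
         (\<alpha> * \<delta> - s (q\<^sup>2) * \<gamma> * \<beta>) - 1])"

definition hq_relation_list :: "real \<Rightarrow> (2 \<times> 2) free_algebra list"
  where "hq_relation_list q =
    (let a = free_gen (1, 1); b = free_gen (1, 2); c = free_gen (2, 1); d = free_gen (2, 2);
         s = (\<lambda>r::real. free_scalar (complex_of_real r))
     in [b * a - s q * a * b,
         c * a - s q * a * c,
         d * b - s q * b * d,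
         d * c - s q * c * d,
         b * c - c * b,
         (d * a - a * d) - s (q - 1 / q) * b * c,
         (a * d - s (1 / q) * b * c) - 1])"

lemma set_bq_relation_list: "set (bq_relation_list q) = BqSU2_relations q"
  by (simp add: bq_relation_list_def BqSU2_relations_def Let_def)

lemma set_hq_relation_list: "set (hq_relation_list q) = CqSL2_relations q"
  by (simp add: hq_relation_list_def CqSL2_relations_def Let_def)

context
  fixes A :: "(complex, 'a, 'm) module_scheme" and \<phi> :: "2 \<times> 2 \<Rightarrow> 'a" and q :: real
  assumes A: "complex_algebra A" and \<phi>: "\<And>g. \<phi> g \<in> carrier A" and q: "q \<noteq> 0"
begin

private lemma free_eval_scalar: "free_eval A \<phi> (free_scalar c) = c \<odot>\<^bsub>A\<^esub> \<one>\<^bsub>A\<^esub>"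
  using free_eval_scalar_mult[OF A \<phi>, where p = 1 and c = c] by (simp add: free_eval_one[OF A \<phi>])

private lemmas rel_simps = free_eval_scalar divide_inverse free_eval_simps[OF A \<phi>] ix_def idx_def coef_def A \<phi> cs_minus ca_smult ca_distrib
  cs_distrib(2) cs_smult_smult power_int_minus cs_assoc cs_combine

lemma free_eval_bq_relations:
  "map (free_eval A \<phi>) (bq_relation_list q) = map (peval A (complex_of_real q) (\<lambda>x. \<phi> (ix x))) bq_rels"
  using q by (simp add: bq_relation_list_def bq_rels_def Let_def rel_simps)

lemma free_eval_hq_relations:
  "map (free_eval A \<phi>) (hq_relation_list q) = map (peval A (complex_of_real q) (\<lambda>x. \<phi> (ix x))) hq_rels"
  using q by (simp add: hq_relation_list_def hq_rels_def Let_def rel_simps)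

end

text \<open>Evaluating at the generators of the presented algebra itself is the quotient map. Hence
  the defining relations evaluate to zero there, which is what the certificates for the rewriting
  rules start from.\<close>

lemma free_eval_presented:
  fixes R :: "'g free_algebra set"
  shows "free_eval (presented_algebra R) (presented_gen R) p = presented_class R p"
proof -
  note ev = free_eval_scale free_eval_add free_eval_mult free_eval_gen free_eval_one free_eval_zero
  note ev' = ev[OF presented_algebra_complex_algebra presented_gen_closed, of R]
  have word: "free_eval (presented_algebra R) (presented_gen R) (Poly_Mapping.single (Word w) 1)
      = presented_class R (Poly_Mapping.single (Word w) 1)" for w :: "'g list"
  proof (induction w)
    case Nil
    have "Poly_Mapping.single (Word []) 1 = (1 :: 'g free_algebra)"
      by (simp add: zero_word_def[symmetric])
    then show ?case
      by (simp add: ev' presented_class_ops)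
  next
    case (Cons g w)
    have "Poly_Mapping.single (Word (g # w)) 1 = free_gen g * Poly_Mapping.single (Word w) 1"
      by (simp add: free_gen_def mult_single plus_word_def)
    then show ?case
      by (simp add: ev' Cons.IH presented_class_ops(4)[symmetric] presented_gen_def[symmetric])
  qed
  have "Poly_Mapping.keys p \<subseteq> UNIV" by simp
  then show ?thesis
  proof (induction p rule: poly_mapping_induct_on)
    case zero
    show ?case by (simp add: ev' presented_class_ops)
  next
    case (single k c)
    obtain w where k: "k = Word w" by (cases k)
    have s: "Poly_Mapping.single k c = scale_fun c (Poly_Mapping.single k 1)" by simp
    show ?case
      unfolding s ev' presented_class_ops(5)[symmetric] by (simp only: k word)
  next
    case (add p r)
    then show ?case by (simp add: ev' presented_class_ops)
  qed
qed

lemma free_eval_presented_relation: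
  "r \<in> R \<Longrightarrow> free_eval (presented_algebra R) (presented_gen R) r = \<zero>\<^bsub>presented_algebra R\<^esub>"
  by (simp add: free_eval_presented presented_class_relation presented_class_ops)

section \<open>The two algebras with their generators, and the Hopf record over its underlying
  algebra\<close>

definition ug :: "real \<Rightarrow> entry \<Rightarrow> bq" where "ug q x = u_gen q (idx (fst x)) (idx (snd x))"

definition tg :: "real \<Rightarrow> entry \<Rightarrow> cq" where "tg q x = t_gen q (idx (fst x)) (idx (snd x))"

lemma ug_presented: "ug q x = presented_gen (BqSU2_relations q) (ix x)"
  by (simp add: ug_def u_gen_def ix_def)

lemma tg_presented: "tg q x = presented_gen (CqSL2_relations q) (ix x)"
  by (simp add: tg_def t_gen_def ix_def)

lemma BqSU2_algebra [simp]: "complex_algebra (BqSU2 q)"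
  by (simp add: BqSU2_def)

lemma ug_closed [simp]: "ug q x \<in> carrier (BqSU2 q)"
  by (simp add: ug_presented BqSU2_def)

lemma CqSL2_simps:
  "carrier (CqSL2 q) = carrier (CqSL2_algebra q)"
  "(\<otimes>\<^bsub>CqSL2 q\<^esub>) = (\<otimes>\<^bsub>CqSL2_algebra q\<^esub>)"
  "\<one>\<^bsub>CqSL2 q\<^esub> = \<one>\<^bsub>CqSL2_algebra q\<^esub>"
  "\<zero>\<^bsub>CqSL2 q\<^esub> = \<zero>\<^bsub>CqSL2_algebra q\<^esub>"
  "(\<oplus>\<^bsub>CqSL2 q\<^esub>) = (\<oplus>\<^bsub>CqSL2_algebra q\<^esub>)"
  "(\<odot>\<^bsub>CqSL2 q\<^esub>) = (\<odot>\<^bsub>CqSL2_algebra q\<^esub>)"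
  by (simp_all add: CqSL2_def Let_def module.defs)

lemma CqSL2_algebra_algebra [simp]: "complex_algebra (CqSL2_algebra q)"
  by (simp add: CqSL2_algebra_def)

lemma CqSL2_cspace: "cspace (CqSL2 q)"
proof -
  have H: "cspace (CqSL2_algebra q)" by simp
  show ?thesis
  proof (rule cspaceI)
    show "abelian_group (CqSL2 q)"
    proof (rule abelian_groupI)
      fix x assume "x \<in> carrier (CqSL2 q)"
      then have "\<ominus>\<^bsub>CqSL2_algebra q\<^esub> x \<in> carrier (CqSL2 q)"
        "\<ominus>\<^bsub>CqSL2_algebra q\<^esub> x \<oplus>\<^bsub>CqSL2 q\<^esub> x = \<zero>\<^bsub>CqSL2 q\<^esub>"
        using abelian_group.l_neg[OF cspace_abelian_group[OF H]] H by (simp_all add: CqSL2_simps)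
      then show "\<exists>y\<in>carrier (CqSL2 q). y \<oplus>\<^bsub>CqSL2 q\<^esub> x = \<zero>\<^bsub>CqSL2 q\<^esub>"
        by blast
    qed (simp_all add: CqSL2_simps cs_ac[OF H])
  qed (simp_all add: CqSL2_simps cs_distrib[OF H] cs_smult_smult[OF H])
qed

lemma CqSL2_complex_algebra [simp]: "complex_algebra (CqSL2 q)"
proof (rule complex_algebraI[OF CqSL2_cspace])
  note b = complex_bilinearD[OF ca_mult_bilinear[OF CqSL2_algebra_algebra[of q]]]
  show "(\<otimes>\<^bsub>CqSL2 q\<^esub>) \<in> complex_bilinear (CqSL2 q) (CqSL2 q) (CqSL2 q)"
    by (intro complex_bilinearI complex_linearI) (simp_all add: CqSL2_simps b)
qed (simp_all add: CqSL2_simps ca_assoc)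

lemma algebra_hom_CqSL2_left: "algebra_hom (CqSL2 q) W = algebra_hom (CqSL2_algebra q) W"
  by (simp add: algebra_hom_def ring_hom_def complex_linear_def CqSL2_simps)

text \<open>The coproduct inside \<open>CqSL2\<close> is built over the tensor square of the bare
  algebra, whereas the comodule axioms refer to the Hopf record; both give the same sets of
  representatives.\<close>

lemma tens_CqSL2:
  "tensor_space (CqSL2_algebra q) (CqSL2_algebra q) = tensor_space (CqSL2 q) (CqSL2 q)"
  "tens (CqSL2_algebra q) (CqSL2_algebra q) = tens (CqSL2 q) (CqSL2 q)"
proof -
  have "tensor_null (CqSL2_algebra q) (CqSL2_algebra q) = tensor_null (CqSL2 q) (CqSL2 q)"
    by (intro tensor_null_cong) (simp_all add: CqSL2_simps)
  moreover have "tensor_reps (CqSL2_algebra q) (CqSL2_algebra q) = tensor_reps (CqSL2 q) (CqSL2 q)"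
    by (simp add: tensor_reps_def CqSL2_simps)
  ultimately have c: "tensor_class (CqSL2_algebra q) (CqSL2_algebra q) = tensor_class (CqSL2 q) (CqSL2 q)"
    "tensor_reps (CqSL2_algebra q) (CqSL2_algebra q) = tensor_reps (CqSL2 q) (CqSL2 q)"
    by (simp_all add: tensor_class_def fun_eq_iff)
  then show t: "tens (CqSL2_algebra q) (CqSL2_algebra q) = tens (CqSL2 q) (CqSL2 q)"
    by (simp add: tens_def fun_eq_iff)
  show "tensor_space (CqSL2_algebra q) (CqSL2_algebra q) = tensor_space (CqSL2 q) (CqSL2 q)"
    using c t by (simp add: tensor_space_def tensor_op_def[abs_def] CqSL2_simps)
qed

lemma tg_closed [simp]: "tg q x \<in> carrier (CqSL2 q)"
  by (simp add: tg_presented CqSL2_simps CqSL2_algebra_def)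

lemma peval_CqSL2: "peval (CqSL2_algebra q) z \<phi> P = peval (CqSL2 q) z \<phi> P"
proof -
  have "word_eval (CqSL2_algebra q) \<phi> w = word_eval (CqSL2 q) \<phi> w" for w
    by (induction w) (simp_all add: CqSL2_simps)
  then show ?thesis
    by (induction P rule: ncpoly_induct) (simp_all add: CqSL2_simps)
qed

section \<open>Sound rewriting rules and universal properties for a nonzero parameter\<close>

locale nonzero_parameter =
  fixes q :: real
  assumes q: "q \<noteq> 0"
begin

abbreviation "z \<equiv> complex_of_real q"
abbreviation "B \<equiv> BqSU2 q"
abbreviation "H \<equiv> CqSL2 q"
abbreviation "BH \<equiv> tensor_space B H"
abbreviation "HH \<equiv> tensor_space H H"
abbreviation "bt \<equiv> two_gen B H (ug q) (tg q)"
abbreviation "tt \<equiv> two_gen H H (tg q) (tg q)"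

lemma z: "z \<noteq> 0" using q by simp

lemma bq_rules_sound: "rules_sound (BqSU2 q) (complex_of_real q) (ug q) bq_rules"
proof (rule rules_sound_cert[where rels = bq_rels and cert = bq_cert])
  fix r assume "r \<in> set bq_rels"
  then have "peval B z (ug q) r \<in> set (map (peval B z (ug q)) bq_rels)"
    by simp
  also have "map (peval B z (ug q)) bq_rels
      = map (free_eval B (presented_gen (BqSU2_relations q))) (bq_relation_list q)"
    using free_eval_bq_relations[OF _ _ q, of B "presented_gen (BqSU2_relations q)"]
    by (simp add: ug_presented[abs_def] BqSU2_def)
  finally show "peval B z (ug q) r = \<zero>\<^bsub>B\<^esub>"
    by (auto simp: set_bq_relation_list BqSU2_def free_eval_presented_relation)
next
  fix x y P assume "bq_rules x y = Some P"
  then show "list_all (\<lambda>(k, e, i). i < length bq_rels) (bq_cert x y) \<and>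
      reduces_to_zero (\<lambda>_ _. None) 0
        ([(1, 0, [x, y])] @ pneg (P @ psum (\<lambda>(k, e, i). pscale k e (bq_rels ! i)) (bq_cert x y)))"
    using bq_cert_check[unfolded all_entries, rule_format, of x y] by simp
qed (simp_all add: q)

lemma hq_rules_sound: "rules_sound (CqSL2 q) (complex_of_real q) (tg q) hq_rules"
proof (rule rules_sound_cert[where rels = hq_rels and cert = hq_cert])
  fix r assume "r \<in> set hq_rels"
  then have "peval H z (tg q) r \<in> set (map (peval H z (tg q)) hq_rels)"
    by simp
  also have "map (peval H z (tg q)) hq_rels
      = map (free_eval (CqSL2_algebra q) (presented_gen (CqSL2_relations q))) (hq_relation_list q)"
    using free_eval_hq_relations[OF _ _ q, of "CqSL2_algebra q" "presented_gen (CqSL2_relations q)"]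
    by (simp add: tg_presented[abs_def] CqSL2_algebra_def peval_CqSL2[symmetric])
  finally show "peval H z (tg q) r = \<zero>\<^bsub>H\<^esub>"
    by (auto simp: set_hq_relation_list CqSL2_simps CqSL2_algebra_def free_eval_presented_relation)
next
  fix x y P assume "hq_rules x y = Some P"
  then show "list_all (\<lambda>(k, e, i). i < length hq_rels) (hq_cert x y) \<and>
      reduces_to_zero (\<lambda>_ _. None) 0
        ([(1, 0, [x, y])] @ pneg (P @ psum (\<lambda>(k, e, i). pscale k e (hq_rels ! i)) (hq_cert x y)))"
    using hq_cert_check[unfolded all_entries, rule_format, of x y] by simp
qed (simp_all add: q)

lemma BqSU2_lift:
  assumes A: "complex_algebra A" and \<phi>: "\<And>g. \<phi> g \<in> carrier A"
    and rels: "\<And>r. r \<in> set bq_rels \<Longrightarrow> peval A (complex_of_real q) (\<lambda>x. \<phi> (ix x)) r = \<zero>\<^bsub>A\<^esub>"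
  shows "presented_lift A \<phi> \<in> algebra_hom (BqSU2 q) A"
    and "presented_lift A \<phi> (ug q x) = \<phi> (ix x)"
proof -
  have R: "free_eval A \<phi> r = \<zero>\<^bsub>A\<^esub>" if "r \<in> BqSU2_relations q" for r
  proof -
    have "free_eval A \<phi> r \<in> set (map (free_eval A \<phi>) (bq_relation_list q))"
      using that by (simp add: set_bq_relation_list)
    then show ?thesis
      unfolding free_eval_bq_relations[OF A \<phi> q] using rels by auto
  qed
  show "presented_lift A \<phi> \<in> algebra_hom B A"
    unfolding BqSU2_def by (rule presented_lift_hom[OF A \<phi> R])
  show "presented_lift A \<phi> (ug q x) = \<phi> (ix x)"
    unfolding ug_presented by (rule presented_lift_gen[OF A \<phi> R])
qed

lemma CqSL2_lift:
  assumes A: "complex_algebra A" and \<phi>: "\<And>g. \<phi> g \<in> carrier A"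
    and rels: "\<And>r. r \<in> set hq_rels \<Longrightarrow> peval A (complex_of_real q) (\<lambda>x. \<phi> (ix x)) r = \<zero>\<^bsub>A\<^esub>"
  shows "presented_lift A \<phi> \<in> algebra_hom (CqSL2 q) A"
    and "presented_lift A \<phi> (tg q x) = \<phi> (ix x)"
proof -
  have R: "free_eval A \<phi> r = \<zero>\<^bsub>A\<^esub>" if "r \<in> CqSL2_relations q" for r
  proof -
    have "free_eval A \<phi> r \<in> set (map (free_eval A \<phi>) (hq_relation_list q))"
      using that by (simp add: set_hq_relation_list)
    then show ?thesis
      unfolding free_eval_hq_relations[OF A \<phi> q] using rels by auto
  qed
  show "presented_lift A \<phi> \<in> algebra_hom H A"
    unfolding algebra_hom_CqSL2_left unfolding CqSL2_algebra_def by (rule presented_lift_hom[OF A \<phi> R])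
  show "presented_lift A \<phi> (tg q x) = \<phi> (ix x)"
    unfolding tg_presented by (rule presented_lift_gen[OF A \<phi> R])
qed

end

section \<open>Targets of the antipode and the counit\<close>

lemma opposite_algebra_simps:
  "carrier (opposite_algebra A) = carrier A"
  "x \<otimes>\<^bsub>opposite_algebra A\<^esub> y = y \<otimes>\<^bsub>A\<^esub> x"
  "\<one>\<^bsub>opposite_algebra A\<^esub> = \<one>\<^bsub>A\<^esub>"
  "\<zero>\<^bsub>opposite_algebra A\<^esub> = \<zero>\<^bsub>A\<^esub>"
  "x \<oplus>\<^bsub>opposite_algebra A\<^esub> y = x \<oplus>\<^bsub>A\<^esub> y"
  "c \<odot>\<^bsub>opposite_algebra A\<^esub> x = c \<odot>\<^bsub>A\<^esub> x"
  by (simp_all add: opposite_algebra_def)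

lemma opposite_complex_algebra:
  assumes A: "complex_algebra A"
  shows "complex_algebra (opposite_algebra A)"
proof (rule complex_algebraI)
  have cs: "cspace A" using A by simp
  show "cspace (opposite_algebra A)"
  proof (rule cspaceI)
    show "abelian_group (opposite_algebra A)"
    proof (rule abelian_groupI)
      fix x assume x: "x \<in> carrier (opposite_algebra A)"
      show "\<exists>y\<in>carrier (opposite_algebra A). y \<oplus>\<^bsub>opposite_algebra A\<^esub> x = \<zero>\<^bsub>opposite_algebra A\<^esub>"
        using x abelian_group.l_neg[OF cspace_abelian_group[OF cs]] cs
        by (intro bexI[of _ "\<ominus>\<^bsub>A\<^esub> x"]) (simp_all add: opposite_algebra_simps)
    qed (simp_all add: opposite_algebra_simps cs cs_ac[OF cs])
  qed (simp_all add: opposite_algebra_simps cs cs_distrib[OF cs] cs_smult_smult[OF cs])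
  show "(\<otimes>\<^bsub>opposite_algebra A\<^esub>)
      \<in> complex_bilinear (opposite_algebra A) (opposite_algebra A) (opposite_algebra A)"
    by (intro complex_bilinearI complex_linearI)
      (simp_all add: opposite_algebra_simps A ca_distrib ca_smult)
qed (simp_all add: opposite_algebra_simps A ca_assoc)

lemma peval_opposite:
  assumes A: "complex_algebra A" and \<phi>: "\<And>x. \<phi> x \<in> carrier A"
  shows "peval (opposite_algebra A) z \<phi> P = peval A z \<phi> (prev P)"
proof -
  have w: "word_eval (opposite_algebra A) \<phi> w = word_eval A \<phi> (rev w)" for w
    using A \<phi> by (induction w) (simp_all add: opposite_algebra_simps word_eval_append[OF A \<phi>])
  show ?thesis
    by (induction P rule: ncpoly_induct) (simp_all add: prev_def opposite_algebra_simps w)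
qed

lemma complex_numbers_simps:
  "carrier complex_numbers = UNIV" "x \<otimes>\<^bsub>complex_numbers\<^esub> y = x * y" "\<one>\<^bsub>complex_numbers\<^esub> = 1"
  "\<zero>\<^bsub>complex_numbers\<^esub> = 0" "x \<oplus>\<^bsub>complex_numbers\<^esub> y = x + y" "c \<odot>\<^bsub>complex_numbers\<^esub> x = c * x"
  by (simp_all add: complex_numbers_def ring.defs module.defs)

lemma complex_numbers_algebra [simp]: "complex_algebra complex_numbers"
proof (rule complex_algebraI)
  show "cspace complex_numbers"
  proof (rule cspaceI)
    show "abelian_group complex_numbers"
      by (rule abelian_groupI) (auto simp: complex_numbers_simps intro: exI[of _ "- _"])
  qed (simp_all add: complex_numbers_simps algebra_simps)
  show "(\<otimes>\<^bsub>complex_numbers\<^esub>) \<in> complex_bilinear complex_numbers complex_numbers complex_numbers"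
    by (intro complex_bilinearI complex_linearI) (simp_all add: complex_numbers_simps algebra_simps)
qed (simp_all add: complex_numbers_simps)

lemma finsum_idx:
  assumes "cspace V" "\<And>b. f (idx b) \<in> carrier V"
  shows "finsum V f UNIV = f (idx False) \<oplus>\<^bsub>V\<^esub> f (idx True)"
  using finsum_two[of V f] assms(1) assms(2)[of False] assms(2)[of True] by (simp add: idx_def)

lemma t_gen_closed [simp]: "t_gen q i j \<in> carrier (CqSL2_algebra q)"
  by (simp add: t_gen_def CqSL2_algebra_def)

lemma u_gen_idx: "u_gen q (idx i) (idx j) = ug q (i, j)"
  by (simp add: ug_def)

lemma t_gen_idx: "t_gen q (idx i) (idx j) = tg q (i, j)"
  by (simp add: tg_def)

lemma hopf_simps:
  "comult (CqSL2 q) = presented_lift (tensor_space (CqSL2 q) (CqSL2 q))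
    (\<lambda>(i, j). \<Oplus>\<^bsub>tensor_space (CqSL2 q) (CqSL2 q)\<^esub>k\<in>UNIV. tens (CqSL2 q) (CqSL2 q) (t_gen q i k) (t_gen q k j))"
  "counit (CqSL2 q) = presented_lift complex_numbers (\<lambda>(i, j). if i = j then 1 else 0)"
  "antipode (CqSL2 q) = presented_lift (opposite_algebra (CqSL2_algebra q)) (\<lambda>(i, j). t_inverse q i j)"
  unfolding tens_CqSL2[symmetric]
  by (simp_all add: CqSL2_def Let_def module.defs hopf_algebra.defs)

section \<open>Hopf structure maps and the adjoint coaction on generators\<close>

context nonzero_parameter
begin

lemma bt_closed: "bt s \<in> carrier BH"
  by (rule two_gen_closed) simp_all

lemma tt_closed: "tt s \<in> carrier HH"
  by (rule two_gen_closed) simp_all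

lemma BH: "complex_algebra BH" by simp
lemma HH: "complex_algebra HH" by simp

lemmas pH = peval_append[where \<phi> = "tg q", OF CqSL2_complex_algebra[of q] tg_closed]
  peval_pmul[where \<phi> = "tg q", OF CqSL2_complex_algebra[of q] tg_closed z]
  peval_closed[where \<phi> = "tg q", OF CqSL2_complex_algebra[of q] tg_closed]
lemmas pB = peval_append[where \<phi> = "ug q", OF BqSU2_algebra[of q] ug_closed]
  peval_pmul[where \<phi> = "ug q", OF BqSU2_algebra[of q] ug_closed z]
  peval_closed[where \<phi> = "ug q", OF BqSU2_algebra[of q] ug_closed]
lemmas pBH = peval_append[where \<phi> = "bt", OF BH bt_closed]
  peval_pmul[where \<phi> = "bt", OF BH bt_closed z]
  peval_closed[where \<phi> = "bt", OF BH bt_closed]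
lemmas pHH = peval_append[where \<phi> = "tt", OF HH tt_closed]
  peval_pmul[where \<phi> = "tt", OF HH tt_closed z]
  peval_closed[where \<phi> = "tt", OF HH tt_closed]

lemma tg_peval: "peval (CqSL2 q) z (tg q) [(1, 0, [x])] = tg q x"
  using CqSL2_cspace by (simp add: coef_def)

lemma ug_peval: "peval (BqSU2 q) z (ug q) [(1, 0, [x])] = ug q x"
  by (simp add: coef_def)

lemma two_hq_rules_sound:
  "rules_sound (tensor_space (CqSL2 q) (CqSL2 q)) z (two_gen (CqSL2 q) (CqSL2 q) (tg q) (tg q))
    (two_rules hq_rules hq_rules)"
  by (intro two_rules_sound hq_rules_sound q) simp_all

lemma bq_hq_rules_sound:
  "rules_sound (tensor_space (BqSU2 q) (CqSL2 q)) z (two_gen (BqSU2 q) (CqSL2 q) (ug q) (tg q))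
    (two_rules bq_rules hq_rules)"
  by (intro two_rules_sound bq_rules_sound hq_rules_sound q) simp_all

lemma t_inverse_peval: "t_inverse q (idx i) (idx j) = peval (CqSL2 q) z (tg q) (hq_antipode (i, j))"
  using CqSL2_algebra_algebra[of q] complex_algebra_cspace[OF CqSL2_algebra_algebra[of q]]
  by (cases i; cases j)
    (simp_all add: t_inverse_def tg_def coef_def idx_def CqSL2_simps power_int_minus divide_inverse)

text \<open>The antipode is a homomorphism into the opposite algebra, so the relations have to hold
  for the proposed images with all words reversed; \<open>antipode_check\<close> supplies
  this.\<close>

lemma antipode_tg: "antipode (CqSL2 q) (tg q x) = peval (CqSL2 q) z (tg q) (hq_antipode x)"
proof -
  let ?A = "opposite_algebra (CqSL2_algebra q)"
  let ?f = "\<lambda>(i, j). t_inverse q i j"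
  have f: "?f (ix x) = peval H z (tg q) (hq_antipode x)" for x
    by (cases x) (simp add: ix_def t_inverse_peval)
  have f_closed: "?f p \<in> carrier ?A" for p
  proof -
    obtain x where "p = ix x" by (rule ix_cases)
    then show ?thesis
      by (simp only: f opposite_algebra_simps CqSL2_simps[symmetric] pH)
  qed
  have "presented_lift ?A ?f (tg q x) = ?f (ix x)"
  proof (rule CqSL2_lift[OF opposite_complex_algebra f_closed])
    fix r assume r: "r \<in> set hq_rels"
    have "peval ?A z (\<lambda>x. ?f (ix x)) r = peval H z (\<lambda>x. ?f (ix x)) (prev r)"
      using f_closed by (subst peval_opposite) (simp_all add: opposite_algebra_simps peval_CqSL2)
    also have "\<dots> = peval H z (tg q) (psubst hq_antipode (prev r))"
      unfolding f by (rule peval_psubst[OF CqSL2_complex_algebra tg_closed z])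
    also have "\<dots> = peval H z (tg q) []"
      using antipode_check r
      by (intro peval_eqI[OF CqSL2_complex_algebra tg_closed z hq_rules_sound]) (auto simp: list_all_iff)
    finally show "peval ?A z (\<lambda>x. ?f (ix x)) r = \<zero>\<^bsub>?A\<^esub>"
      by (simp add: opposite_algebra_simps CqSL2_simps)
  qed simp
  then show ?thesis
    by (simp only: hopf_simps f)
qed

lemma counit_hom: "counit (CqSL2 q) \<in> algebra_hom (CqSL2 q) complex_numbers"
  and counit_tg: "counit (CqSL2 q) (tg q x) = (if fst x = snd x then 1 else 0)"
proof -
  let ?f = "\<lambda>(i, j). if i = j then 1 else 0 :: complex"
  have rel: "peval complex_numbers z (\<lambda>x. ?f (ix x)) r = \<zero>\<^bsub>complex_numbers\<^esub>" if "r \<in> set hq_rels" for r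
    using that by (auto simp: hq_rels_def ix_def complex_numbers_simps coef_def)
  show "counit H \<in> algebra_hom H complex_numbers"
    unfolding hopf_simps by (rule CqSL2_lift(1)[OF complex_numbers_algebra _ rel]) (simp_all add: complex_numbers_simps)
  have "presented_lift complex_numbers ?f (tg q x) = ?f (ix x)"
    by (rule CqSL2_lift(2)[OF complex_numbers_algebra _ rel]) (simp_all add: complex_numbers_simps)
  then show "counit H (tg q x) = (if fst x = snd x then 1 else 0)"
    by (simp add: hopf_simps ix_def)
qed

lemma comult_hom: "comult (CqSL2 q) \<in> algebra_hom (CqSL2 q) (tensor_space (CqSL2 q) (CqSL2 q))"
  and comult_tg: "comult (CqSL2 q) (tg q x) = peval (tensor_space (CqSL2 q) (CqSL2 q)) z
    (two_gen (CqSL2 q) (CqSL2 q) (tg q) (tg q)) (hq_comult x)"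
proof -
  let ?f = "\<lambda>(i, j). \<Oplus>\<^bsub>HH\<^esub>k\<in>UNIV. tens H H (t_gen q i k) (t_gen q k j)"
  have f: "?f (ix x) = peval HH z tt (hq_comult x)" for x
  proof -
    obtain i j where x: "x = (i, j)" by (cases x)
    have "?f (ix x) = tens H H (tg q (i, False)) (tg q (False, j)) \<oplus>\<^bsub>HH\<^esub> tens H H (tg q (i, True)) (tg q (True, j))"
      by (simp add: x ix_def finsum_idx t_gen_idx)
    also have "\<dots> = peval HH z tt (hq_comult x)"
      by (simp add: x hq_comult_def psum_def coef_def two_gen_def tensor_mult_tens tensor_space_simps(3)
          complex_algebra_cspace[OF HH])
    finally show ?thesis .
  qed
  have f_closed: "?f p \<in> carrier HH" for p
  proof -
    obtain x where "p = ix x" by (rule ix_cases)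
    then show ?thesis by (simp only: f pHH)
  qed
  have rel: "peval HH z (\<lambda>x. ?f (ix x)) r = \<zero>\<^bsub>HH\<^esub>" if r: "r \<in> set hq_rels" for r
  proof -
    have "peval HH z (\<lambda>x. ?f (ix x)) r = peval HH z tt (psubst hq_comult r)"
      unfolding f by (rule peval_psubst[OF HH tt_closed z])
    also have "\<dots> = peval HH z tt []"
      using comult_check r
      by (intro peval_eqI[OF HH tt_closed z two_hq_rules_sound]) (auto simp: list_all_iff)
    finally show ?thesis by simp
  qed
  show "comult H \<in> algebra_hom H HH"
    unfolding hopf_simps by (rule CqSL2_lift(1)[OF HH f_closed rel])
  have "presented_lift HH ?f (tg q x) = ?f (ix x)"
    by (rule CqSL2_lift(2)[OF HH f_closed rel])
  then show "comult H (tg q x) = peval HH z tt (hq_comult x)"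
    by (simp only: hopf_simps f)
qed

lemma adj_peval:
  "antipode (CqSL2 q) (tg q (fst x, fst s)) \<otimes>\<^bsub>CqSL2 q\<^esub> tg q (snd s, snd x)
    = peval (CqSL2 q) z (tg q) (adj x s)"
  unfolding adj_def by (simp only: pH antipode_tg tg_peval)

lemma adjoint_coaction_hom: "adjoint_coaction q \<in> algebra_hom (BqSU2 q) (tensor_space (BqSU2 q) (CqSL2 q))"
  and adjoint_coaction_ug: "adjoint_coaction q (ug q x) = peval (tensor_space (BqSU2 q) (CqSL2 q)) z
    (two_gen (BqSU2 q) (CqSL2 q) (ug q) (tg q)) (bq_coaction x)"
proof -
  let ?f = "\<lambda>(i, j). \<Oplus>\<^bsub>BH\<^esub>m\<in>UNIV. \<Oplus>\<^bsub>BH\<^esub>n\<in>UNIV.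
          tens B H (u_gen q m n) (antipode H (t_gen q i m) \<otimes>\<^bsub>H\<^esub> t_gen q n j)"
  have f: "?f (ix x) = peval BH z bt (bq_coaction x)" for x
  proof -
    obtain i j where x: "x = (i, j)" by (cases x)
    let ?t = "\<lambda>m n. tens B H (ug q (m, n)) (antipode H (tg q (i, m)) \<otimes>\<^bsub>H\<^esub> tg q (n, j))"
    have t: "?t m n = peval BH z bt (pmul (pmap Fst [(1, 0, [(m, n)])]) (pmap Snd (adj x (m, n))))" for m n
    proof -
      have "?t m n = tens B H (peval B z (ug q) [(1, 0, [(m, n)])]) (peval H z (tg q) (adj x (m, n)))"
        using adj_peval[of x "(m, n)"] by (simp only: ug_peval x fst_conv snd_conv)
      also have "\<dots> = peval BH z bt (pmul (pmap Fst [(1, 0, [(m, n)])]) (pmap Snd (adj x (m, n))))"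
        by (rule tens_peval[OF BqSU2_algebra CqSL2_complex_algebra ug_closed tg_closed z])
      finally show ?thesis .
    qed
    have c: "?t m n \<in> carrier BH" for m n
      unfolding t by (rule pBH)
    have "?f (ix x) = (?t False False \<oplus>\<^bsub>BH\<^esub> ?t False True) \<oplus>\<^bsub>BH\<^esub> (?t True False \<oplus>\<^bsub>BH\<^esub> ?t True True)"
      using c by (simp add: x ix_def finsum_idx t_gen_idx u_gen_idx)
    also have "\<dots> = peval BH z bt (bq_coaction x)"
      unfolding t using pBH(3)
      by (simp add: bq_coaction_def psum_def entries_def pBH(1) cs_assoc[OF complex_algebra_cspace[OF BH]]
        del: pmul.simps pmap.simps)
    finally show ?thesis .
  qed
  have f_closed: "?f p \<in> carrier BH" for p
  proof -
    obtain x where "p = ix x" by (rule ix_cases)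
    then show ?thesis by (simp only: f pBH)
  qed
  have rel: "peval BH z (\<lambda>x. ?f (ix x)) r = \<zero>\<^bsub>BH\<^esub>" if r: "r \<in> set bq_rels" for r
  proof -
    have "peval BH z (\<lambda>x. ?f (ix x)) r = peval BH z bt (psubst bq_coaction r)"
      unfolding f by (rule peval_psubst[OF BH bt_closed z])
    also have "\<dots> = peval BH z bt []"
      using coaction_check r
      by (intro peval_eqI[OF BH bt_closed z bq_hq_rules_sound]) (auto simp: list_all_iff)
    finally show ?thesis by simp
  qed
  show "adjoint_coaction q \<in> algebra_hom B BH"
    unfolding adjoint_coaction_def Let_def by (rule BqSU2_lift(1)[OF BH f_closed rel])
  have "presented_lift BH ?f (ug q x) = ?f (ix x)"
    by (rule BqSU2_lift(2)[OF BH f_closed rel])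
  then show "adjoint_coaction q (ug q x) = peval BH z bt (bq_coaction x)"
    by (simp only: adjoint_coaction_def Let_def f)
qed


section \<open>The algebra B as a right comodule algebra\<close>

abbreviation "T3 \<equiv> tensor_space B HH"
abbreviation "e3 \<equiv> two_gen B HH (ug q) tt"

lemma T3: "complex_algebra T3" by simp

lemma e3_closed: "e3 s \<in> carrier T3"
  by (rule two_gen_closed) (simp_all add: tt_closed)

lemma e3_rules: "rules_sound T3 z e3 (two_rules bq_rules (two_rules hq_rules hq_rules))"
  by (intro two_rules_sound bq_rules_sound hq_rules_sound q) (simp_all add: tt_closed)

abbreviation "\<rho> \<equiv> adjoint_coaction q"

lemmas rho_hom = adjoint_coaction_hom
lemmas rho_linear = algebra_hom_linear[OF rho_hom]
lemmas Delta_hom = comult_hom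
lemmas Delta_linear = algebra_hom_linear[OF Delta_hom]
lemmas eps_hom = counit_hom
lemmas eps_linear = algebra_hom_linear[OF eps_hom]

text \<open>The map y \<mapsto> y \<otimes> 1 followed by reassociation is an algebra homomorphism,
  so its effect on a polynomial is a relabelling of generators.\<close>

lemma tensor_assoc_tens_one:
  "tensor_assoc B H H (tens BH H (peval BH z bt P) \<one>\<^bsub>H\<^esub>) = peval T3 z e3 (pmap reassoc P)"
proof -
  let ?j = "\<lambda>y. tensor_assoc B H H (tens BH H y \<one>\<^bsub>H\<^esub>)"
  have j: "?j \<in> algebra_hom BH T3"
    by (rule algebra_hom_comp[OF tens_one_right_hom tensor_assoc_algebra_hom]) simp_all
  have "?j (bt s) = e3 (reassoc s)" for s
    by (cases s) (simp_all add: two_gen_def tensor_assoc_tens tensor_space_simps(3))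
  then show ?thesis
    using peval_hom[OF BH j T3 bt_closed] by (simp add: peval_pmap)
qed

text \<open>Both sides apply an algebra homomorphism out of B \<otimes> H to the same element. Their
  values on the generators of B \<otimes> H are polynomials, so substitution gives two polynomials
  in B \<otimes> (H \<otimes> H), compared by \<open>coassoc_check\<close>.\<close>

lemma coaction_coassoc_ug:
  "tensor_assoc B H H (tensor_map BH H \<rho> id (\<rho> (ug q x))) = tensor_map B HH id (comult H) (\<rho> (ug q x))"
proof -
  let ?k = "\<lambda>y. tensor_assoc B H H (tensor_map BH H \<rho> id y)" and ?l = "tensor_map B HH id (comult H)"
  have k: "?k \<in> algebra_hom BH T3"
    by (rule algebra_hom_comp[OF tensor_map_algebra_hom[OF rho_hom algebra_hom_id] tensor_assoc_algebra_hom])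
      simp_all
  have l: "?l \<in> algebra_hom BH T3"
    by (rule tensor_map_algebra_hom[OF algebra_hom_id Delta_hom]) simp_all
  have k_gen: "?k (bt s) = peval T3 z e3 (coassoc_left s)" for s
  proof (cases s)
    case (Fst x)
    then have "?k (bt s) = tensor_assoc B H H (tens BH H (\<rho> (ug q x)) \<one>\<^bsub>H\<^esub>)"
      by (simp add: two_gen_def tensor_map_tens[OF rho_linear complex_linear_id])
    then show ?thesis
      by (simp only: adjoint_coaction_ug tensor_assoc_tens_one Fst coassoc_left.simps)
  next
    case (Snd y)
    then have "?k (bt s) = tensor_assoc B H H (tens BH H (tens B H \<one>\<^bsub>B\<^esub> \<one>\<^bsub>H\<^esub>) (tg q y))"
      by (simp add: two_gen_def tensor_map_tens[OF rho_linear complex_linear_id] algebra_hom_one[OF rho_hom]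
          tensor_space_simps(3))
    also have "\<dots> = e3 (Snd (Snd y))"
      by (simp add: tensor_assoc_tens two_gen_def)
    also have "\<dots> = peval T3 z e3 (coassoc_left s)"
      using e3_closed[of "Snd (Snd y)"] by (simp add: Snd coef_def T3)
    finally show ?thesis .
  qed
  have l_gen: "?l (bt s) = peval T3 z e3 (coassoc_right s)" for s
  proof (cases s)
    case (Fst x)
    then have "?l (bt s) = e3 (Fst x)"
      by (simp add: two_gen_def tensor_map_tens[OF complex_linear_id Delta_linear] algebra_hom_one[OF Delta_hom])
    also have "\<dots> = peval T3 z e3 (coassoc_right s)"
      using e3_closed[of "Fst x"] by (simp add: Fst coef_def T3)
    finally show ?thesis .
  next
    case (Snd y)
    then have "?l (bt s) = tens B HH \<one>\<^bsub>B\<^esub> (peval HH z tt (hq_comult y))"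
      by (simp add: two_gen_def tensor_map_tens[OF complex_linear_id Delta_linear] comult_tg)
    also have "\<dots> = peval T3 z e3 (pmap Snd (hq_comult y))"
      using peval_hom[where \<phi> = tt, OF HH tens_one_left_hom[OF BqSU2_algebra HH] T3 tt_closed]
      by (simp add: peval_pmap two_gen_def)
    finally show ?thesis by (simp add: Snd)
  qed
  have "?k (\<rho> (ug q x)) = peval T3 z e3 (psubst coassoc_left (bq_coaction x))"
    unfolding adjoint_coaction_ug peval_hom[OF BH k T3 bt_closed] k_gen
    by (rule peval_psubst[OF T3 e3_closed z])
  also have "\<dots> = peval T3 z e3 (psubst coassoc_right (bq_coaction x))"
    by (rule peval_eqI[OF T3 e3_closed z e3_rules coassoc_check[unfolded all_entries, rule_format]])
  also have "\<dots> = ?l (\<rho> (ug q x))"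
    unfolding adjoint_coaction_ug peval_hom[OF BH l T3 bt_closed] l_gen
    by (rule peval_psubst[OF T3 e3_closed z, symmetric])
  finally show ?thesis .
qed

lemma counit_bilinear:
  assumes "cspace V"
  shows "(\<lambda>v h. counit (CqSL2 q) h \<odot>\<^bsub>V\<^esub> v) \<in> complex_bilinear V (CqSL2 q) V"
  using assms
  by (intro complex_bilinearI complex_linearI)
    (simp_all add: complex_linearD[OF eps_linear] complex_numbers_simps cs_distrib cs_smult_smult mult.commute)

text \<open>Applying the counit to the second factor is multiplicative because the counit is, and
  its scalar values can be moved past elements of B.\<close>

lemma coaction_counit_hom:
  "tensor_lift (BqSU2 q) (\<lambda>v h. counit (CqSL2 q) h \<odot>\<^bsub>BqSU2 q\<^esub> v) \<in> algebra_hom (tensor_space (BqSU2 q) (CqSL2 q)) (BqSU2 q)"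
proof (rule algebra_homI)
  let ?k = "tensor_lift B (\<lambda>v h. counit H h \<odot>\<^bsub>B\<^esub> v)"
  have cs: "cspace B" "cspace H" by simp_all
  note bil = counit_bilinear[OF cs(1)]
  note lin = tensor_lift_linear[OF cs cs(1) bil] and t = tensor_lift_tens[OF cs cs(1) bil]
  note m = complex_bilinearD[OF tensor_mult_bilinear[OF BqSU2_algebra CqSL2_complex_algebra]]
  show "?k \<in> complex_linear BH B" by (rule lin)
  show "?k \<one>\<^bsub>BH\<^esub> = \<one>\<^bsub>B\<^esub>"
    by (simp add: tensor_space_simps(3) t algebra_hom_one[OF eps_hom] complex_numbers_simps)
  show "?k (x \<otimes>\<^bsub>BH\<^esub> y) = ?k x \<otimes>\<^bsub>B\<^esub> ?k y" if x: "x \<in> carrier BH" and y: "y \<in> carrier BH" for x y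
    using cs x
  proof (induction x rule: tensor_induct)
    case (tens v h)
    show ?case
      using cs y
      by (induction y rule: tensor_induct)
        (simp_all add: tens m t complex_linearD[OF lin] tensor_mult_tens algebra_hom_mult[OF eps_hom]
          complex_numbers_simps ca_smult ca_distrib cs_smult_smult mult.commute)
  next
    case (add x x')
    then show ?case
      using y by (simp add: m complex_linearD[OF lin] ca_distrib)
  qed
qed

lemma coaction_counit_ug:
  "tensor_lift B (\<lambda>v h. counit H h \<odot>\<^bsub>B\<^esub> v) (\<rho> (ug q x)) = ug q x"
proof -
  let ?k = "tensor_lift B (\<lambda>v h. counit H h \<odot>\<^bsub>B\<^esub> v)"
  have cs: "cspace B" "cspace H" by simp_all
  note t = tensor_lift_tens[OF cs cs(1) counit_bilinear[OF cs(1)]]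
  have gen: "?k (bt s) = peval B z (ug q) (counit_subst s)" for s
  proof (cases s)
    case (Fst x)
    then show ?thesis
      by (simp add: two_gen_def t algebra_hom_one[OF eps_hom] complex_numbers_simps coef_def)
  next
    case (Snd y)
    then show ?thesis
      by (simp add: two_gen_def t counit_tg hq_counit_def coef_def)
  qed
  have "?k (\<rho> (ug q x)) = peval B z (ug q) (psubst counit_subst (bq_coaction x))"
    unfolding adjoint_coaction_ug peval_hom[OF BH coaction_counit_hom BqSU2_algebra bt_closed] gen
    by (rule peval_psubst[OF BqSU2_algebra ug_closed z])
  also have "\<dots> = peval B z (ug q) [(1, 0, [x])]"
    by (rule peval_eqI[OF BqSU2_algebra ug_closed z bq_rules_sound
          counit_check[unfolded all_entries, rule_format]])
  finally show ?thesis
    by (simp only: ug_peval)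
qed

lemma BqSU2_hom_eqI:
  assumes "complex_algebra A" "v \<in> carrier (BqSU2 q)" "f \<in> algebra_hom (BqSU2 q) A" "g \<in> algebra_hom (BqSU2 q) A"
    and "\<And>x. f (ug q x) = g (ug q x)"
  shows "f v = g v"
proof (rule presented_hom_eqI[OF assms(1) _ assms(3,4)[unfolded BqSU2_def]])
  show "v \<in> carrier (presented_algebra (BqSU2_relations q))"
    using assms(2) by (simp add: BqSU2_def)
  show "f (presented_gen (BqSU2_relations q) i) = g (presented_gen (BqSU2_relations q) i)" for i
  proof -
    obtain x where "i = ix x" by (rule ix_cases)
    then show ?thesis using assms(5)[of x] by (simp add: ug_presented)
  qed
qed

lemma adjoint_comodule_algebra: "right_comodule_algebra (CqSL2 q) (BqSU2 q) (adjoint_coaction q)"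
proof (intro right_comodule_algebra.intro right_comodule.intro right_comodule_axioms.intro
    right_comodule_algebra_axioms.intro)
  show "complex_algebra B" "cspace B" by simp_all
  show "\<rho> \<in> complex_linear B BH" by (rule rho_linear)
  show "\<rho> \<in> algebra_hom B BH" by (rule rho_hom)
  fix v assume v: "v \<in> carrier B"
  show "tensor_assoc B H H (tensor_map BH H \<rho> id (\<rho> v)) = tensor_map B HH id (comult H) (\<rho> v)"
  proof (rule BqSU2_hom_eqI[where f = "\<lambda>v. tensor_assoc B H H (tensor_map BH H \<rho> id (\<rho> v))"
        and g = "\<lambda>v. tensor_map B HH id (comult H) (\<rho> v)", OF T3 v _ _ coaction_coassoc_ug])
    show "(\<lambda>v. tensor_assoc B H H (tensor_map BH H \<rho> id (\<rho> v))) \<in> algebra_hom B T3"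
      by (rule algebra_hom_comp[OF rho_hom algebra_hom_comp[OF tensor_map_algebra_hom[OF rho_hom algebra_hom_id]
            tensor_assoc_algebra_hom]]) simp_all
    show "(\<lambda>v. tensor_map B HH id (comult H) (\<rho> v)) \<in> algebra_hom B T3"
      by (rule algebra_hom_comp[OF rho_hom tensor_map_algebra_hom[OF algebra_hom_id Delta_hom]]) simp_all
  qed
  show "tensor_lift B (\<lambda>v' h. counit H h \<odot>\<^bsub>B\<^esub> v') (\<rho> v) = v"
    using BqSU2_hom_eqI[OF BqSU2_algebra v algebra_hom_comp[OF rho_hom coaction_counit_hom] algebra_hom_id]
      coaction_counit_ug by simp
qed

end

section \<open>The bimodule of one-forms\<close>

lemma cs_finsum_swap:
  assumes V: "cspace V" and fin: "finite S" "finite T"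
    and c: "\<And>i j. i \<in> S \<Longrightarrow> j \<in> T \<Longrightarrow> f i j \<in> carrier V"
  shows "(\<Oplus>\<^bsub>V\<^esub>i\<in>S. \<Oplus>\<^bsub>V\<^esub>j\<in>T. f i j) = (\<Oplus>\<^bsub>V\<^esub>j\<in>T. \<Oplus>\<^bsub>V\<^esub>i\<in>S. f i j)"
  using fin(1) c
proof (induction S rule: finite_induct)
  case empty
  then show ?case using V by (simp add: cs_finsum_zero)
next
  case (insert s S)
  have "(\<Oplus>\<^bsub>V\<^esub>i\<in>insert s S. \<Oplus>\<^bsub>V\<^esub>j\<in>T. f i j) = (\<Oplus>\<^bsub>V\<^esub>j\<in>T. f s j) \<oplus>\<^bsub>V\<^esub> (\<Oplus>\<^bsub>V\<^esub>i\<in>S. \<Oplus>\<^bsub>V\<^esub>j\<in>T. f i j)"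
    using insert V by (intro cs_finsum_insert) (auto intro!: cs_finsum_closed)
  also have "\<dots> = (\<Oplus>\<^bsub>V\<^esub>j\<in>T. f s j) \<oplus>\<^bsub>V\<^esub> (\<Oplus>\<^bsub>V\<^esub>j\<in>T. \<Oplus>\<^bsub>V\<^esub>i\<in>S. f i j)"
    using insert by simp
  also have "\<dots> = (\<Oplus>\<^bsub>V\<^esub>j\<in>T. f s j \<oplus>\<^bsub>V\<^esub> (\<Oplus>\<^bsub>V\<^esub>i\<in>S. f i j))"
    using insert V by (intro cs_finsum_add[symmetric]) (auto intro!: cs_finsum_closed)
  also have "\<dots> = (\<Oplus>\<^bsub>V\<^esub>j\<in>T. \<Oplus>\<^bsub>V\<^esub>i\<in>insert s S. f i j)"
    using insert V
    by (intro cs_finsum_cong) (auto intro!: cs_finsum_closed cs_closed cs_finsum_insert[symmetric])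
  finally show ?case .
qed

lemma finsum_entries:
  assumes V: "cspace V" and c: "\<And>x :: entry. f x \<in> carrier V"
  shows "finsum V f UNIV = f (False, False) \<oplus>\<^bsub>V\<^esub> (f (False, True) \<oplus>\<^bsub>V\<^esub> (f (True, False) \<oplus>\<^bsub>V\<^esub> f (True, True)))"
proof -
  have "(UNIV :: entry set) = {(False, False), (False, True), (True, False), (True, True)}"
    by (auto)
  moreover have "finsum V f {(False, False), (False, True), (True, False), (True, True)}
      = f (False, False) \<oplus>\<^bsub>V\<^esub> (f (False, True) \<oplus>\<^bsub>V\<^esub> (f (True, False) \<oplus>\<^bsub>V\<^esub> f (True, True)))"
    using V c by (subst cs_finsum_insert, simp_all)+
  ultimately show ?thesis by simp
qed

lemma peval_psum_entries:
  assumes A: "complex_algebra A" and \<phi>: "\<And>g. \<phi> g \<in> carrier A"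
  shows "peval A z \<phi> (psum f entries) = (\<Oplus>\<^bsub>A\<^esub>x\<in>UNIV. peval A z \<phi> (f x))"
proof -
  have cs: "cspace A" using A by simp
  show ?thesis
    by (subst finsum_entries[OF cs peval_closed[OF A \<phi>]])
      (simp add: psum_def entries_def peval_append[OF A \<phi>] cs peval_closed[OF A \<phi>])
qed

subsection \<open>Matrices over an algebra\<close>

definition row_mult :: "(complex, 'a, 'm) module_scheme \<Rightarrow> ('i \<Rightarrow> 'a) \<Rightarrow> ('i \<Rightarrow> 'i \<Rightarrow> 'a) \<Rightarrow> 'i \<Rightarrow> 'a"
  where "row_mult A v m j = (\<Oplus>\<^bsub>A\<^esub>k\<in>UNIV. v k \<otimes>\<^bsub>A\<^esub> m k j)"

text \<open>Rows act from the left: from e_i f = sum of m_ik e_k and e_k g = sum of n_kj e_j one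
  gets e_i (f g) with matrix m n. Right multiplication therefore becomes a homomorphism into
  matrices, with no reversal of order.\<close>

definition matrix_algebra :: "(complex, 'a, 'm) module_scheme \<Rightarrow> (complex, 'i \<Rightarrow> 'i \<Rightarrow> 'a) module"
  where "matrix_algebra A = \<lparr>carrier = {m. \<forall>i j. m i j \<in> carrier A},
    monoid.mult = (\<lambda>m n i. row_mult A (m i) n), one = (\<lambda>i j. if i = j then \<one>\<^bsub>A\<^esub> else \<zero>\<^bsub>A\<^esub>),
    ring.zero = (\<lambda>i j. \<zero>\<^bsub>A\<^esub>), ring.add = (\<lambda>m n i j. m i j \<oplus>\<^bsub>A\<^esub> n i j),
    module.smult = (\<lambda>c m i j. c \<odot>\<^bsub>A\<^esub> m i j)\<rparr>"

lemma matrix_algebra_simps: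
  "m \<in> carrier (matrix_algebra A) \<longleftrightarrow> (\<forall>i j. m i j \<in> carrier A)"
  "(m \<otimes>\<^bsub>matrix_algebra A\<^esub> n) i = row_mult A (m i) n"
  "\<one>\<^bsub>matrix_algebra A\<^esub> = (\<lambda>i j. if i = j then \<one>\<^bsub>A\<^esub> else \<zero>\<^bsub>A\<^esub>)"
  "\<zero>\<^bsub>matrix_algebra A\<^esub> = (\<lambda>i j. \<zero>\<^bsub>A\<^esub>)"
  "m \<oplus>\<^bsub>matrix_algebra A\<^esub> n = (\<lambda>i j. m i j \<oplus>\<^bsub>A\<^esub> n i j)"
  "c \<odot>\<^bsub>matrix_algebra A\<^esub> m = (\<lambda>i j. c \<odot>\<^bsub>A\<^esub> m i j)"
  by (simp_all add: matrix_algebra_def)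

context
  fixes A :: "(complex, 'a, 'm) module_scheme"
  assumes A: "complex_algebra A"
begin

private lemma cs: "cspace A" using A by simp

lemma row_mult_closed:
  "(\<And>k. v k \<in> carrier A) \<Longrightarrow> (\<And>k j. m k j \<in> carrier A) \<Longrightarrow> row_mult A v m j \<in> carrier A"
  unfolding row_mult_def using A by (intro cs_finsum_closed[OF cs] Pi_I) simp

lemma row_mult_delta:
  fixes i :: "'i::finite"
  assumes "\<And>k j. m k j \<in> carrier A"
  shows "row_mult A (\<lambda>k. if i = k then \<one>\<^bsub>A\<^esub> else \<zero>\<^bsub>A\<^esub>) m j = m i j"
proof -
  have "row_mult A (\<lambda>k. if i = k then \<one>\<^bsub>A\<^esub> else \<zero>\<^bsub>A\<^esub>) m j
      = (\<Oplus>\<^bsub>A\<^esub>k\<in>{i}. (if i = k then \<one>\<^bsub>A\<^esub> else \<zero>\<^bsub>A\<^esub>) \<otimes>\<^bsub>A\<^esub> m k j)"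
    unfolding row_mult_def using A assms by (intro cs_finsum_mono_neutral[OF cs]) auto
  then show ?thesis
    using A assms by (simp add: cs_finsum_insert[OF cs])
qed

lemma row_mult_one:
  fixes v :: "'i::finite \<Rightarrow> 'a"
  assumes "\<And>k. v k \<in> carrier A"
  shows "row_mult A v (\<lambda>i j. if i = j then \<one>\<^bsub>A\<^esub> else \<zero>\<^bsub>A\<^esub>) j = v j"
proof -
  have "row_mult A v (\<lambda>i j. if i = j then \<one>\<^bsub>A\<^esub> else \<zero>\<^bsub>A\<^esub>) j
      = (\<Oplus>\<^bsub>A\<^esub>k\<in>{j}. v k \<otimes>\<^bsub>A\<^esub> (if k = j then \<one>\<^bsub>A\<^esub> else \<zero>\<^bsub>A\<^esub>))"
    unfolding row_mult_def using A assms by (intro cs_finsum_mono_neutral[OF cs]) auto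
  then show ?thesis
    using A assms by (simp add: cs_finsum_insert[OF cs])
qed

lemma row_mult_assoc:
  fixes v :: "'i::finite \<Rightarrow> 'a"
  assumes v: "\<And>k. v k \<in> carrier A" and m: "\<And>k j. m k j \<in> carrier A" and n: "\<And>k j. n k j \<in> carrier A"
  shows "row_mult A (row_mult A v m) n j = row_mult A v (\<lambda>i. row_mult A (m i) n) j"
proof -
  have "row_mult A (row_mult A v m) n j = (\<Oplus>\<^bsub>A\<^esub>k\<in>UNIV. \<Oplus>\<^bsub>A\<^esub>l\<in>UNIV. v l \<otimes>\<^bsub>A\<^esub> m l k \<otimes>\<^bsub>A\<^esub> n k j)"
    unfolding row_mult_def using A v m n
    by (intro cs_finsum_cong[OF cs]) (auto intro!: ca_finsum_mult[OF A] cs_finsum_closed[OF cs])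
  also have "\<dots> = (\<Oplus>\<^bsub>A\<^esub>l\<in>UNIV. \<Oplus>\<^bsub>A\<^esub>k\<in>UNIV. v l \<otimes>\<^bsub>A\<^esub> m l k \<otimes>\<^bsub>A\<^esub> n k j)"
    using A v m n by (intro cs_finsum_swap[OF cs]) auto
  also have "\<dots> = row_mult A v (\<lambda>i. row_mult A (m i) n) j"
  proof -
    have "(\<Oplus>\<^bsub>A\<^esub>k\<in>UNIV. v l \<otimes>\<^bsub>A\<^esub> m l k \<otimes>\<^bsub>A\<^esub> n k j) = v l \<otimes>\<^bsub>A\<^esub> (\<Oplus>\<^bsub>A\<^esub>k\<in>UNIV. m l k \<otimes>\<^bsub>A\<^esub> n k j)" for l
      using A v m n by (subst ca_finsum_mult[OF A]) (auto intro!: cs_finsum_cong[OF cs] simp: ca_assoc)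
    then show ?thesis
      by (simp add: row_mult_def)
  qed
  finally show ?thesis .
qed

lemma row_mult_add_left:
  fixes v w :: "'i::finite \<Rightarrow> 'a"
  assumes v: "\<And>k. v k \<in> carrier A" and w: "\<And>k. w k \<in> carrier A" and m: "\<And>k j. m k j \<in> carrier A"
  shows "row_mult A (\<lambda>k. v k \<oplus>\<^bsub>A\<^esub> w k) m j = row_mult A v m j \<oplus>\<^bsub>A\<^esub> row_mult A w m j"
  unfolding row_mult_def using A assms
  by (subst cs_finsum_add[OF cs, symmetric]) (auto simp: ca_distrib)

lemma row_mult_add_right:
  fixes v :: "'i::finite \<Rightarrow> 'a"
  assumes v: "\<And>k. v k \<in> carrier A" and m: "\<And>k j. m k j \<in> carrier A" and n: "\<And>k j. n k j \<in> carrier A"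
  shows "row_mult A v (\<lambda>k l. m k l \<oplus>\<^bsub>A\<^esub> n k l) j = row_mult A v m j \<oplus>\<^bsub>A\<^esub> row_mult A v n j"
  unfolding row_mult_def using A assms
  by (subst cs_finsum_add[OF cs, symmetric]) (auto simp: ca_distrib)

lemma row_mult_smult_left:
  fixes v :: "'i::finite \<Rightarrow> 'a"
  assumes v: "\<And>k. v k \<in> carrier A" and m: "\<And>k j. m k j \<in> carrier A"
  shows "row_mult A (\<lambda>k. c \<odot>\<^bsub>A\<^esub> v k) m j = c \<odot>\<^bsub>A\<^esub> row_mult A v m j"
  unfolding row_mult_def using A assms
  by (subst cs_finsum_smult[OF cs]) (auto simp: ca_smult)

lemma row_mult_smult_right:
  fixes v :: "'i::finite \<Rightarrow> 'a"
  assumes v: "\<And>k. v k \<in> carrier A" and m: "\<And>k j. m k j \<in> carrier A"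
  shows "row_mult A v (\<lambda>k l. c \<odot>\<^bsub>A\<^esub> m k l) j = c \<odot>\<^bsub>A\<^esub> row_mult A v m j"
  unfolding row_mult_def using A assms
  by (subst cs_finsum_smult[OF cs]) (auto simp: ca_smult)

lemma row_mult_mult_left:
  fixes v :: "'i::finite \<Rightarrow> 'a"
  assumes "f \<in> carrier A" and v: "\<And>k. v k \<in> carrier A" and m: "\<And>k j. m k j \<in> carrier A"
  shows "row_mult A (\<lambda>k. f \<otimes>\<^bsub>A\<^esub> v k) m j = f \<otimes>\<^bsub>A\<^esub> row_mult A v m j"
  unfolding row_mult_def using A assms
  by (subst ca_finsum_mult[OF A]) (auto simp: ca_assoc)

lemmas row_mult_linear = row_mult_add_left row_mult_add_right row_mult_smult_left row_mult_smult_right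
  row_mult_mult_left

lemma matrix_complex_algebra: "complex_algebra (matrix_algebra A :: (complex, 'i::finite \<Rightarrow> 'i \<Rightarrow> 'a) module)"
proof (rule complex_algebraI)
  let ?M = "matrix_algebra A :: (complex, 'i \<Rightarrow> 'i \<Rightarrow> 'a) module"
  note s = matrix_algebra_simps
  show "cspace ?M"
  proof (rule cspaceI)
    show "abelian_group ?M"
    proof (rule abelian_groupI)
      fix m assume m: "m \<in> carrier ?M"
      have "(\<lambda>i j. (- 1) \<odot>\<^bsub>A\<^esub> m i j) \<oplus>\<^bsub>?M\<^esub> m = \<zero>\<^bsub>?M\<^esub>"
        using m cs_combine(3)[OF cs] by (intro ext) (simp add: s cs cs_comm[OF cs])
      then show "\<exists>n\<in>carrier ?M. n \<oplus>\<^bsub>?M\<^esub> m = \<zero>\<^bsub>?M\<^esub>"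
        using m cs by (intro bexI[of _ "\<lambda>i j. (- 1) \<odot>\<^bsub>A\<^esub> m i j"]) (simp_all add: s)
    qed (auto simp: s cs cs_ac[OF cs] intro!: ext)
  qed (auto simp: s cs cs_distrib[OF cs] cs_smult_smult[OF cs] intro!: ext)
  show "(\<otimes>\<^bsub>?M\<^esub>) \<in> complex_bilinear ?M ?M ?M"
    by (intro complex_bilinearI complex_linearI)
      (auto simp: s row_mult_closed row_mult_linear A fun_eq_iff)
  show "\<one>\<^bsub>?M\<^esub> \<in> carrier ?M"
    using A by (simp add: s cs)
  show "\<one>\<^bsub>?M\<^esub> \<otimes>\<^bsub>?M\<^esub> m = m" "m \<otimes>\<^bsub>?M\<^esub> \<one>\<^bsub>?M\<^esub> = m" if "m \<in> carrier ?M" for m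
    using that by (auto simp: s row_mult_one row_mult_delta intro!: ext)
  show "m \<otimes>\<^bsub>?M\<^esub> n \<otimes>\<^bsub>?M\<^esub> p = m \<otimes>\<^bsub>?M\<^esub> (n \<otimes>\<^bsub>?M\<^esub> p)"
    if "m \<in> carrier ?M" "n \<in> carrier ?M" "p \<in> carrier ?M" for m n p
  proof (intro ext)
    fix i j
    have "n \<otimes>\<^bsub>?M\<^esub> p = (\<lambda>i. row_mult A (n i) p)"
      by (rule ext) (simp add: s)
    then show "(m \<otimes>\<^bsub>?M\<^esub> n \<otimes>\<^bsub>?M\<^esub> p) i j = (m \<otimes>\<^bsub>?M\<^esub> (n \<otimes>\<^bsub>?M\<^esub> p)) i j"
      using that by (simp add: s row_mult_assoc)
  qed
qed

end

subsection \<open>Inner derivations\<close>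

text \<open>In the Leibniz rule each summand on the right produces a term f \<theta> g, with
  opposite signs; the compatibility of the left and right actions identifies them, so they
  cancel.\<close>

lemma inner_derivation:
  fixes \<Omega> :: "('b, 'w, 'n) bimodule_scheme" and c :: complex
  assumes bim: "algebra_bimodule B \<Omega>" and \<theta>: "\<theta> \<in> carrier \<Omega>"
  defines "d \<equiv> \<lambda>f. c \<odot>\<^bsub>\<Omega>\<^esub> (\<theta> \<triangleleft>\<^bsub>\<Omega>\<^esub> f \<ominus>\<^bsub>\<Omega>\<^esub> f \<triangleright>\<^bsub>\<Omega>\<^esub> \<theta>)"
  shows "d \<in> complex_linear B \<Omega>"
    and "\<And>f g. f \<in> carrier B \<Longrightarrow> g \<in> carrier B
      \<Longrightarrow> d (f \<otimes>\<^bsub>B\<^esub> g) = d f \<triangleleft>\<^bsub>\<Omega>\<^esub> g \<oplus>\<^bsub>\<Omega>\<^esub> f \<triangleright>\<^bsub>\<Omega>\<^esub> d g"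
proof -
  interpret algebra_bimodule B \<Omega> by (rule bim)
  have cs: "cspace \<Omega>" and B: "complex_algebra B"
    by unfold_locales
  note c = lact_closed ract_closed
  show "d \<in> complex_linear B \<Omega>"
    unfolding d_def using \<theta> cs
    by (intro complex_linearI)
      (simp_all add: c lact_add_left ract_add_right lact_smult_left ract_smult_right cs_minus cs_distrib
        cs_smult_smult cs_ac mult.commute)
  show "d (f \<otimes>\<^bsub>B\<^esub> g) = d f \<triangleleft>\<^bsub>\<Omega>\<^esub> g \<oplus>\<^bsub>\<Omega>\<^esub> f \<triangleright>\<^bsub>\<Omega>\<^esub> d g"
    if "f \<in> carrier B" "g \<in> carrier B" for f g
  proof -
    let ?x = "\<theta> \<triangleleft>\<^bsub>\<Omega>\<^esub> f \<triangleleft>\<^bsub>\<Omega>\<^esub> g" and ?y = "f \<triangleright>\<^bsub>\<Omega>\<^esub> (\<theta> \<triangleleft>\<^bsub>\<Omega>\<^esub> g)" and ?w = "f \<triangleright>\<^bsub>\<Omega>\<^esub> g \<triangleright>\<^bsub>\<Omega>\<^esub> \<theta>"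
    have xyw: "?x \<in> carrier \<Omega>" "?y \<in> carrier \<Omega>" "?w \<in> carrier \<Omega>"
      using that \<theta> by (simp_all add: c)
    have "d (f \<otimes>\<^bsub>B\<^esub> g) = c \<odot>\<^bsub>\<Omega>\<^esub> ?x \<oplus>\<^bsub>\<Omega>\<^esub> (- c) \<odot>\<^bsub>\<Omega>\<^esub> ?w"
      unfolding d_def using \<theta> cs that xyw
      by (simp add: c ract_mult lact_mult cs_minus cs_distrib cs_smult_smult)
    moreover have "d f \<triangleleft>\<^bsub>\<Omega>\<^esub> g = c \<odot>\<^bsub>\<Omega>\<^esub> ?x \<oplus>\<^bsub>\<Omega>\<^esub> (- c) \<odot>\<^bsub>\<Omega>\<^esub> ?y"
      unfolding d_def using \<theta> cs that xyw
      by (simp add: c ract_add_left ract_smult_left lact_ract cs_minus cs_distrib cs_smult_smult)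
    moreover have "f \<triangleright>\<^bsub>\<Omega>\<^esub> d g = c \<odot>\<^bsub>\<Omega>\<^esub> ?y \<oplus>\<^bsub>\<Omega>\<^esub> (- c) \<odot>\<^bsub>\<Omega>\<^esub> ?w"
      unfolding d_def using \<theta> cs that xyw
      by (simp add: c lact_add_right lact_smult_right lact_ract cs_minus cs_distrib cs_smult_smult)
    moreover have "(- c) \<odot>\<^bsub>\<Omega>\<^esub> ?y \<oplus>\<^bsub>\<Omega>\<^esub> (c \<odot>\<^bsub>\<Omega>\<^esub> ?y \<oplus>\<^bsub>\<Omega>\<^esub> (- c) \<odot>\<^bsub>\<Omega>\<^esub> ?w) = (- c) \<odot>\<^bsub>\<Omega>\<^esub> ?w"
      using cs xyw by (simp add: cs_combine)
    ultimately show ?thesis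
      using cs xyw by (simp add: cs_assoc)
  qed
qed

declare split_paired_All [simp del]

section \<open>The free left module of forms and its right action\<close>

definition unidx :: "2 \<Rightarrow> bool" where "unidx i = (i = 2)"

definition unix :: "2 \<times> 2 \<Rightarrow> entry" where "unix p = (unidx (fst p), unidx (snd p))"

lemma unidx_idx [simp]: "unidx (idx b) = b"
  by (simp add: unidx_def idx_def)

lemma idx_unidx [simp]: "idx (unidx i) = i"
  by (rule idx_cases[of i]) (simp add: unidx_def idx_def)

lemma unix_ix [simp]: "unix (ix x) = x"
  by (simp add: unix_def ix_def)

text \<open>Forms are families over the index type \<open>2\<close>, while the computed matrices are
  indexed by \<open>entry\<close>. All identities between forms are proved through these
  components.\<close>

definition form_comp :: "(2 \<Rightarrow> 2 \<Rightarrow> 'a) \<Rightarrow> entry \<Rightarrow> 'a"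
  where "form_comp \<omega> x = \<omega> (idx (fst x)) (idx (snd x))"

definition form_of :: "(entry \<Rightarrow> 'a) \<Rightarrow> 2 \<Rightarrow> 2 \<Rightarrow> 'a"
  where "form_of v = (\<lambda>i j. v (unidx i, unidx j))"

lemma form_comp_of [simp]: "form_comp (form_of v) x = v x"
  by (simp add: form_comp_def form_of_def)

lemma form_eqI: "(\<And>x. form_comp \<omega> x = form_comp \<eta> x) \<Longrightarrow> \<omega> = \<eta>"
proof (intro ext)
  fix i j assume "\<And>x. form_comp \<omega> x = form_comp \<eta> x"
  from this[of "(unidx i, unidx j)"] show "\<omega> i j = \<eta> i j"
    by (simp add: form_comp_def)
qed

lemma form_eqI_entries:
  assumes "form_comp \<omega> (False, False) = form_comp \<eta> (False, False)"
    "form_comp \<omega> (False, True) = form_comp \<eta> (False, True)"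
    "form_comp \<omega> (True, False) = form_comp \<eta> (True, False)"
    "form_comp \<omega> (True, True) = form_comp \<eta> (True, True)"
  shows "\<omega> = \<eta>"
proof (rule form_eqI)
  show "form_comp \<omega> x = form_comp \<eta> x" for x
    using assms by (cases x; cases "fst x"; cases "snd x") simp_all
qed

text \<open>Row \<open>i\<close> of the matrix \<open>action q f\<close> consists of the components of \<open>e\<^sub>i f\<close>.\<close>

definition action :: "real \<Rightarrow> bq \<Rightarrow> entry \<Rightarrow> entry \<Rightarrow> bq"
  where "action q = presented_lift (matrix_algebra (BqSU2 q))
    (\<lambda>p i j. peval (BqSU2 q) (complex_of_real q) (ug q) (bq_action (unix p) i j))"

definition forms :: "real \<Rightarrow> (bq, 2 \<Rightarrow> 2 \<Rightarrow> bq) bimodule"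
  where "forms q = \<lparr>carrier = {\<omega>. \<forall>i j. \<omega> i j \<in> carrier (BqSU2 q)},
    monoid.mult = undefined, one = undefined, ring.zero = (\<lambda>i j. \<zero>\<^bsub>BqSU2 q\<^esub>),
    ring.add = (\<lambda>\<omega> \<eta> i j. \<omega> i j \<oplus>\<^bsub>BqSU2 q\<^esub> \<eta> i j),
    module.smult = (\<lambda>c \<omega> i j. c \<odot>\<^bsub>BqSU2 q\<^esub> \<omega> i j),
    lact = (\<lambda>f \<omega> i j. f \<otimes>\<^bsub>BqSU2 q\<^esub> \<omega> i j),
    ract = (\<lambda>\<omega> f. form_of (row_mult (BqSU2 q) (form_comp \<omega>) (action q f)))\<rparr>"

definition basis_form :: "real \<Rightarrow> entry \<Rightarrow> 2 \<Rightarrow> 2 \<Rightarrow> bq"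
  where "basis_form q x = form_of (\<lambda>y. if x = y then \<one>\<^bsub>BqSU2 q\<^esub> else \<zero>\<^bsub>BqSU2 q\<^esub>)"

lemma forms_closed_iff: "\<omega> \<in> carrier (forms q) \<longleftrightarrow> (\<forall>x. form_comp \<omega> x \<in> carrier (BqSU2 q))"
proof
  assume "\<forall>x. form_comp \<omega> x \<in> carrier (BqSU2 q)"
  then have "form_comp \<omega> (unidx i, unidx j) \<in> carrier (BqSU2 q)" for i j
    by blast
  then show "\<omega> \<in> carrier (forms q)"
    by (simp add: forms_def form_comp_def)
qed (simp add: forms_def form_comp_def)

lemma form_comp_simps [simp]:
  "form_comp \<zero>\<^bsub>forms q\<^esub> = (\<lambda>x. \<zero>\<^bsub>BqSU2 q\<^esub>)"
  "form_comp (\<omega> \<oplus>\<^bsub>forms q\<^esub> \<eta>) = (\<lambda>x. form_comp \<omega> x \<oplus>\<^bsub>BqSU2 q\<^esub> form_comp \<eta> x)"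
  "form_comp (c \<odot>\<^bsub>forms q\<^esub> \<omega>) = (\<lambda>x. c \<odot>\<^bsub>BqSU2 q\<^esub> form_comp \<omega> x)"
  "form_comp (f \<triangleright>\<^bsub>forms q\<^esub> \<omega>) = (\<lambda>x. f \<otimes>\<^bsub>BqSU2 q\<^esub> form_comp \<omega> x)"
  "form_comp (\<omega> \<triangleleft>\<^bsub>forms q\<^esub> f) = row_mult (BqSU2 q) (form_comp \<omega>) (action q f)"
  "form_comp (basis_form q y) = (\<lambda>x. if y = x then \<one>\<^bsub>BqSU2 q\<^esub> else \<zero>\<^bsub>BqSU2 q\<^esub>)"
  by (simp_all add: forms_def basis_form_def fun_eq_iff) (simp_all add: form_comp_def)

lemma form_compD: "\<omega> \<in> carrier (forms q) \<Longrightarrow> form_comp \<omega> x \<in> carrier (BqSU2 q)"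
  by (simp add: forms_closed_iff)

lemma forms_cspace [simp]: "cspace (forms q)"
proof -
  have B: "cspace (BqSU2 q)" by simp
  show ?thesis
  proof (rule cspaceI)
    show "abelian_group (forms q)"
    proof (rule abelian_groupI)
      fix \<omega> assume \<omega>: "\<omega> \<in> carrier (forms q)"
      have "(- 1) \<odot>\<^bsub>forms q\<^esub> \<omega> \<oplus>\<^bsub>forms q\<^esub> \<omega> = \<zero>\<^bsub>forms q\<^esub>"
        using form_compD[OF \<omega>] cs_combine(3)[OF B] by (intro form_eqI) (simp add: cs_comm[OF B])
      then show "\<exists>\<eta>\<in>carrier (forms q). \<eta> \<oplus>\<^bsub>forms q\<^esub> \<omega> = \<zero>\<^bsub>forms q\<^esub>"
        using \<omega> by (intro bexI[of _ "(- 1) \<odot>\<^bsub>forms q\<^esub> \<omega>"]) (simp_all add: forms_closed_iff)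
    qed (auto simp: forms_closed_iff cs_ac[OF B] intro!: form_eqI)
  qed (auto simp: forms_closed_iff cs_distrib[OF B] cs_smult_smult[OF B] intro!: form_eqI)
qed

lemma basis_form_closed [simp]: "basis_form q x \<in> carrier (forms q)"
  by (simp add: forms_closed_iff)

lemma form_comp_minus [simp]:
  assumes "\<omega> \<in> carrier (forms q)" "\<eta> \<in> carrier (forms q)"
  shows "form_comp (\<omega> \<ominus>\<^bsub>forms q\<^esub> \<eta>) x = form_comp \<omega> x \<ominus>\<^bsub>BqSU2 q\<^esub> form_comp \<eta> x"
  using assms form_compD[OF assms(1)] form_compD[OF assms(2)]
  by (simp add: cs_minus[OF forms_cspace] cs_minus[OF complex_algebra_cspace[OF BqSU2_algebra]])

lemma form_comp_finsum:
  assumes "F \<in> S \<rightarrow> carrier (forms q)"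
  shows "form_comp (finsum (forms q) F S) x = (\<Oplus>\<^bsub>BqSU2 q\<^esub>s\<in>S. form_comp (F s) x)"
proof -
  have "(\<lambda>\<omega>. form_comp \<omega> x) \<in> complex_linear (forms q) (BqSU2 q)"
    by (intro complex_linearI) (simp_all add: form_compD)
  then show ?thesis
    using assms by (rule complex_linear_finsum[OF forms_cspace complex_algebra_cspace[OF BqSU2_algebra]])
qed

context nonzero_parameter
begin


lemma mat: "complex_algebra (matrix_algebra B :: (complex, entry \<Rightarrow> entry \<Rightarrow> bq) module)"
  by (simp add: matrix_complex_algebra)

lemma peval_matrix:
  "peval (matrix_algebra (BqSU2 q)) z (\<lambda>x i j. peval (BqSU2 q) z (ug q) (bq_action x i j)) P i j
    = peval (BqSU2 q) z (ug q) (msubst P i j)"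
proof -
  let ?\<mu> = "\<lambda>x i j. peval B z (ug q) (bq_action x i j)"
  have word: "word_eval (matrix_algebra B) ?\<mu> w i j = peval B z (ug q) (msubst_word w i j)" for w i j
  proof (induction w arbitrary: i)
    case Nil
    then show ?case by (simp add: matrix_algebra_simps coef_def)
  next
    case (Cons x w)
    then show ?case
      by (simp add: matrix_algebra_simps row_mult_def peval_psum_entries[where \<phi> = "ug q", OF BqSU2_algebra ug_closed] pB)
  qed
  show ?thesis
    by (induction P rule: ncpoly_induct)
      (simp_all add: matrix_algebra_simps word pB peval_pscale[where \<phi> = "ug q", OF BqSU2_algebra ug_closed z])
qed

lemma action_hom: "action q \<in> algebra_hom (BqSU2 q) (matrix_algebra (BqSU2 q))"
  and action_ug: "action q (ug q x) i j = peval (BqSU2 q) z (ug q) (bq_action x i j)"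
proof -
  let ?f = "\<lambda>p i j. peval B z (ug q) (bq_action (unix p) i j)"
  have f: "?f p \<in> carrier (matrix_algebra B)" for p
    by (simp add: matrix_algebra_simps pB)
  have rel: "peval (matrix_algebra B) z (\<lambda>x. ?f (ix x)) r = \<zero>\<^bsub>matrix_algebra B\<^esub>" if r: "r \<in> set bq_rels" for r
  proof (intro ext)
    fix i j
    have "reduces_to_zero bq_rules 20 (msubst r i j @ pneg [])"
      using action_check r by (simp add: list_all_iff set_entries)
    then have "peval B z (ug q) (msubst r i j) = peval B z (ug q) []"
      by (rule peval_eqI[OF BqSU2_algebra ug_closed z bq_rules_sound])
    then show "peval (matrix_algebra B) z (\<lambda>x. ?f (ix x)) r i j = \<zero>\<^bsub>matrix_algebra B\<^esub> i j"
      by (simp add: peval_matrix matrix_algebra_simps)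
  qed
  show "action q \<in> algebra_hom B (matrix_algebra B)"
    unfolding action_def by (rule BqSU2_lift(1)[OF mat f rel])
  have "presented_lift (matrix_algebra B) ?f (ug q x) = ?f (ix x)"
    by (rule BqSU2_lift(2)[OF mat f rel])
  then show "action q (ug q x) i j = peval B z (ug q) (bq_action x i j)"
    by (simp add: action_def)
qed

lemmas act_linear = algebra_hom_linear[OF action_hom]

lemma action_closed: "f \<in> carrier (BqSU2 q) \<Longrightarrow> action q f i j \<in> carrier (BqSU2 q)"
  using complex_linear_closed[OF act_linear, of f] by (simp add: matrix_algebra_simps)

lemmas row = row_mult_linear[OF BqSU2_algebra] row_mult_closed[OF BqSU2_algebra] form_compD action_closed

lemma forms_bimodule: "algebra_bimodule (BqSU2 q) (forms q)"
proof (intro algebra_bimodule.intro algebra_bimodule_axioms.intro)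
  show "complex_algebra B" "cspace (forms q)" by simp_all
  fix \<omega> assume \<omega>: "\<omega> \<in> carrier (forms q)"
  show "\<omega> \<triangleleft>\<^bsub>forms q\<^esub> \<one>\<^bsub>B\<^esub> = \<omega>"
    using \<omega> by (intro form_eqI)
      (simp add: algebra_hom_one[OF action_hom] matrix_algebra_simps row_mult_one[OF BqSU2_algebra] form_compD)
  fix f g assume f: "f \<in> carrier B" and g: "g \<in> carrier B"
  have "action q (f \<otimes>\<^bsub>B\<^esub> g) = (\<lambda>i. row_mult B (action q f i) (action q g))"
    using f g by (intro ext) (simp add: algebra_hom_mult[OF action_hom] matrix_algebra_simps)
  then show "\<omega> \<triangleleft>\<^bsub>forms q\<^esub> (f \<otimes>\<^bsub>B\<^esub> g) = \<omega> \<triangleleft>\<^bsub>forms q\<^esub> f \<triangleleft>\<^bsub>forms q\<^esub> g"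
    using \<omega> f g
    by (intro form_eqI) (simp add: row_mult_assoc[OF BqSU2_algebra] row)
qed (auto intro!: form_eqI simp: forms_closed_iff row ca_distrib ca_smult ca_assoc complex_linear_add[OF act_linear]
    complex_linear_smult[OF act_linear] matrix_algebra_simps)

definition theta_form :: "2 \<Rightarrow> 2 \<Rightarrow> bq"
  where "theta_form = basis_form q (False, False) \<oplus>\<^bsub>forms q\<^esub> basis_form q (True, True)"

definition differential :: "bq \<Rightarrow> 2 \<Rightarrow> 2 \<Rightarrow> bq"
  where "differential f = complex_of_real (inverse (1 - 1 / q\<^sup>2)) \<odot>\<^bsub>forms q\<^esub>
    (theta_form \<triangleleft>\<^bsub>forms q\<^esub> f \<ominus>\<^bsub>forms q\<^esub> f \<triangleright>\<^bsub>forms q\<^esub> theta_form)"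

lemma theta_form_closed: "theta_form \<in> carrier (forms q)"
  by (simp add: theta_form_def)

lemmas lact_cl = algebra_bimodule.lact_closed[OF forms_bimodule]
lemmas ract_cl = algebra_bimodule.ract_closed[OF forms_bimodule]

lemma basis_form_ract: "f \<in> carrier (BqSU2 q) \<Longrightarrow>
    form_comp (basis_form q x \<triangleleft>\<^bsub>forms q\<^esub> f) j = action q f x j"
  by (simp add: row_mult_delta[OF BqSU2_algebra] action_closed)

lemma form_comp_differential:
  "form_comp (differential (ug q x)) j
    = complex_of_real (inverse (1 - 1 / q\<^sup>2)) \<odot>\<^bsub>BqSU2 q\<^esub> peval (BqSU2 q) z (ug q) (theta x j)"
proof -
  have u: "ug q x \<in> carrier B" by simp
  have cs: "cspace B" by simp
  have 1: "form_comp (theta_form \<triangleleft>\<^bsub>forms q\<^esub> ug q x) j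
      = peval B z (ug q) (bq_action x (False, False) j) \<oplus>\<^bsub>B\<^esub> peval B z (ug q) (bq_action x (True, True) j)"
    unfolding theta_form_def algebra_bimodule.ract_add_left[OF forms_bimodule u basis_form_closed basis_form_closed]
    by (simp add: row_mult_delta[OF BqSU2_algebra] action_ug pB)
  have "form_comp (differential (ug q x)) j = complex_of_real (inverse (1 - 1 / q\<^sup>2)) \<odot>\<^bsub>B\<^esub>
      (form_comp (theta_form \<triangleleft>\<^bsub>forms q\<^esub> ug q x) j \<ominus>\<^bsub>B\<^esub> form_comp (ug q x \<triangleright>\<^bsub>forms q\<^esub> theta_form) j)"
    unfolding differential_def form_comp_simps(3)
    by (simp only: form_comp_minus[OF ract_cl[OF u theta_form_closed] lact_cl[OF u theta_form_closed]])
  also have "form_comp (theta_form \<triangleleft>\<^bsub>forms q\<^esub> ug q x) j \<ominus>\<^bsub>B\<^esub> form_comp (ug q x \<triangleright>\<^bsub>forms q\<^esub> theta_form) j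
      = peval B z (ug q) (theta x j)"
    unfolding 1 theta_def using cs pB(3)[where P = "bq_action x (False, False) j"] pB(3)[where P = "bq_action x (True, True) j"]
    by (auto simp: pB(1) theta_form_def cs_minus coef_def cs_assoc)
  finally show ?thesis .
qed

lemma basis_expand:
  assumes "\<omega> \<in> carrier (forms q)"
  shows "(\<Oplus>\<^bsub>forms q\<^esub>i\<in>UNIV. \<Oplus>\<^bsub>forms q\<^esub>j\<in>UNIV. \<omega> i j \<triangleright>\<^bsub>forms q\<^esub> basis_form q (unix (i, j))) = \<omega>"
proof (rule form_eqI)
  fix x
  have c: "\<omega> i j \<in> carrier B" for i j
    using assms by (simp add: forms_def)
  then have t: "\<omega> i j \<triangleright>\<^bsub>forms q\<^esub> basis_form q (unix (i, j)) \<in> carrier (forms q)" for i j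
    by (intro lact_cl) simp_all
  have t': "\<omega> (idx a) (idx b) \<triangleright>\<^bsub>forms q\<^esub> basis_form q (a, b) \<in> carrier (forms q)" for a b
    using t[of "idx a" "idx b"] by (simp add: unix_def)
  show "form_comp (\<Oplus>\<^bsub>forms q\<^esub>i\<in>UNIV. \<Oplus>\<^bsub>forms q\<^esub>j\<in>UNIV. \<omega> i j \<triangleright>\<^bsub>forms q\<^esub> basis_form q (unix (i, j))) x = form_comp \<omega> x"
    using c by (cases x; cases "fst x"; cases "snd x")
      (simp_all add: finsum_idx t' unix_def form_comp_def[of \<omega>])
qed

lemma forms_free_left_basis: "free_left_basis (BqSU2 q) (forms q) (\<lambda>i j. basis_form q (unix (i, j)))"
  unfolding free_left_basis_def
proof (intro conjI allI ballI ex1I)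
  fix \<omega> assume \<omega>: "\<omega> \<in> carrier (forms q)"
  then show "\<omega> i j \<in> carrier B" for i j
    by (simp add: forms_def)
  show "\<omega> = (\<Oplus>\<^bsub>forms q\<^esub>i\<in>UNIV. \<Oplus>\<^bsub>forms q\<^esub>j\<in>UNIV. \<omega> i j \<triangleright>\<^bsub>forms q\<^esub> basis_form q (unix (i, j)))"
    using basis_expand[OF \<omega>] by simp
  fix f assume f: "(\<forall>i j. f i j \<in> carrier B) \<and>
    \<omega> = (\<Oplus>\<^bsub>forms q\<^esub>i\<in>UNIV. \<Oplus>\<^bsub>forms q\<^esub>j\<in>UNIV. f i j \<triangleright>\<^bsub>forms q\<^esub> basis_form q (unix (i, j)))"
  \<comment> \<open>Uniqueness: a family of coefficients is itself an element of the module, so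
    \<open>basis_expand\<close> says that its combination of basis forms is the family
    again.\<close>
  then have "f \<in> carrier (forms q)"
    by (simp add: forms_def)
  with f show "f = \<omega>"
    using basis_expand[of f] by simp
qed simp

lemma qcomm_basis_form:
  "form_comp (qcomm (forms q) p (basis_form q i) (ug q x)) j = peval (BqSU2 q) z (ug q) (bq_action x i j)
    \<ominus>\<^bsub>BqSU2 q\<^esub> complex_of_real p \<odot>\<^bsub>BqSU2 q\<^esub> (ug q x \<otimes>\<^bsub>BqSU2 q\<^esub> (if i = j then \<one>\<^bsub>BqSU2 q\<^esub> else \<zero>\<^bsub>BqSU2 q\<^esub>))"
proof -
  have u: "ug q x \<in> carrier B" by simp
  have "complex_of_real p \<odot>\<^bsub>forms q\<^esub> (ug q x \<triangleright>\<^bsub>forms q\<^esub> basis_form q i) \<in> carrier (forms q)"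
    using lact_cl[OF u basis_form_closed] by simp
  then show ?thesis
    unfolding qcomm_def
    by (simp only: form_comp_minus[OF ract_cl[OF u basis_form_closed]] basis_form_ract[OF u] action_ug)
      (simp add: if_distrib cong: if_cong)
qed

lemma forms_calculus_relations: "calculus_relations q (forms q) (\<lambda>i j. basis_form q (unix (i, j)))"
proof -
  have g: "u_gen q 1 1 = ug q (False, False)" "u_gen q 1 2 = ug q (False, True)"
    "u_gen q 2 1 = ug q (True, False)" "u_gen q 2 2 = ug q (True, True)"
    by (simp_all add: ug_def idx_def)
  have e: "unix (1, 1) = (False, False)" "unix (1, 2) = (False, True)"
    "unix (2, 1) = (True, False)" "unix (2, 2) = (True, True)"
    by (simp_all add: unix_def unidx_def)
  have cs: "cspace B" by simp
  have comb: "c \<odot>\<^bsub>B\<^esub> v \<oplus>\<^bsub>B\<^esub> v = (c + 1) \<odot>\<^bsub>B\<^esub> v" if "v \<in> carrier B" for c v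
    using that cs_distrib(1)[OF cs that, of c 1] cs by simp
  have zi: "z * (inverse z * t) = t" for t
    using q by simp
  have z3: "inverse (z ^ 3) = inverse z * (inverse z * inverse z)"
    by (simp add: power3_eq_cube)
  note s = bq_action_def psum_def coef_def cs_minus ca_distrib ca_smult cs_distrib(2) cs_smult_smult
    power_int_minus cs_assoc cs_combine divide_inverse power2_eq_square algebra_simps
  show ?thesis
    unfolding calculus_relations_def Let_def g e
    using q cs
    apply (intro conjI form_eqI_entries; simp add: qcomm_basis_form s)
    apply (simp_all add: comb)
    apply (simp_all add: z3 zi algebra_simps)
    apply (simp_all add: cs_comm[OF cs])
    done
qed

end

text \<open>After multiplication by q^6 the expression is (1 - q)(q - 1)(q^2 + q + 1)(q^2 - 1).
  Reality of \<open>q\<close> is what keeps the quadratic factor positive; primitive cube roots of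
  unity would be complex zeros.\<close>

lemma span_determinant:
  fixes q :: real
  assumes "q \<noteq> 0" "q\<^sup>2 \<noteq> 1"
  shows "1 / q ^ 6 - 1 / q ^ 5 - 1 / q ^ 4 + 1 / q ^ 2 + 1 / q - 1 \<noteq> 0"
proof -
  have q1: "q \<noteq> 1"
    using assms(2) by auto
  have "q\<^sup>2 + q + 1 = (q + 1 / 2)\<^sup>2 + 3 / 4"
    by (simp add: power2_eq_square algebra_simps)
  then have "q\<^sup>2 + q + 1 > 0"
    by (simp add: add_nonneg_pos)
  then have "(1 - q) * ((q - 1) * (q\<^sup>2 + q + 1)) * (q\<^sup>2 - 1) \<noteq> 0"
    using q1 assms(2) by simp
  also have "(1 - q) * ((q - 1) * (q\<^sup>2 + q + 1)) * (q\<^sup>2 - 1)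
      = q ^ 6 * (1 / q ^ 6 - 1 / q ^ 5 - 1 / q ^ 4 + 1 / q ^ 2 + 1 / q - 1)"
    using assms(1) by (simp add: field_simps power2_eq_square power_def eval_nat_numeral)
  finally show ?thesis
    by auto
qed

text \<open>The spanning axiom of a calculus asks for a sum over an initial segment of the natural
  numbers, whereas the combination found below runs over the four generators.\<close>

lemma finsum_nth_entries:
  assumes V: "cspace V" and F: "\<And>x :: entry. F x \<in> carrier V"
  shows "(\<Oplus>\<^bsub>V\<^esub>i\<in>{..<4}. F (entries ! i)) = finsum V F UNIV"
proof -
  interpret Module.module complex_field V by (rule V)
  have "(!) entries ` {..<4} = set entries"
    by (auto simp: entries_def set_conv_nth nth_Cons' lessThan_def numeral_eq_Suc less_Suc_eq image_iff)
  moreover have "inj_on ((!) entries) {..<4}"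
    by (rule inj_on_nth) (simp_all add: entries_def)
  ultimately show ?thesis
    using finsum_reindex[of F "(!) entries" "{..<4}"] F by (simp add: set_entries)
qed

section \<open>Spanning of the forms by elements f dg\<close>

locale calculus_parameter = nonzero_parameter +
  assumes q2: "q\<^sup>2 \<noteq> 1"
begin

abbreviation "\<mu> \<equiv> complex_of_real (1 - 1 / q\<^sup>2)"

lemma mu_nz: "\<mu> \<noteq> 0"
proof -
  have "1 - 1 / q\<^sup>2 \<noteq> 0"
    using q q2 by (simp add: field_simps)
  then show ?thesis
    unfolding of_real_eq_0_iff .
qed

lemma span_scale_nonzero: obtains s where "s \<noteq> 0" "peval (BqSU2 q) z (ug q) (span_scale i) = s \<odot>\<^bsub>BqSU2 q\<^esub> \<one>\<^bsub>BqSU2 q\<^esub>"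
proof -
  have cs: "cspace B" by simp
  note simps = span_scale_def coef_def cs_combine[OF cs] power_int_minus divide_inverse
  consider "i = (False, True)" | "i = (True, False)" | "i \<noteq> (False, True)" "i \<noteq> (True, False)"
    by blast
  then show ?thesis
  proof cases
    case 1
    then have "peval B z (ug q) (span_scale i) = \<mu> \<odot>\<^bsub>B\<^esub> \<one>\<^bsub>B\<^esub>"
      by (simp add: simps)
    with mu_nz show ?thesis by (rule that)
  next
    case 2
    have "inverse (z ^ 2) - inverse (z ^ 4) = inverse (z ^ 2) * \<mu>"
      using q by (simp add: field_simps power2_eq_square eval_nat_numeral)
    then have nz: "inverse (z ^ 2) - inverse (z ^ 4) \<noteq> 0"
      using mu_nz q by simp
    have "peval B z (ug q) (span_scale i) = (inverse (z ^ 2) - inverse (z ^ 4)) \<odot>\<^bsub>B\<^esub> \<one>\<^bsub>B\<^esub>"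
      using 2 by (simp add: simps)
    with nz show ?thesis by (rule that)
  next
    case 3
    let ?s = "complex_of_real (1 / q ^ 6 - 1 / q ^ 5 - 1 / q ^ 4 + 1 / q ^ 2 + 1 / q - 1)"
    have "?s \<noteq> 0"
      unfolding of_real_eq_0_iff by (rule span_determinant[OF q q2])
    moreover have "peval B z (ug q) (span_scale i) = ?s \<odot>\<^bsub>B\<^esub> \<one>\<^bsub>B\<^esub>"
      using 3 by (simp add: simps) (simp add: algebra_simps)
    ultimately show ?thesis by (rule that)
  qed
qed

lemma forms_spanned:
  assumes \<omega>: "\<omega> \<in> carrier (forms q)"
  shows "\<exists>(n::nat) f g. f \<in> {..<n} \<rightarrow> carrier (BqSU2 q) \<and> g \<in> {..<n} \<rightarrow> carrier (BqSU2 q) \<and>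
    \<omega> = (\<Oplus>\<^bsub>forms q\<^esub>i\<in>{..<n}. f i \<triangleright>\<^bsub>forms q\<^esub> differential (g i))"
proof -
  have cs: "cspace B" by simp
  have "\<exists>s. \<forall>i. s i \<noteq> 0 \<and> peval B z (ug q) (span_scale i) = s i \<odot>\<^bsub>B\<^esub> \<one>\<^bsub>B\<^esub>"
    by (rule choice) (metis span_scale_nonzero)
  then obtain s where s: "\<And>i. s i \<noteq> 0"
      "\<And>i. peval B z (ug q) (span_scale i) = s i \<odot>\<^bsub>B\<^esub> \<one>\<^bsub>B\<^esub>"
    by blast
  let ?S = "\<lambda>i x. peval B z (ug q) (span_coeff i x)" and ?T = "\<lambda>x j. peval B z (ug q) (theta x j)"
  let ?w = "form_comp \<omega>"
  \<comment> \<open>With S the matrix of \<open>span_coeff\<close> and T that of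
    \<open>theta\<close>, S T is diagonal with entries s_i, and du_x is \<mu>^-1 times row x of T.
    Hence e_i is \<mu> / s_i times the sum over x of S_ix du_x, and collecting the coefficient of
    du_x in the expansion of \<omega> gives \<open>G x\<close>.\<close>
  define G where "G x = (\<Oplus>\<^bsub>B\<^esub>i\<in>UNIV. (\<mu> / s i) \<odot>\<^bsub>B\<^esub> (?w i \<otimes>\<^bsub>B\<^esub> ?S i x))" for x
  note c = form_compD[OF \<omega>] pB(3)
  have G: "G x \<in> carrier B" for x
    unfolding G_def by (intro cs_finsum_closed[OF cs] Pi_I) (simp add: c)
  have d: "differential (ug q x) \<in> carrier (forms q)" for x
    using complex_linear_closed[OF inner_derivation(1)[OF forms_bimodule theta_form_closed]]
    unfolding differential_def by simp
  have t: "G x \<triangleright>\<^bsub>forms q\<^esub> differential (ug q x) \<in> carrier (forms q)" for x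
    using algebra_bimodule.lact_closed[OF forms_bimodule G d] .
  have ST: "(\<Oplus>\<^bsub>B\<^esub>x\<in>UNIV. ?S i x \<otimes>\<^bsub>B\<^esub> ?T x j) = (if i = j then s i \<odot>\<^bsub>B\<^esub> \<one>\<^bsub>B\<^esub> else \<zero>\<^bsub>B\<^esub>)" for i j
  proof -
    have "(\<Oplus>\<^bsub>B\<^esub>x\<in>UNIV. ?S i x \<otimes>\<^bsub>B\<^esub> ?T x j)
        = peval B z (ug q) (psum (\<lambda>x. pmul (span_coeff i x) (theta x j)) entries)"
      by (simp add: peval_psum_entries[where \<phi> = "ug q", OF BqSU2_algebra ug_closed] pB)
    also have "\<dots> = peval B z (ug q) (if i = j then span_scale i else [])"
      by (rule peval_eqI[OF BqSU2_algebra ug_closed z bq_rules_sound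
            span_check[unfolded all_entries, rule_format]])
    finally show ?thesis
      by (simp add: s)
  qed
  have "\<omega> = (\<Oplus>\<^bsub>forms q\<^esub>x\<in>UNIV. G x \<triangleright>\<^bsub>forms q\<^esub> differential (ug q x))"
  proof (rule form_eqI)
    fix j
    have comp_term: "G x \<otimes>\<^bsub>B\<^esub> form_comp (differential (ug q x)) j
        = (\<Oplus>\<^bsub>B\<^esub>i\<in>UNIV. (1 / s i) \<odot>\<^bsub>B\<^esub> (?w i \<otimes>\<^bsub>B\<^esub> (?S i x \<otimes>\<^bsub>B\<^esub> ?T x j)))" for x
      unfolding G_def form_comp_differential
      using mu_nz
      by (subst ca_finsum_mult[OF BqSU2_algebra])
        (auto intro!: cs_finsum_cong[OF cs] simp: c ca_smult ca_assoc cs_smult_smult of_real_inverse simp del: of_real_diff of_real_divide)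
    have "form_comp (\<Oplus>\<^bsub>forms q\<^esub>x\<in>UNIV. G x \<triangleright>\<^bsub>forms q\<^esub> differential (ug q x)) j
        = (\<Oplus>\<^bsub>B\<^esub>x\<in>UNIV. G x \<otimes>\<^bsub>B\<^esub> form_comp (differential (ug q x)) j)"
      using t by (simp add: form_comp_finsum)
    also have "\<dots> = (\<Oplus>\<^bsub>B\<^esub>i\<in>UNIV. \<Oplus>\<^bsub>B\<^esub>x\<in>UNIV. (1 / s i) \<odot>\<^bsub>B\<^esub> (?w i \<otimes>\<^bsub>B\<^esub> (?S i x \<otimes>\<^bsub>B\<^esub> ?T x j)))"
      unfolding comp_term by (rule cs_finsum_swap[OF cs]) (simp_all add: c)
    also have "\<dots> = (\<Oplus>\<^bsub>B\<^esub>i\<in>UNIV. (1 / s i) \<odot>\<^bsub>B\<^esub> (?w i \<otimes>\<^bsub>B\<^esub> (\<Oplus>\<^bsub>B\<^esub>x\<in>UNIV. ?S i x \<otimes>\<^bsub>B\<^esub> ?T x j)))"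
      by (simp add: ca_finsum_mult[OF BqSU2_algebra] cs_finsum_smult[OF cs] c)
    also have "\<dots> = (\<Oplus>\<^bsub>B\<^esub>i\<in>{j}. (1 / s i) \<odot>\<^bsub>B\<^esub> (?w i \<otimes>\<^bsub>B\<^esub> (\<Oplus>\<^bsub>B\<^esub>x\<in>UNIV. ?S i x \<otimes>\<^bsub>B\<^esub> ?T x j)))"
      unfolding ST by (rule cs_finsum_mono_neutral[OF cs]) (auto simp: c)
    also have "\<dots> = ?w j"
      unfolding ST using s(1)[of j] by (simp add: cs_finsum_insert[OF cs] c ca_smult cs_smult_smult)
    finally show "?w j = form_comp (\<Oplus>\<^bsub>forms q\<^esub>x\<in>UNIV. G x \<triangleright>\<^bsub>forms q\<^esub> differential (ug q x)) j"
      by simp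
  qed
  also have "\<dots> = (\<Oplus>\<^bsub>forms q\<^esub>i\<in>{..<4}. G (entries ! i) \<triangleright>\<^bsub>forms q\<^esub> differential (ug q (entries ! i)))"
    by (rule finsum_nth_entries[symmetric, OF forms_cspace t])
  finally have "\<omega> = (\<Oplus>\<^bsub>forms q\<^esub>i\<in>{..<4}. G (entries ! i) \<triangleright>\<^bsub>forms q\<^esub> differential (ug q (entries ! i)))" .
  then show ?thesis
    using G by (intro exI[of _ 4] exI[of _ "\<lambda>i. G (entries ! i)"] exI[of _ "\<lambda>i. ug q (entries ! i)"]) auto
qed

lemma forms_calculus: "first_order_calculus (BqSU2 q) (forms q) (differential)"
proof (intro first_order_calculus.intro first_order_calculus_axioms.intro)
  note inner = inner_derivation[OF forms_bimodule theta_form_closed]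
  show "algebra_bimodule B (forms q)"
    by (rule forms_bimodule)
  show "differential \<in> complex_linear B (forms q)"
    unfolding differential_def[abs_def] by (rule inner(1))
  show "differential (f \<otimes>\<^bsub>B\<^esub> g) = differential f \<triangleleft>\<^bsub>forms q\<^esub> g \<oplus>\<^bsub>forms q\<^esub> f \<triangleright>\<^bsub>forms q\<^esub> differential g"
    if "f \<in> carrier B" "g \<in> carrier B" for f g
    unfolding differential_def using that by (rule inner(2))
qed (rule forms_spanned)

end

section \<open>The coaction on one-forms\<close>

lemma complex_linear_finsum_fun:
  assumes "cspace V" "cspace W" "finite S" "\<And>i. i \<in> S \<Longrightarrow> F i \<in> complex_linear V W"
  shows "(\<lambda>x. \<Oplus>\<^bsub>W\<^esub>i\<in>S. F i x) \<in> complex_linear V W"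
proof (rule complex_linearI)
  note D = complex_linearD[OF assms(4)]
  show "(\<Oplus>\<^bsub>W\<^esub>i\<in>S. F i x) \<in> carrier W" if "x \<in> carrier V" for x
    using assms(2) that D(1) by (intro cs_finsum_closed) auto
  show "(\<Oplus>\<^bsub>W\<^esub>i\<in>S. F i (x \<oplus>\<^bsub>V\<^esub> y)) = (\<Oplus>\<^bsub>W\<^esub>i\<in>S. F i x) \<oplus>\<^bsub>W\<^esub> (\<Oplus>\<^bsub>W\<^esub>i\<in>S. F i y)"
    if "x \<in> carrier V" "y \<in> carrier V" for x y
    using assms(2) that D by (subst cs_finsum_add[symmetric]) (auto intro!: cs_finsum_cong)
  show "(\<Oplus>\<^bsub>W\<^esub>i\<in>S. F i (c \<odot>\<^bsub>V\<^esub> x)) = c \<odot>\<^bsub>W\<^esub> (\<Oplus>\<^bsub>W\<^esub>i\<in>S. F i x)" if "x \<in> carrier V" for c x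
    using assms(2) that D by (subst cs_finsum_smult) (auto intro!: cs_finsum_cong)
qed

lemma cs_finsum_delta:
  assumes "cspace V" "v \<in> carrier V"
  shows "(\<Oplus>\<^bsub>V\<^esub>i\<in>(UNIV :: 'i::finite set). if i = j then v else \<zero>\<^bsub>V\<^esub>) = v"
proof -
  have "(\<Oplus>\<^bsub>V\<^esub>i\<in>UNIV. if i = j then v else \<zero>\<^bsub>V\<^esub>) = (\<Oplus>\<^bsub>V\<^esub>i\<in>{j}. if i = j then v else \<zero>\<^bsub>V\<^esub>)"
    using assms by (intro cs_finsum_mono_neutral) auto
  then show ?thesis
    using assms by (simp add: cs_finsum_insert)
qed

context nonzero_parameter
begin

abbreviation "\<Omega> \<equiv> forms q"
abbreviation "OH \<equiv> tensor_space \<Omega> H"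
abbreviation "\<rho>\<^sub>B \<equiv> adjoint_coaction q"
abbreviation "bas \<equiv> basis_form q"
abbreviation "lH \<equiv> tensor_op \<Omega> H (lact \<Omega>) (\<otimes>\<^bsub>H\<^esub>)"
abbreviation "rH \<equiv> tensor_op \<Omega> H (ract \<Omega>) (\<otimes>\<^bsub>H\<^esub>)"

lemma BqSU2_cspace: "cspace B" by simp

lemma lact_bilinear: "lact \<Omega> \<in> complex_bilinear B \<Omega> \<Omega>"
proof -
  interpret algebra_bimodule B \<Omega> by (rule forms_bimodule)
  show ?thesis
    by (intro complex_bilinearI complex_linearI)
      (simp_all add: lact_closed lact_add_left lact_add_right lact_smult_left lact_smult_right)
qed

lemma ract_bilinear: "ract \<Omega> \<in> complex_bilinear \<Omega> B \<Omega>"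
proof -
  interpret algebra_bimodule B \<Omega> by (rule forms_bimodule)
  show ?thesis
    by (intro complex_bilinearI complex_linearI)
      (simp_all add: ract_closed ract_add_left ract_add_right ract_smult_left ract_smult_right)
qed

lemmas mult_H = ca_mult_bilinear[OF CqSL2_complex_algebra[of q]]
lemmas mult_B = ca_mult_bilinear[OF BqSU2_algebra[of q]]
lemmas rho_B_closed = complex_linear_closed[OF rho_linear]

lemmas lH_bilinear = tensor_op_bilinear[OF lact_bilinear mult_H BqSU2_cspace forms_cspace forms_cspace
    CqSL2_cspace CqSL2_cspace CqSL2_cspace]
lemmas lH_tens = tensor_op_tens[OF lact_bilinear mult_H BqSU2_cspace forms_cspace forms_cspace
    CqSL2_cspace CqSL2_cspace CqSL2_cspace]
lemmas rH_bilinear = tensor_op_bilinear[OF ract_bilinear mult_H forms_cspace BqSU2_cspace forms_cspace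
    CqSL2_cspace CqSL2_cspace CqSL2_cspace]
lemmas rH_tens = tensor_op_tens[OF ract_bilinear mult_H forms_cspace BqSU2_cspace forms_cspace
    CqSL2_cspace CqSL2_cspace CqSL2_cspace]

lemma lH_mult:
  assumes "x \<in> carrier BH" "y \<in> carrier BH" "\<omega> \<in> carrier OH"
  shows "lH (x \<otimes>\<^bsub>BH\<^esub> y) \<omega> = lH x (lH y \<omega>)"
  unfolding tensor_space_simps(2)
  by (rule tensor_op_assoc[OF mult_B lact_bilinear lact_bilinear lact_bilinear mult_H mult_H mult_H mult_H
        BqSU2_cspace BqSU2_cspace forms_cspace BqSU2_cspace forms_cspace forms_cspace
        CqSL2_cspace CqSL2_cspace CqSL2_cspace CqSL2_cspace CqSL2_cspace CqSL2_cspace])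
    (simp_all add: assms algebra_bimodule.lact_mult[OF forms_bimodule] ca_assoc)

lemma rH_mult:
  assumes "\<omega> \<in> carrier OH" "x \<in> carrier BH" "y \<in> carrier BH"
  shows "rH (rH \<omega> x) y = rH \<omega> (x \<otimes>\<^bsub>BH\<^esub> y)"
  unfolding tensor_space_simps(2)
  by (rule tensor_op_assoc[OF ract_bilinear ract_bilinear mult_B ract_bilinear mult_H mult_H mult_H mult_H
        forms_cspace BqSU2_cspace BqSU2_cspace forms_cspace forms_cspace BqSU2_cspace
        CqSL2_cspace CqSL2_cspace CqSL2_cspace CqSL2_cspace CqSL2_cspace CqSL2_cspace])
    (simp_all add: assms algebra_bimodule.ract_mult[OF forms_bimodule] ca_assoc)

lemma lH_rH:
  assumes "x \<in> carrier BH" "\<omega> \<in> carrier OH" "y \<in> carrier BH"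
  shows "rH (lH x \<omega>) y = lH x (rH \<omega> y)"
  by (rule tensor_op_assoc[OF lact_bilinear ract_bilinear ract_bilinear lact_bilinear mult_H mult_H mult_H mult_H
        BqSU2_cspace forms_cspace BqSU2_cspace forms_cspace forms_cspace forms_cspace
        CqSL2_cspace CqSL2_cspace CqSL2_cspace CqSL2_cspace CqSL2_cspace CqSL2_cspace])
    (simp_all add: assms algebra_bimodule.lact_ract[OF forms_bimodule] ca_assoc)

lemma lH_one:
  assumes "\<omega> \<in> carrier OH"
  shows "lH \<one>\<^bsub>BH\<^esub> \<omega> = \<omega>"
  using forms_cspace CqSL2_cspace assms
  by (induction \<omega> rule: tensor_induct)
    (simp_all add: tensor_space_simps(3) lH_tens algebra_bimodule.lact_one[OF forms_bimodule]
      complex_bilinear_add_right[OF lH_bilinear])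

lemma rH_one:
  assumes "\<omega> \<in> carrier OH"
  shows "rH \<omega> \<one>\<^bsub>BH\<^esub> = \<omega>"
  using forms_cspace CqSL2_cspace assms
  by (induction \<omega> rule: tensor_induct)
    (simp_all add: tensor_space_simps(3) rH_tens algebra_bimodule.ract_one[OF forms_bimodule]
      complex_bilinear_add_left[OF rH_bilinear])

text \<open>The prescribed coaction on basis forms, with \<open>form_coaction\<close> as matrix of
  coefficients. It uses the index type \<open>entry\<close>; agreement with the formula in the
  theorem is \<open>form_coact_basis_formula\<close>.\<close>

definition basis_coaction :: "entry \<Rightarrow> (2 \<Rightarrow> 2 \<Rightarrow> bq, cq) tensor"
  where "basis_coaction i = (\<Oplus>\<^bsub>OH\<^esub>k\<in>UNIV. tens \<Omega> H (bas k) (peval H z (tg q) (form_coaction i k)))"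

definition form_coact :: "(2 \<Rightarrow> 2 \<Rightarrow> bq) \<Rightarrow> (2 \<Rightarrow> 2 \<Rightarrow> bq, cq) tensor"
  where "form_coact \<omega> = (\<Oplus>\<^bsub>OH\<^esub>i\<in>UNIV. lH (\<rho>\<^sub>B (form_comp \<omega> i)) (basis_coaction i))"

lemma basis_coaction_closed: "basis_coaction i \<in> carrier OH"
  unfolding basis_coaction_def by (intro cs_finsum_closed[OF tensor_space_cspace] Pi_I) (simp add: pH)

lemma form_coact_linear: "form_coact \<in> complex_linear \<Omega> OH"
  unfolding form_coact_def[abs_def]
proof (rule complex_linear_finsum_fun[OF forms_cspace tensor_space_cspace finite])
  fix i
  have "(\<lambda>\<omega>. form_comp \<omega> i) \<in> complex_linear \<Omega> B"
    by (intro complex_linearI) (simp_all add: form_compD)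
  from complex_linear_comp[OF complex_linear_comp[OF this rho_linear]
      complex_bilinear_left[OF lH_bilinear basis_coaction_closed]]
  show "(\<lambda>\<omega>. lH (\<rho>\<^sub>B (form_comp \<omega> i)) (basis_coaction i)) \<in> complex_linear \<Omega> OH" .
qed

lemmas form_coact_closed = complex_linear_closed[OF form_coact_linear]

text \<open>Only one component of a basis form is nonzero, and the coaction sends the unit of B to
  the unit of B \<otimes> H, which acts as the identity.\<close>

lemma form_coact_basis: "form_coact (bas i) = basis_coaction i"
proof -
  have "\<rho>\<^sub>B \<zero>\<^bsub>B\<^esub> = \<zero>\<^bsub>BH\<^esub>"
    by (rule complex_linear_zero[OF BqSU2_cspace tensor_space_cspace rho_linear])
  moreover have "lH \<zero>\<^bsub>BH\<^esub> \<omega> = \<zero>\<^bsub>OH\<^esub>" if "\<omega> \<in> carrier OH" for \<omega>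
    by (rule complex_linear_zero[OF tensor_space_cspace tensor_space_cspace complex_bilinear_left[OF lH_bilinear that]])
  ultimately have "lH (\<rho>\<^sub>B (form_comp (bas i) k)) (basis_coaction k)
      = (if k = i then basis_coaction i else \<zero>\<^bsub>OH\<^esub>)" for k
    using basis_coaction_closed[of k] by (auto simp: algebra_hom_one[OF rho_hom] lH_one)
  then show ?thesis
    using basis_coaction_closed by (simp only: form_coact_def cs_finsum_delta[OF tensor_space_cspace])
qed

lemma form_coact_lact:
  assumes f: "f \<in> carrier B" and \<omega>: "\<omega> \<in> carrier \<Omega>"
  shows "form_coact (f \<triangleright>\<^bsub>\<Omega>\<^esub> \<omega>) = lH (\<rho>\<^sub>B f) (form_coact \<omega>)"
proof -
  have t: "lH (\<rho>\<^sub>B (form_comp \<omega> i)) (basis_coaction i) \<in> carrier OH" for i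
    using form_compD[OF \<omega>] by (intro complex_bilinear_closed[OF lH_bilinear] rho_B_closed basis_coaction_closed)
  have "form_coact (f \<triangleright>\<^bsub>\<Omega>\<^esub> \<omega>) = (\<Oplus>\<^bsub>OH\<^esub>i\<in>UNIV. lH (\<rho>\<^sub>B f) (lH (\<rho>\<^sub>B (form_comp \<omega> i)) (basis_coaction i)))"
    unfolding form_coact_def using f form_compD[OF \<omega>]
    by (simp add: algebra_hom_mult[OF rho_hom] lH_mult rho_B_closed basis_coaction_closed)
  also have "\<dots> = lH (\<rho>\<^sub>B f) (form_coact \<omega>)"
    unfolding form_coact_def
    by (rule complex_linear_finsum[OF tensor_space_cspace tensor_space_cspace
          complex_bilinear_right[OF lH_bilinear rho_B_closed[OF f]], symmetric]) (use t in simp)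
  finally show ?thesis .
qed

section \<open>Expansion in the basis, and compatibility of the coaction with right
  multiplication\<close>

lemma form_expand: "\<omega> \<in> carrier \<Omega> \<Longrightarrow> \<omega> = (\<Oplus>\<^bsub>\<Omega>\<^esub>k\<in>UNIV. form_comp \<omega> k \<triangleright>\<^bsub>\<Omega>\<^esub> bas k)"
proof (rule form_eqI)
  fix x assume \<omega>: "\<omega> \<in> carrier \<Omega>"
  have "form_comp \<omega> k \<otimes>\<^bsub>B\<^esub> (if k = x then \<one>\<^bsub>B\<^esub> else \<zero>\<^bsub>B\<^esub>) = (if k = x then form_comp \<omega> x else \<zero>\<^bsub>B\<^esub>)" for k
    using form_compD[OF \<omega>] by simp
  then show "form_comp \<omega> x = form_comp (\<Oplus>\<^bsub>\<Omega>\<^esub>k\<in>UNIV. form_comp \<omega> k \<triangleright>\<^bsub>\<Omega>\<^esub> bas k) x"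
    using form_compD[OF \<omega>] lact_cl[OF form_compD[OF \<omega>] basis_form_closed]
    by (simp add: form_comp_finsum cs_finsum_delta[OF BqSU2_cspace])
qed

lemma form_induct [consumes 1, case_names basis add]:
  assumes \<omega>: "\<omega> \<in> carrier \<Omega>"
    and basis: "\<And>f k. f \<in> carrier B \<Longrightarrow> P (f \<triangleright>\<^bsub>\<Omega>\<^esub> bas k)"
    and add: "\<And>\<omega> \<eta>. \<omega> \<in> carrier \<Omega> \<Longrightarrow> \<eta> \<in> carrier \<Omega> \<Longrightarrow> P \<omega> \<Longrightarrow> P \<eta> \<Longrightarrow> P (\<omega> \<oplus>\<^bsub>\<Omega>\<^esub> \<eta>)"
  shows "P \<omega>"
proof -
  have t: "form_comp \<omega> k \<triangleright>\<^bsub>\<Omega>\<^esub> bas k \<in> carrier \<Omega>" for k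
    using lact_cl[OF form_compD[OF \<omega>] basis_form_closed] .
  have "P (\<Oplus>\<^bsub>\<Omega>\<^esub>k\<in>UNIV. form_comp \<omega> k \<triangleright>\<^bsub>\<Omega>\<^esub> bas k)"
    unfolding finsum_entries[OF forms_cspace t]
    by (intro add basis t form_compD[OF \<omega>] cs_closed(2)[OF forms_cspace])
  then show ?thesis
    using form_expand[OF \<omega>] by simp
qed

text \<open>For a fixed \<open>g\<close>, left linearity extends the claim from basis forms to all
  forms: (f e_k) g = f (e_k g), and the left and right actions of B \<otimes> H on \<Omega>
  \<otimes> H commute in the same way.\<close>

lemma form_coact_ract_of_basis:
  assumes g: "g \<in> carrier B" and basis: "\<And>k. form_coact (bas k \<triangleleft>\<^bsub>\<Omega>\<^esub> g) = rH (basis_coaction k) (\<rho>\<^sub>B g)"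
    and \<omega>: "\<omega> \<in> carrier \<Omega>"
  shows "form_coact (\<omega> \<triangleleft>\<^bsub>\<Omega>\<^esub> g) = rH (form_coact \<omega>) (\<rho>\<^sub>B g)"
  using \<omega>
proof (induction \<omega> rule: form_induct)
  case (basis f k)
  note b = basis_form_closed[of q k]
  have "form_coact ((f \<triangleright>\<^bsub>\<Omega>\<^esub> bas k) \<triangleleft>\<^bsub>\<Omega>\<^esub> g) = form_coact (f \<triangleright>\<^bsub>\<Omega>\<^esub> (bas k \<triangleleft>\<^bsub>\<Omega>\<^esub> g))"
    by (simp only: algebra_bimodule.lact_ract[OF forms_bimodule basis g b])
  also have "\<dots> = lH (\<rho>\<^sub>B f) (rH (basis_coaction k) (\<rho>\<^sub>B g))"
    by (simp only: form_coact_lact[OF basis ract_cl[OF g b]] assms(2))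
  also have "\<dots> = rH (form_coact (f \<triangleright>\<^bsub>\<Omega>\<^esub> bas k)) (\<rho>\<^sub>B g)"
    by (simp only: form_coact_lact[OF basis b] form_coact_basis
        lH_rH[OF rho_B_closed[OF basis] basis_coaction_closed rho_B_closed[OF g]])
  finally show ?case .
next
  case (add \<omega> \<eta>)
  then show ?case
    using g by (simp add: algebra_bimodule.ract_add_left[OF forms_bimodule] complex_linear_add[OF form_coact_linear]
        ract_cl complex_bilinear_add_left[OF rH_bilinear] form_coact_closed rho_B_closed)
qed

lemma BqSU2_induct [consumes 1, case_names one gen smult add]:
  assumes "x \<in> carrier B" "P \<one>\<^bsub>B\<^esub>"
    and gen: "\<And>g x. x \<in> carrier B \<Longrightarrow> P x \<Longrightarrow> P (ug q g \<otimes>\<^bsub>B\<^esub> x)"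
    and "\<And>c x. x \<in> carrier B \<Longrightarrow> P x \<Longrightarrow> P (c \<odot>\<^bsub>B\<^esub> x)"
    and "\<And>x y. x \<in> carrier B \<Longrightarrow> y \<in> carrier B \<Longrightarrow> P x \<Longrightarrow> P y \<Longrightarrow> P (x \<oplus>\<^bsub>B\<^esub> y)"
  shows "P x"
proof (rule presented_induct[of x "BqSU2_relations q" P, folded BqSU2_def])
  fix p x assume "x \<in> carrier B" "P x"
  moreover obtain g where "p = ix g"
    by (rule ix_cases)
  ultimately show "P (presented_gen (BqSU2_relations q) p \<otimes>\<^bsub>B\<^esub> x)"
    using gen[of x g] by (simp add: ug_presented)
qed (use assms in auto)

lemma lH_tens_basis:
  assumes "v \<in> carrier B" "h \<in> carrier H"
  shows "lH (tens B H v h) (tens \<Omega> H (bas k) \<one>\<^bsub>H\<^esub>) = tens \<Omega> H (v \<triangleright>\<^bsub>\<Omega>\<^esub> bas k) h"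
  using assms by (simp add: lH_tens)

abbreviation "b1 k \<equiv> tens \<Omega> H (bas k) \<one>\<^bsub>H\<^esub>"

lemma b1_closed: "b1 k \<in> carrier OH"
  by simp

lemma lH_finsum_left:
  assumes "\<And>j. F j \<in> carrier BH" "\<omega> \<in> carrier OH"
  shows "lH (\<Oplus>\<^bsub>BH\<^esub>j\<in>S. F j) \<omega> = (\<Oplus>\<^bsub>OH\<^esub>j\<in>S. lH (F j) \<omega>)"
  by (rule complex_linear_finsum[OF tensor_space_cspace tensor_space_cspace
        complex_bilinear_left[OF lH_bilinear assms(2)]]) (use assms(1) in simp)

lemma lH_finsum_right:
  assumes "\<And>j. F j \<in> carrier OH" "x \<in> carrier BH"
  shows "lH x (\<Oplus>\<^bsub>OH\<^esub>j\<in>S. F j) = (\<Oplus>\<^bsub>OH\<^esub>j\<in>S. lH x (F j))"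
  by (rule complex_linear_finsum[OF tensor_space_cspace tensor_space_cspace
        complex_bilinear_right[OF lH_bilinear assms(2)]]) (use assms(1) in simp)

lemma rH_finsum_left:
  assumes "\<And>j. F j \<in> carrier OH" "x \<in> carrier BH"
  shows "rH (\<Oplus>\<^bsub>OH\<^esub>j\<in>S. F j) x = (\<Oplus>\<^bsub>OH\<^esub>j\<in>S. rH (F j) x)"
  by (rule complex_linear_finsum[OF tensor_space_cspace tensor_space_cspace
        complex_bilinear_left[OF rH_bilinear assms(2)]]) (use assms(1) in simp)

lemma rH_finsum_right:
  assumes "\<And>j. F j \<in> carrier BH" "\<omega> \<in> carrier OH"
  shows "rH \<omega> (\<Oplus>\<^bsub>BH\<^esub>j\<in>S. F j) = (\<Oplus>\<^bsub>OH\<^esub>j\<in>S. rH \<omega> (F j))"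
  by (rule complex_linear_finsum[OF tensor_space_cspace tensor_space_cspace
        complex_bilinear_right[OF rH_bilinear assms(2)]]) (use assms(1) in simp)

lemma peval_BH_Snd: "peval BH z bt (pmap Snd P) = tens B H \<one>\<^bsub>B\<^esub> (peval H z (tg q) P)"
  using peval_hom[where \<phi> = "tg q", OF CqSL2_complex_algebra tens_one_left_hom[OF BqSU2_algebra CqSL2_complex_algebra] BH tg_closed]
  by (simp add: peval_pmap two_gen_def)

text \<open>Brings the coaction of e_i u_x into the shape of a combination of the e_l \<otimes> 1
  with coefficients in B \<otimes> H on the left, so that it can be compared with the other order of
  operations one coefficient at a time.\<close>

lemma form_coact_gen_left:
  "form_coact (bas i \<triangleleft>\<^bsub>\<Omega>\<^esub> ug q x) = (\<Oplus>\<^bsub>OH\<^esub>l\<in>UNIV. lH (peval BH z bt (cov_left x i l)) (b1 l))"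
proof -
  let ?X = "\<lambda>j. peval BH z bt (psubst bq_coaction (bq_action x i j))"
  let ?Y = "\<lambda>j l. peval BH z bt (pmap Snd (form_coaction j l))"
  have rho: "\<rho>\<^sub>B (form_comp (bas i \<triangleleft>\<^bsub>\<Omega>\<^esub> ug q x) j) = ?X j" for j
    unfolding basis_form_ract[OF ug_closed] action_ug
      peval_hom[where \<phi> = "ug q", OF BqSU2_algebra rho_hom BH ug_closed] adjoint_coaction_ug
    by (rule peval_psubst[OF BH bt_closed z])
  have E: "basis_coaction j = (\<Oplus>\<^bsub>OH\<^esub>l\<in>UNIV. lH (?Y j l) (b1 l))" for j
    unfolding basis_coaction_def peval_BH_Snd
    by (simp add: lH_tens pH algebra_bimodule.lact_one[OF forms_bimodule])
  have c: "lH (?Y j l) (b1 l) \<in> carrier OH" "lH (?X j) (lH (?Y j l) (b1 l)) \<in> carrier OH" for j l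
    by (simp_all add: complex_bilinear_closed[OF lH_bilinear] pBH)
  have cov: "(\<Oplus>\<^bsub>BH\<^esub>j\<in>UNIV. ?X j \<otimes>\<^bsub>BH\<^esub> ?Y j l) = peval BH z bt (cov_left x i l)" for l
    unfolding cov_left_def peval_psum_entries[where \<phi> = bt, OF BH bt_closed] pBH(2) ..
  have "form_coact (bas i \<triangleleft>\<^bsub>\<Omega>\<^esub> ug q x) = (\<Oplus>\<^bsub>OH\<^esub>j\<in>UNIV. \<Oplus>\<^bsub>OH\<^esub>l\<in>UNIV. lH (?X j) (lH (?Y j l) (b1 l)))"
    unfolding form_coact_def rho E by (simp only: lH_finsum_right[OF c(1) pBH(3)])
  also have "\<dots> = (\<Oplus>\<^bsub>OH\<^esub>l\<in>UNIV. \<Oplus>\<^bsub>OH\<^esub>j\<in>UNIV. lH (?X j) (lH (?Y j l) (b1 l)))"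
    by (rule cs_finsum_swap[OF tensor_space_cspace finite finite c(2)])
  also have "\<dots> = (\<Oplus>\<^bsub>OH\<^esub>l\<in>UNIV. lH (\<Oplus>\<^bsub>BH\<^esub>j\<in>UNIV. ?X j \<otimes>\<^bsub>BH\<^esub> ?Y j l) (b1 l))"
    by (simp only: lH_finsum_left[OF ca_mult_closed[OF BH pBH(3) pBH(3)] b1_closed]
        lH_mult[OF pBH(3) pBH(3) b1_closed])
  also have "\<dots> = (\<Oplus>\<^bsub>OH\<^esub>l\<in>UNIV. lH (peval BH z bt (cov_left x i l)) (b1 l))"
    by (simp only: cov)
  finally show ?thesis .
qed

lemma rho_ug: "\<rho>\<^sub>B (ug q x) = (\<Oplus>\<^bsub>BH\<^esub>s\<in>UNIV. tens B H (ug q s) (peval H z (tg q) (adj x s)))"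
proof -
  have "tens B H (ug q s) (peval H z (tg q) (adj x s)) = peval BH z bt (pmul (pmap Fst [(1, 0, [s])]) (pmap Snd (adj x s)))" for s
    using tens_peval[where \<phi> = "ug q" and \<psi> = "tg q", OF BqSU2_algebra CqSL2_complex_algebra ug_closed tg_closed z,
        where P = "[(1, 0, [s])]" and Q = "adj x s"]
    unfolding ug_peval .
  then show ?thesis
    unfolding adjoint_coaction_ug bq_coaction_def peval_psum_entries[where \<phi> = bt, OF BH bt_closed] by simp
qed

lemma tens_form_expand:
  assumes "\<omega> \<in> carrier \<Omega>" "h \<in> carrier H"
  shows "tens \<Omega> H \<omega> h = (\<Oplus>\<^bsub>OH\<^esub>l\<in>UNIV. lH (tens B H (form_comp \<omega> l) h) (b1 l))"
proof -
  have "tens \<Omega> H \<omega> h = tens \<Omega> H (\<Oplus>\<^bsub>\<Omega>\<^esub>l\<in>UNIV. form_comp \<omega> l \<triangleright>\<^bsub>\<Omega>\<^esub> bas l) h"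
    using form_expand[OF assms(1)] by simp
  also have "\<dots> = (\<Oplus>\<^bsub>OH\<^esub>l\<in>UNIV. tens \<Omega> H (form_comp \<omega> l \<triangleright>\<^bsub>\<Omega>\<^esub> bas l) h)"
    using lact_cl[OF form_compD[OF assms(1)] basis_form_closed]
    by (intro complex_linear_finsum[OF forms_cspace tensor_space_cspace
          complex_bilinear_left[OF tens_bilinear[OF forms_cspace CqSL2_cspace] assms(2)]]) simp
  also have "\<dots> = (\<Oplus>\<^bsub>OH\<^esub>l\<in>UNIV. lH (tens B H (form_comp \<omega> l) h) (b1 l))"
    by (simp only: lH_tens_basis[OF form_compD[OF assms(1)] assms(2)])
  finally show ?thesis .
qed

text \<open>The counterpart with the same shape: each product e_k u_s is expanded again in the
  basis, and the H-coefficients of the form and of the generator are multiplied in that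
  order.\<close>

lemma form_coact_gen_right:
  "rH (basis_coaction i) (\<rho>\<^sub>B (ug q x)) = (\<Oplus>\<^bsub>OH\<^esub>l\<in>UNIV. lH (peval BH z bt (cov_right x i l)) (b1 l))"
proof -
  let ?T = "\<lambda>k. peval H z (tg q) (form_coaction i k)" and ?A = "\<lambda>s. peval H z (tg q) (adj x s)"
  let ?Q = "\<lambda>k s l. peval BH z bt (pmul (pmap Fst (bq_action s k l)) (pmap Snd (pmul (form_coaction i k) (adj x s))))"
  have Tc: "tens \<Omega> H (bas k) (?T k) \<in> carrier OH" for k
    by (simp add: pH)
  have Ac: "tens B H (ug q s) (?A s) \<in> carrier BH" for s
    by (simp add: pH)
  have Rc: "(\<Oplus>\<^bsub>BH\<^esub>s\<in>UNIV. tens B H (ug q s) (?A s)) \<in> carrier BH"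
    using Ac by (intro cs_finsum_closed[OF tensor_space_cspace]) simp
  have c: "lH (?Q k s l) (b1 l) \<in> carrier OH" for k s l
    by (simp add: complex_bilinear_closed[OF lH_bilinear] pBH)
  have swap: "(\<Oplus>\<^bsub>OH\<^esub>s\<in>UNIV. \<Oplus>\<^bsub>OH\<^esub>l\<in>UNIV. lH (?Q k s l) (b1 l)) = (\<Oplus>\<^bsub>OH\<^esub>l\<in>UNIV. \<Oplus>\<^bsub>OH\<^esub>s\<in>UNIV. lH (?Q k s l) (b1 l))" for k
    by (rule cs_finsum_swap[OF tensor_space_cspace finite finite c])
  have ks: "rH (tens \<Omega> H (bas k) (?T k)) (tens B H (ug q s) (?A s)) = (\<Oplus>\<^bsub>OH\<^esub>l\<in>UNIV. lH (?Q k s l) (b1 l))" for k s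
  proof -
    have "rH (tens \<Omega> H (bas k) (?T k)) (tens B H (ug q s) (?A s)) = tens \<Omega> H (bas k \<triangleleft>\<^bsub>\<Omega>\<^esub> ug q s) (?T k \<otimes>\<^bsub>H\<^esub> ?A s)"
      by (rule rH_tens) (simp_all add: pH)
    also have "\<dots> = (\<Oplus>\<^bsub>OH\<^esub>l\<in>UNIV. lH (tens B H (form_comp (bas k \<triangleleft>\<^bsub>\<Omega>\<^esub> ug q s) l) (?T k \<otimes>\<^bsub>H\<^esub> ?A s)) (b1 l))"
      by (rule tens_form_expand[OF ract_cl[OF ug_closed basis_form_closed]]) (simp add: pH)
    also have "\<dots> = (\<Oplus>\<^bsub>OH\<^esub>l\<in>UNIV. lH (?Q k s l) (b1 l))"
      by (simp only: basis_form_ract[OF ug_closed] action_ug pH(2)[symmetric]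
          tens_peval[where \<phi> = "ug q" and \<psi> = "tg q", OF BqSU2_algebra CqSL2_complex_algebra ug_closed tg_closed z])
    finally show ?thesis .
  qed
  have cov: "(\<Oplus>\<^bsub>BH\<^esub>k\<in>UNIV. \<Oplus>\<^bsub>BH\<^esub>s\<in>UNIV. ?Q k s l) = peval BH z bt (cov_right x i l)" for l
    unfolding cov_right_def peval_psum_entries[where \<phi> = bt, OF BH bt_closed] ..
  have "rH (basis_coaction i) (\<rho>\<^sub>B (ug q x)) = (\<Oplus>\<^bsub>OH\<^esub>k\<in>UNIV. \<Oplus>\<^bsub>OH\<^esub>s\<in>UNIV. \<Oplus>\<^bsub>OH\<^esub>l\<in>UNIV. lH (?Q k s l) (b1 l))"
    unfolding basis_coaction_def rho_ug
    by (simp only: rH_finsum_left[OF Tc Rc] rH_finsum_right[OF Ac Tc] ks)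
  also have "\<dots> = (\<Oplus>\<^bsub>OH\<^esub>k\<in>UNIV. \<Oplus>\<^bsub>OH\<^esub>l\<in>UNIV. \<Oplus>\<^bsub>OH\<^esub>s\<in>UNIV. lH (?Q k s l) (b1 l))"
    by (simp only: swap)
  also have "\<dots> = (\<Oplus>\<^bsub>OH\<^esub>l\<in>UNIV. \<Oplus>\<^bsub>OH\<^esub>k\<in>UNIV. \<Oplus>\<^bsub>OH\<^esub>s\<in>UNIV. lH (?Q k s l) (b1 l))"
    using c by (intro cs_finsum_swap[OF tensor_space_cspace finite finite] cs_finsum_closed[OF tensor_space_cspace]) simp
  also have "\<dots> = (\<Oplus>\<^bsub>OH\<^esub>l\<in>UNIV. lH (\<Oplus>\<^bsub>BH\<^esub>k\<in>UNIV. \<Oplus>\<^bsub>BH\<^esub>s\<in>UNIV. ?Q k s l) (b1 l))"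
    by (simp only: lH_finsum_left[OF pBH(3) b1_closed]
        lH_finsum_left[OF cs_finsum_closed[OF tensor_space_cspace Pi_I[OF pBH(3)]] b1_closed])
  also have "\<dots> = (\<Oplus>\<^bsub>OH\<^esub>l\<in>UNIV. lH (peval BH z bt (cov_right x i l)) (b1 l))"
    by (simp only: cov)
  finally show ?thesis .
qed

lemma form_coact_ract:
  assumes "f \<in> carrier B" and \<omega>: "\<omega> \<in> carrier \<Omega>"
  shows "form_coact (\<omega> \<triangleleft>\<^bsub>\<Omega>\<^esub> f) = rH (form_coact \<omega>) (\<rho>\<^sub>B f)"
proof (rule form_coact_ract_of_basis[OF assms(1) _ \<omega>])
  note E = basis_coaction_closed
  note bim = forms_bimodule
  show "form_coact (bas k \<triangleleft>\<^bsub>\<Omega>\<^esub> f) = rH (basis_coaction k) (\<rho>\<^sub>B f)" for k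
    using assms(1)
  \<comment> \<open>The index stays arbitrary: e_k u_x involves other basis forms, so the induction
    hypothesis is needed for all of them, and \<open>form_coact_ract_of_basis\<close> then extends
    it to the form e_k u_x.\<close>
  proof (induction f arbitrary: k rule: BqSU2_induct)
    case one
    then show ?case
      by (simp add: algebra_bimodule.ract_one[OF bim] form_coact_basis algebra_hom_one[OF rho_hom] rH_one E)
  next
    case (gen x f)
    have "peval BH z bt (cov_left x i l) = peval BH z bt (cov_right x i l)" for i l
      by (rule peval_eqI[OF BH bt_closed z bq_hq_rules_sound covariance_check[unfolded all_entries, rule_format]])
    then have x: "form_coact (bas k \<triangleleft>\<^bsub>\<Omega>\<^esub> ug q x) = rH (basis_coaction k) (\<rho>\<^sub>B (ug q x))"
      unfolding form_coact_gen_left form_coact_gen_right by simp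
    have u: "ug q x \<in> carrier B" by simp
    have "form_coact (bas k \<triangleleft>\<^bsub>\<Omega>\<^esub> (ug q x \<otimes>\<^bsub>B\<^esub> f)) = form_coact (bas k \<triangleleft>\<^bsub>\<Omega>\<^esub> ug q x \<triangleleft>\<^bsub>\<Omega>\<^esub> f)"
      by (simp only: algebra_bimodule.ract_mult[OF bim u gen(1) basis_form_closed])
    also have "\<dots> = rH (form_coact (bas k \<triangleleft>\<^bsub>\<Omega>\<^esub> ug q x)) (\<rho>\<^sub>B f)"
      by (rule form_coact_ract_of_basis[OF gen(1) gen(2) ract_cl[OF u basis_form_closed]])
    also have "\<dots> = rH (basis_coaction k) (\<rho>\<^sub>B (ug q x \<otimes>\<^bsub>B\<^esub> f))"
      by (simp only: x rH_mult[OF E rho_B_closed[OF u] rho_B_closed[OF gen(1)]] algebra_hom_mult[OF rho_hom u gen(1)])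
    finally show ?case .
  next
    case (smult c f)
    then show ?case
      by (simp add: algebra_bimodule.ract_smult_right[OF bim] complex_linear_smult[OF form_coact_linear]
          complex_linear_smult[OF rho_linear] complex_bilinear_smult_right[OF rH_bilinear] E rho_B_closed ract_cl)
  next
    case (add f g)
    then show ?case
      by (simp add: algebra_bimodule.ract_add_right[OF bim] complex_linear_add[OF form_coact_linear]
          complex_linear_add[OF rho_linear] complex_bilinear_add_right[OF rH_bilinear] E rho_B_closed ract_cl)
  qed
qed

section \<open>The coinvariant form \<theta> and compatibility with the differential\<close>

lemma form_coact_theta: "form_coact theta_form = tens \<Omega> H theta_form \<one>\<^bsub>H\<^esub>"
proof -
  let ?T = "\<lambda>i k. peval H z (tg q) (form_coaction i k)"
  have T: "?T (False, False) k \<oplus>\<^bsub>H\<^esub> ?T (True, True) k = (if fst k = snd k then \<one>\<^bsub>H\<^esub> else \<zero>\<^bsub>H\<^esub>)" for k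
  proof -
    have "peval H z (tg q) (form_coaction (False, False) k @ form_coaction (True, True) k) = peval H z (tg q) (hq_counit k)"
      by (rule peval_eqI[OF CqSL2_complex_algebra tg_closed z hq_rules_sound
            form_theta_check[unfolded all_entries, rule_format]])
    then show ?thesis
      using CqSL2_cspace[of q] by (simp add: pH(1) hq_counit_def coef_def)
  qed
  have t: "tens \<Omega> H (bas k) (?T i k) \<in> carrier OH" for i k
    by (simp add: pH)
  have "form_coact theta_form = basis_coaction (False, False) \<oplus>\<^bsub>OH\<^esub> basis_coaction (True, True)"
    by (simp add: theta_form_def complex_linear_add[OF form_coact_linear] form_coact_basis)
  also have "\<dots> = (\<Oplus>\<^bsub>OH\<^esub>k\<in>UNIV. tens \<Omega> H (bas k) (?T (False, False) k) \<oplus>\<^bsub>OH\<^esub> tens \<Omega> H (bas k) (?T (True, True) k))"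
    unfolding basis_coaction_def using t by (intro cs_finsum_add[OF tensor_space_cspace, symmetric]) simp_all
  also have "\<dots> = (\<Oplus>\<^bsub>OH\<^esub>k\<in>UNIV. tens \<Omega> H (bas k) (if fst k = snd k then \<one>\<^bsub>H\<^esub> else \<zero>\<^bsub>H\<^esub>))"
    by (simp only: T[symmetric] complex_linear_add[OF complex_bilinear_right[OF tens_bilinear[OF forms_cspace CqSL2_cspace]
            basis_form_closed] pH(3) pH(3)])
  also have "\<dots> = tens \<Omega> H (bas (False, False)) \<one>\<^bsub>H\<^esub> \<oplus>\<^bsub>OH\<^esub> tens \<Omega> H (bas (True, True)) \<one>\<^bsub>H\<^esub>"
  proof -
    have "tens \<Omega> H (bas k) \<zero>\<^bsub>H\<^esub> = \<zero>\<^bsub>OH\<^esub>" for k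
      by (rule complex_linear_zero[OF CqSL2_cspace tensor_space_cspace
            complex_bilinear_right[OF tens_bilinear[OF forms_cspace CqSL2_cspace] basis_form_closed]])
    then show ?thesis
      using CqSL2_cspace[of q] by (subst finsum_entries[OF tensor_space_cspace]) auto
  qed
  also have "\<dots> = tens \<Omega> H theta_form \<one>\<^bsub>H\<^esub>"
    by (simp add: theta_form_def tens_simps CqSL2_cspace)
  finally show ?thesis .
qed

lemma differential_linear: "differential \<in> complex_linear B \<Omega>"
  unfolding differential_def[abs_def] by (rule inner_derivation(1)[OF forms_bimodule theta_form_closed])

lemma form_coact_differential:
  assumes f: "f \<in> carrier B"
  shows "form_coact (differential f) = tensor_map \<Omega> H differential id (\<rho>\<^sub>B f)"
proof -
  let ?c = "complex_of_real (inverse (1 - 1 / q\<^sup>2))" and ?\<theta> = "tens \<Omega> H theta_form \<one>\<^bsub>H\<^esub>"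
  have \<theta>: "?\<theta> \<in> carrier OH"
    using theta_form_closed by simp
  \<comment> \<open>Stated for every element y of B \<otimes> H: the commutator of \<theta>
    \<otimes> 1 with v \<otimes> h is the commutator of \<theta> with v, tensored with h. So after
    the factor \<mu>^-1 it equals d \<otimes> id. Coinvariance of \<theta> then allows y to be the
    coaction of f.\<close>
  have inner: "?c \<odot>\<^bsub>OH\<^esub> (rH ?\<theta> y \<oplus>\<^bsub>OH\<^esub> (- 1) \<odot>\<^bsub>OH\<^esub> lH y ?\<theta>) = tensor_map \<Omega> H differential id y"
    if "y \<in> carrier BH" for y
    using BqSU2_cspace CqSL2_cspace that
  proof (induction y rule: tensor_induct)
    case (tens v h)
    have r: "theta_form \<triangleleft>\<^bsub>\<Omega>\<^esub> v \<in> carrier \<Omega>" "v \<triangleright>\<^bsub>\<Omega>\<^esub> theta_form \<in> carrier \<Omega>"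
      using ract_cl lact_cl tens theta_form_closed by simp_all
    then have "tens \<Omega> H (differential v) h
        = ?c \<odot>\<^bsub>OH\<^esub> (tens \<Omega> H (theta_form \<triangleleft>\<^bsub>\<Omega>\<^esub> v) h \<oplus>\<^bsub>OH\<^esub> (- 1) \<odot>\<^bsub>OH\<^esub> tens \<Omega> H (v \<triangleright>\<^bsub>\<Omega>\<^esub> theta_form) h)"
      using tens(2) by (simp add: differential_def cs_minus tens_simps CqSL2_cspace)
    moreover have "tensor_map \<Omega> H differential id (tens B H v h) = tens \<Omega> H (differential v) h"
      using tensor_map_tens[OF differential_linear complex_linear_id BqSU2_cspace forms_cspace CqSL2_cspace
          CqSL2_cspace tens] by (simp only: id_apply)
    ultimately show ?case
      using tens theta_form_closed by (simp add: rH_tens lH_tens del: id_apply)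
  next
    case (add x y)
    let ?f = "\<lambda>x. ?c \<odot>\<^bsub>OH\<^esub> (rH ?\<theta> x \<oplus>\<^bsub>OH\<^esub> (- 1) \<odot>\<^bsub>OH\<^esub> lH x ?\<theta>)"
    have "?f (x \<oplus>\<^bsub>BH\<^esub> y) = ?f x \<oplus>\<^bsub>OH\<^esub> ?f y"
      using add(1,2) \<theta>
      by (simp add: complex_bilinear_add_right[OF rH_bilinear] complex_bilinear_add_left[OF lH_bilinear]
          complex_bilinear_closed[OF rH_bilinear] complex_bilinear_closed[OF lH_bilinear]
          cs_distrib(2)[OF tensor_space_cspace] cs_ac[OF tensor_space_cspace])
    then show ?case
      by (simp only: add(3,4) complex_linear_add[OF tensor_map_linear[OF differential_linear complex_linear_id
              BqSU2_cspace forms_cspace CqSL2_cspace CqSL2_cspace] add(1,2)])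
  qed
  have r: "theta_form \<triangleleft>\<^bsub>\<Omega>\<^esub> f \<in> carrier \<Omega>" "f \<triangleright>\<^bsub>\<Omega>\<^esub> theta_form \<in> carrier \<Omega>"
    using ract_cl lact_cl f theta_form_closed by simp_all
  have "form_coact (differential f) = ?c \<odot>\<^bsub>OH\<^esub> (rH ?\<theta> (\<rho>\<^sub>B f) \<oplus>\<^bsub>OH\<^esub> (- 1) \<odot>\<^bsub>OH\<^esub> lH (\<rho>\<^sub>B f) ?\<theta>)"
    using r f theta_form_closed
    by (simp add: differential_def cs_minus complex_linearD[OF form_coact_linear] form_coact_ract form_coact_lact
        form_coact_theta)
  also have "\<dots> = tensor_map \<Omega> H differential id (\<rho>\<^sub>B f)"
    by (rule inner[OF rho_B_closed[OF f]])
  finally show ?thesis .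
qed

section \<open>Coassociativity and counit for the coaction on forms\<close>

abbreviation "OHH \<equiv> tensor_space \<Omega> HH"
abbreviation "lHH \<equiv> tensor_op \<Omega> HH (lact \<Omega>) (\<otimes>\<^bsub>HH\<^esub>)"

lemmas mult_HH = tensor_mult_bilinear[OF CqSL2_complex_algebra CqSL2_complex_algebra, of q q]
lemmas H_cs = CqSL2_cspace[of q]

text \<open>Applying the coaction twice turns left multiplication by x into left multiplication by
  the twice coacted x. Together with the version for the coproduct, this reduces coassociativity on
  f e_k to coassociativity on f and on e_k separately.\<close>

lemma form_coassoc_lact_left:
  assumes x: "x \<in> carrier BH" and y: "y \<in> carrier OH"
  shows "tensor_assoc \<Omega> H H (tensor_map OH H form_coact id (lH x y))
    = lHH (tensor_assoc B H H (tensor_map BH H \<rho>\<^sub>B id x)) (tensor_assoc \<Omega> H H (tensor_map OH H form_coact id y))"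
proof -
  note mapB = tensor_map_linear[OF rho_linear complex_linear_id BqSU2_cspace tensor_space_cspace H_cs H_cs]
  note mapO = tensor_map_linear[OF form_coact_linear complex_linear_id forms_cspace tensor_space_cspace H_cs H_cs]
  have 1: "tensor_map OH H form_coact id (lH x y)
      = tensor_op OH H lH (\<otimes>\<^bsub>H\<^esub>) (tensor_map BH H \<rho>\<^sub>B id x) (tensor_map OH H form_coact id y)"
    by (rule tensor_map_op[OF lact_bilinear lH_bilinear mult_H mult_H rho_linear form_coact_linear form_coact_linear
          complex_linear_id complex_linear_id complex_linear_id
          BqSU2_cspace forms_cspace forms_cspace H_cs H_cs H_cs
          tensor_space_cspace tensor_space_cspace tensor_space_cspace H_cs H_cs H_cs])
      (simp_all add: form_coact_lact x y)
  have 2: "tensor_assoc \<Omega> H H (tensor_op OH H lH (\<otimes>\<^bsub>H\<^esub>) (tensor_map BH H \<rho>\<^sub>B id x) (tensor_map OH H form_coact id y))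
      = tensor_op \<Omega> HH (lact \<Omega>) (tensor_op H H (\<otimes>\<^bsub>H\<^esub>) (\<otimes>\<^bsub>H\<^esub>))
      (tensor_assoc B H H (tensor_map BH H \<rho>\<^sub>B id x)) (tensor_assoc \<Omega> H H (tensor_map OH H form_coact id y))"
    by (rule tensor_assoc_op[OF lact_bilinear mult_H mult_H BqSU2_cspace H_cs H_cs forms_cspace H_cs H_cs
          forms_cspace H_cs H_cs complex_linear_closed[OF mapB x] complex_linear_closed[OF mapO y]])
  show ?thesis
    unfolding 1 2 tensor_space_simps(2) ..
qed

lemma form_coassoc_lact_right:
  assumes x: "x \<in> carrier BH" and y: "y \<in> carrier OH"
  shows "tensor_map \<Omega> HH id (comult H) (lH x y)
    = lHH (tensor_map B HH id (comult H) x) (tensor_map \<Omega> HH id (comult H) y)"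
  by (rule tensor_map_op[OF lact_bilinear lact_bilinear mult_H mult_HH
        complex_linear_id complex_linear_id complex_linear_id Delta_linear Delta_linear Delta_linear
        BqSU2_cspace forms_cspace forms_cspace H_cs H_cs H_cs BqSU2_cspace forms_cspace forms_cspace
        tensor_space_cspace tensor_space_cspace tensor_space_cspace])
    (simp_all add: algebra_hom_mult[OF Delta_hom] x y)

lemma comult_form_coaction:
  "comult H (peval H z (tg q) (form_coaction i l))
    = (\<Oplus>\<^bsub>HH\<^esub>k\<in>UNIV. tens H H (peval H z (tg q) (form_coaction k l)) (peval H z (tg q) (form_coaction i k)))"
proof -
  have "comult H (peval H z (tg q) (form_coaction i l)) = peval HH z tt (psubst hq_comult (form_coaction i l))"
    unfolding peval_hom[where \<phi> = "tg q", OF CqSL2_complex_algebra Delta_hom HH tg_closed] comult_tg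
    by (rule peval_psubst[OF HH tt_closed z])
  also have "\<dots> = peval HH z tt (psum (\<lambda>k. pmul (pmap Fst (form_coaction k l)) (pmap Snd (form_coaction i k))) entries)"
    by (rule peval_eqI[OF HH tt_closed z two_hq_rules_sound form_coassoc_check[unfolded all_entries, rule_format]])
  also have "\<dots> = (\<Oplus>\<^bsub>HH\<^esub>k\<in>UNIV. tens H H (peval H z (tg q) (form_coaction k l)) (peval H z (tg q) (form_coaction i k)))"
    unfolding peval_psum_entries[where \<phi> = tt, OF HH tt_closed]
      tens_peval[where \<phi> = "tg q" and \<psi> = "tg q", OF CqSL2_complex_algebra CqSL2_complex_algebra tg_closed tg_closed z] ..
  finally show ?thesis .
qed

text \<open>Both sides expand to the double sum of e_l \<otimes> (T_kl \<otimes> T_ik): on the left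
  by coacting on e_k, on the right by the formula for the coproduct of T_il.\<close>

lemma basis_coaction_coassoc:
  "tensor_assoc \<Omega> H H (tensor_map OH H form_coact id (basis_coaction i)) = tensor_map \<Omega> HH id (comult H) (basis_coaction i)"
proof -
  let ?T = "\<lambda>i k. peval H z (tg q) (form_coaction i k)"
  let ?K = "\<lambda>y. tensor_assoc \<Omega> H H (tensor_map OH H form_coact id y)" and ?L = "tensor_map \<Omega> HH id (comult H)"
  let ?t = "\<lambda>k l. tens \<Omega> HH (bas l) (tens H H (?T k l) (?T i k))"
  have K: "?K \<in> complex_linear OH OHH"
    by (rule complex_linear_comp[OF tensor_map_linear[OF form_coact_linear complex_linear_id forms_cspace
          tensor_space_cspace H_cs H_cs] tensor_assoc_linear[OF forms_cspace H_cs H_cs]])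
  have L: "?L \<in> complex_linear OH OHH"
    by (rule tensor_map_linear[OF complex_linear_id Delta_linear forms_cspace forms_cspace H_cs tensor_space_cspace])
  have c: "tens \<Omega> H (bas k) (?T i k) \<in> carrier OH" for i k
    by (simp add: pH)
  have tc: "?t k l \<in> carrier OHH" for k l
    by (simp add: pH)
  have "?K (tens \<Omega> H (bas k) (?T i k)) = (\<Oplus>\<^bsub>OHH\<^esub>l\<in>UNIV. ?t k l)" for k
  proof -
    have lin: "(\<lambda>y. tensor_assoc \<Omega> H H (tens OH H y (?T i k))) \<in> complex_linear OH OHH"
      by (rule complex_linear_comp[OF complex_bilinear_left[OF tens_bilinear[OF tensor_space_cspace H_cs] pH(3)]
            tensor_assoc_linear[OF forms_cspace H_cs H_cs]])
    have "?K (tens \<Omega> H (bas k) (?T i k)) = tensor_assoc \<Omega> H H (tens OH H (basis_coaction k) (?T i k))"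
      by (simp add: tensor_map_tens[OF form_coact_linear complex_linear_id] H_cs pH form_coact_basis)
    also have "\<dots> = (\<Oplus>\<^bsub>OHH\<^esub>l\<in>UNIV. tensor_assoc \<Omega> H H (tens OH H (tens \<Omega> H (bas l) (?T k l)) (?T i k)))"
      unfolding basis_coaction_def
      by (rule complex_linear_finsum[OF tensor_space_cspace tensor_space_cspace lin]) (use c in simp)
    also have "\<dots> = (\<Oplus>\<^bsub>OHH\<^esub>l\<in>UNIV. ?t k l)"
      by (simp add: tensor_assoc_tens H_cs pH)
    finally show ?thesis .
  qed
  then have "?K (basis_coaction i) = (\<Oplus>\<^bsub>OHH\<^esub>k\<in>UNIV. \<Oplus>\<^bsub>OHH\<^esub>l\<in>UNIV. ?t k l)"
    unfolding basis_coaction_def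
    using complex_linear_finsum[OF tensor_space_cspace tensor_space_cspace K, of "\<lambda>k. tens \<Omega> H (bas k) (?T i k)" UNIV] c
    by simp
  also have "\<dots> = (\<Oplus>\<^bsub>OHH\<^esub>l\<in>UNIV. \<Oplus>\<^bsub>OHH\<^esub>k\<in>UNIV. ?t k l)"
    by (rule cs_finsum_swap[OF tensor_space_cspace finite finite tc])
  also have "\<dots> = (\<Oplus>\<^bsub>OHH\<^esub>l\<in>UNIV. ?L (tens \<Omega> H (bas l) (?T i l)))"
  proof -
    have "?L (tens \<Omega> H (bas l) (?T i l)) = tens \<Omega> HH (bas l) (\<Oplus>\<^bsub>HH\<^esub>k\<in>UNIV. tens H H (?T k l) (?T i k))" for l
      by (simp add: tensor_map_tens[OF complex_linear_id Delta_linear] H_cs pH comult_form_coaction)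
    also have "tens \<Omega> HH (bas l) (\<Oplus>\<^bsub>HH\<^esub>k\<in>UNIV. tens H H (?T k l) (?T i k)) = (\<Oplus>\<^bsub>OHH\<^esub>k\<in>UNIV. ?t k l)" for l
      by (rule complex_linear_finsum[OF tensor_space_cspace tensor_space_cspace
            complex_bilinear_right[OF tens_bilinear[OF forms_cspace tensor_space_cspace] basis_form_closed]])
        (simp add: pH)
    finally show ?thesis by simp
  qed
  also have "\<dots> = ?L (basis_coaction i)"
    unfolding basis_coaction_def
    by (rule complex_linear_finsum[OF tensor_space_cspace tensor_space_cspace L, symmetric]) (use c in simp)
  finally show ?thesis .
qed

lemma forms_comodule: "right_comodule H \<Omega> form_coact"
proof (intro right_comodule.intro right_comodule_axioms.intro)
  show "cspace \<Omega>" by simp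
  show "form_coact \<in> complex_linear \<Omega> OH" by (rule form_coact_linear)
  fix \<omega> assume \<omega>: "\<omega> \<in> carrier \<Omega>"
  interpret B: right_comodule_algebra H B \<rho>\<^sub>B
    by (rule adjoint_comodule_algebra)
  show "tensor_assoc \<Omega> H H (tensor_map OH H form_coact id (form_coact \<omega>)) = tensor_map \<Omega> HH id (comult H) (form_coact \<omega>)"
    using \<omega>
  proof (induction \<omega> rule: form_induct)
    case (basis f k)
    show ?case
      by (simp only: form_coact_lact[OF basis basis_form_closed] form_coact_basis basis_coaction_coassoc
          form_coassoc_lact_left[OF rho_B_closed[OF basis] basis_coaction_closed]
          form_coassoc_lact_right[OF rho_B_closed[OF basis] basis_coaction_closed] B.coaction_coassoc[OF basis])
  next
    case (add \<omega> \<eta>)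
    note D = complex_linear_add[OF form_coact_linear]
      complex_linear_add[OF tensor_map_linear[OF form_coact_linear complex_linear_id forms_cspace tensor_space_cspace H_cs H_cs]]
      complex_linear_closed[OF tensor_map_linear[OF form_coact_linear complex_linear_id forms_cspace tensor_space_cspace H_cs H_cs]]
      complex_linear_add[OF tensor_assoc_linear[OF forms_cspace H_cs H_cs]]
      complex_linear_add[OF tensor_map_linear[OF complex_linear_id Delta_linear forms_cspace forms_cspace H_cs tensor_space_cspace]]
    note c = form_coact_closed[OF add(1)] form_coact_closed[OF add(2)]
    show ?case
      by (simp only: D(1)[OF add(1,2)] D(2)[OF c] D(5)[OF c] D(4)[OF D(3)[OF c(1)] D(3)[OF c(2)]] add(3,4))
  qed
  let ?N = "tensor_lift \<Omega> (\<lambda>v h. counit H h \<odot>\<^bsub>\<Omega>\<^esub> v)" and ?NB = "tensor_lift B (\<lambda>v h. counit H h \<odot>\<^bsub>B\<^esub> v)"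
  note N = tensor_lift_linear[OF forms_cspace H_cs forms_cspace counit_bilinear[OF forms_cspace]]
  note Nt = tensor_lift_tens[OF forms_cspace H_cs forms_cspace counit_bilinear[OF forms_cspace]]
  note NB = tensor_lift_linear[OF BqSU2_cspace H_cs BqSU2_cspace counit_bilinear[OF BqSU2_cspace]]
  note NBt = tensor_lift_tens[OF BqSU2_cspace H_cs BqSU2_cspace counit_bilinear[OF BqSU2_cspace]]
  \<comment> \<open>Applying the counit to the H-factor is compatible with left multiplication, so
    the counit law for f e_k splits into the law for f, known in B, and the law for e_k.\<close>
  have N_lact: "?N (lH x y) = ?NB x \<triangleright>\<^bsub>\<Omega>\<^esub> ?N y" if x: "x \<in> carrier BH" and y: "y \<in> carrier OH" for x y
    using BqSU2_cspace H_cs x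
  proof (induction x rule: tensor_induct)
    case (tens v h)
    show ?case
      using forms_cspace H_cs y
      by (induction y rule: tensor_induct)
        (simp_all add: tens lH_tens Nt NBt lact_cl complex_bilinearD[OF lH_bilinear] complex_linearD[OF N]
          algebra_hom_mult[OF eps_hom] complex_numbers_simps complex_bilinearD[OF lact_bilinear] cs_smult_smult[OF forms_cspace]
          mult.commute)
  next
    case (add x x')
    then show ?case
      using y by (simp add: complex_bilinearD[OF lH_bilinear] complex_linearD[OF N] complex_linearD[OF NB]
          complex_bilinearD[OF lact_bilinear])
  qed
  \<comment> \<open>The counit sends the matrix of coefficients t^m_\<alpha> S t^\<beta>_n to the
    identity matrix; the sixteen entries are evaluated one by one.\<close>
  have eps: "counit H (peval H z (tg q) (form_coaction i k)) = (if k = i then 1 else 0)" for i k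
    unfolding peval_hom[where \<phi> = "tg q", OF CqSL2_complex_algebra eps_hom complex_numbers_algebra tg_closed]
    using q by (cases i; cases k; cases "fst i"; cases "snd i"; cases "fst k"; cases "snd k")
      (simp_all add: form_coaction_def counit_tg complex_numbers_simps coef_def)
  have N_basis: "?N (basis_coaction i) = bas i" for i
  proof -
    have "?N (basis_coaction i) = (\<Oplus>\<^bsub>\<Omega>\<^esub>k\<in>UNIV. ?N (tens \<Omega> H (bas k) (peval H z (tg q) (form_coaction i k))))"
      unfolding basis_coaction_def
      by (rule complex_linear_finsum[OF tensor_space_cspace forms_cspace N]) (simp add: pH)
    also have "\<dots> = (\<Oplus>\<^bsub>\<Omega>\<^esub>k\<in>UNIV. if k = i then bas i else \<zero>\<^bsub>\<Omega>\<^esub>)"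
      by (intro cs_finsum_cong[OF forms_cspace]) (auto simp: Nt pH eps)
    also have "\<dots> = bas i"
      by (rule cs_finsum_delta[OF forms_cspace basis_form_closed])
    finally show ?thesis .
  qed
  show "?N (form_coact \<omega>) = \<omega>"
    using \<omega>
  proof (induction \<omega> rule: form_induct)
    case (basis f k)
    show ?case
      by (simp only: form_coact_lact[OF basis basis_form_closed] form_coact_basis
          N_lact[OF rho_B_closed[OF basis] basis_coaction_closed] N_basis B.coaction_counit[OF basis])
  next
    case (add \<omega> \<eta>)
    then show ?case
      by (simp add: complex_linear_add[OF form_coact_linear] complex_linear_add[OF N] form_coact_closed)
  qed
qed

lemma form_coact_basis_formula:
  "form_coact (bas (unix (\<alpha>, \<beta>))) = (\<Oplus>\<^bsub>OH\<^esub>m\<in>UNIV. \<Oplus>\<^bsub>OH\<^esub>n\<in>UNIV.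
     tens \<Omega> H (bas (unix (m, n))) (t_gen q m \<alpha> \<otimes>\<^bsub>H\<^esub> antipode H (t_gen q \<beta> n)))"
proof -
  let ?t = "\<lambda>k. tens \<Omega> H (bas k) (peval H z (tg q) (form_coaction (unix (\<alpha>, \<beta>)) k))"
  have H: "t_gen q (idx a) \<alpha> \<otimes>\<^bsub>H\<^esub> antipode H (t_gen q \<beta> (idx b)) = peval H z (tg q) (form_coaction (unix (\<alpha>, \<beta>)) (a, b))" for a b
  proof -
    have "t_gen q (idx a) \<alpha> = tg q (a, unidx \<alpha>)" "t_gen q \<beta> (idx b) = tg q (unidx \<beta>, b)"
      by (simp_all add: tg_def)
    then show ?thesis
      unfolding form_coaction_def by (simp only: pH tg_peval antipode_tg unix_def fst_conv snd_conv)
  qed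
  have c: "?t k \<in> carrier OH" for k
    by (simp add: pH)
  have "(\<Oplus>\<^bsub>OH\<^esub>m\<in>UNIV. \<Oplus>\<^bsub>OH\<^esub>n\<in>UNIV. tens \<Omega> H (bas (unix (m, n))) (t_gen q m \<alpha> \<otimes>\<^bsub>H\<^esub> antipode H (t_gen q \<beta> n)))
      = (?t (False, False) \<oplus>\<^bsub>OH\<^esub> ?t (False, True)) \<oplus>\<^bsub>OH\<^esub> (?t (True, False) \<oplus>\<^bsub>OH\<^esub> ?t (True, True))"
    using c by (simp add: finsum_idx H unix_def)
  also have "\<dots> = form_coact (bas (unix (\<alpha>, \<beta>)))"
    using c by (simp add: form_coact_basis basis_coaction_def finsum_entries cs_assoc[OF tensor_space_cspace])
  finally show ?thesis ..
qed

end

theorem proposition5: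
  fixes q :: real
  assumes "q \<noteq> 0" and "q\<^sup>2 \<noteq> 1"
  shows "\<exists>(\<Omega> :: (bq, 2 \<Rightarrow> 2 \<Rightarrow> bq) bimodule) d e \<rho>\<Omega>.
    first_order_calculus (BqSU2 q) \<Omega> d \<and>
    free_left_basis (BqSU2 q) \<Omega> e \<and>
    calculus_relations q \<Omega> e \<and>
    covariant_calculus (CqSL2 q) (BqSU2 q) (adjoint_coaction q) \<Omega> d \<rho>\<Omega> \<and>
    (\<forall>\<alpha> \<beta>. \<rho>\<Omega> (e \<alpha> \<beta>) =
      (\<Oplus>\<^bsub>tensor_space \<Omega> (CqSL2 q)\<^esub>m\<in>UNIV. \<Oplus>\<^bsub>tensor_space \<Omega> (CqSL2 q)\<^esub>n\<in>UNIV.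
         tens \<Omega> (CqSL2 q) (e m n)
           (t_gen q m \<alpha> \<otimes>\<^bsub>CqSL2 q\<^esub> antipode (CqSL2 q) (t_gen q \<beta> n)))) \<and>
    (\<forall>f\<in>carrier (BqSU2 q).
      d f = complex_of_real (inverse (1 - 1 / q\<^sup>2)) \<odot>\<^bsub>\<Omega>\<^esub>
        ((e 1 1 \<oplus>\<^bsub>\<Omega>\<^esub> e 2 2) \<triangleleft>\<^bsub>\<Omega>\<^esub> f \<ominus>\<^bsub>\<Omega>\<^esub> f \<triangleright>\<^bsub>\<Omega>\<^esub> (e 1 1 \<oplus>\<^bsub>\<Omega>\<^esub> e 2 2)))"
proof -
  interpret calculus_parameter q
    using assms by unfold_locales
  let ?e = "\<lambda>i j. basis_form q (unix (i, j))"
  have cov: "covariant_calculus H B \<rho>\<^sub>B \<Omega> differential form_coact"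
    using form_coact_lact form_coact_ract form_coact_differential
    by (intro covariant_calculus.intro covariant_calculus_axioms.intro forms_calculus
        adjoint_comodule_algebra forms_comodule)
  have \<theta>: "theta_form = ?e 1 1 \<oplus>\<^bsub>\<Omega>\<^esub> ?e 2 2"
    by (simp add: theta_form_def unix_def unidx_def)
  show ?thesis
    using forms_calculus forms_free_left_basis forms_calculus_relations cov form_coact_basis_formula
    by (intro exI[of _ \<Omega>] exI[of _ differential] exI[of _ ?e] exI[of _ form_coact] conjI allI ballI)
      (simp_all only: differential_def \<theta>)
qed

end
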